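(* For $n\ge1$ let $\mathcal{S}_n=\{k/n:k\in\mathbb{N}\}$ and, on the toy Fock space $T\Phi(n)=T\Phi(\mathcal{S}_n)$, consider the operators $X_i^{(n)}=a_i^++a_i^-$, $i\in\mathbb{N}$. Then: (1) For all $n\ge1$, the family $\{X_i^{(n)}\}_{i\in\mathbb{N}}$ is a free family (with respect to the vacuum state) of Bernoulli random variables of distribution $\frac12\delta_{-1}+\frac12\delta_1$. (2) For all $t\in\mathbb{R}_+$, the operator $$W_t^{(n)}=\frac1{\sqrt n}\sum_{i=0}^{\lfloor nt\rfloor}X_i^{(n)}$$ (regarded as an operator on $\Phi$ vanishing on $T\Phi(n)^\perp$) converges in the strong operator topology, as $n\to\infty$, to the free Brownian motion operator $W_t=a_t^++a_t^-$ on $\Phi$.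
   Context: Free Fock space: $\Phi=\mathcal{F}(L^2(\mathbb{R}_+;\mathbb{C}))=\mathbb{C}\Omega\oplus\bigoplus_{m\ge1}L^2(\mathbb{R}_+^m)$ (orthogonal Hilbert sum, $L^2(\mathbb{R}_+)^{\otimes m}=L^2(\mathbb{R}_+^m)$), with vacuum vector $\Omega$, $\|\Omega\|=1$. For real-valued $h\in L^2(\mathbb{R}_+)$: $a^+(h)\Omega=h$, $a^+(h)f_m=h\otimes f_m$; $a^-(h)\Omega=0$, $(a^-(h)f_m)(x_2,\dots,x_m)=\int h(x)f_m(x,x_2,\dots,x_m)\,dx$ for $f_m\in L^2(\mathbb{R}_+^m)$ (for $m=1$ this is $(\int hf_1)\Omega$). Put $a_t^\pm=a^\pm(\mathbf{1}_{[0,t)})$. Toy Fock space of $\mathcal{S}_n$: with $\mathbb{N}=\{0,1,2,\dots\}$, put $X_i=\sqrt n\,\mathbf{1}_{[i/n,(i+1)/n)}$. A finite word $\sigma=[\sigma_1,\dots,\sigma_m]$ in $\mathbb{N}$ is adapted if $\sigma_j\neq\sigma_{j+1}$ for all $j$; the empty word is adapted. $X_\sigma=X_{\sigma_1}\otimes\cdots\otimes X_{\sigma_m}$, $X_\emptyset=\Omega$. $T\Phi(n)$ is the closed subspace of $\Phi$ with orthonormal basis $\{X_\sigma\}_{\sigma\text{ adapted}}$. The operators $a_i^\pm$ on $T\Phi(n)$ are given by $a_i^+\Omega=X_i$, $a_i^+X_\sigma=\mathbf{1}_{\sigma_1\ne i}X_{[i,\sigma_1,\dots,\sigma_m]}$;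 $a_i^-\Omega=0$, $a_i^-X_\sigma=\mathbf{1}_{\sigma_1=i}X_{[\sigma_2,\dots,\sigma_m]}$ for $\sigma=[\sigma_1,\dots,\sigma_m]$ non-empty adapted; they are extended by $0$ on $T\Phi(n)^\perp$ to operators on $\Phi$. The vacuum state is $\phi(T)=\langle\Omega,T\Omega\rangle$ on $\mathcal{B}(T\Phi(n))$. A self-adjoint operator $X$ has distribution $\mu$ (a compactly supported probability measure on $\mathbb{R}$) if $\phi(X^k)=\int x^k\,d\mu(x)$ for all $k\in\mathbb{N}$. Unital subalgebras $(\mathcal{A}_i)_{i\in I}$ are free if $\phi(b_1\cdots b_m)=0$ for all $m\ge1$ whenever $b_k\in\mathcal{A}_{j(k)}$, $\phi(b_k)=0$ for all $k$, and $j(k)\ne j(k+1)$ for all $1\le k<m$; a family of random variables is free if the unital algebras they generate are free. *)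

theory Defs
  imports "HOL-Probability.Probability"
begin

section \<open>Square-integrable functions\<close>

definition square_integrable :: "'a measure \<Rightarrow> ('a \<Rightarrow> 'b::{real_normed_vector, second_countable_topology}) \<Rightarrow> bool" where
  "square_integrable M f \<longleftrightarrow> f \<in> borel_measurable M \<and> integrable M (\<lambda>x. (norm (f x))\<^sup>2)"

lemma square_integrable_iff_nn:
  "square_integrable M f \<longleftrightarrow>
     f \<in> borel_measurable M \<and> (\<integral>\<^sup>+x. ennreal ((norm (f x))\<^sup>2) \<partial>M) < \<infinity>"
  by (auto simp: square_integrable_def integrable_iff_bounded)

lemma square_integrable_measurable: "square_integrable M f \<Longrightarrow> f \<in> borel_measurable M"
  by (simp add: square_integrable_def)

lemma integral_norm_square_eq_nn:
  fixes f :: "'a \<Rightarrow> 'b::{real_normed_vector, second_countable_topology}"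
  assumes "square_integrable M f"
  shows "ennreal (\<integral>x. (norm (f x))\<^sup>2 \<partial>M) = (\<integral>\<^sup>+x. ennreal ((norm (f x))\<^sup>2) \<partial>M)"
  using assms by (subst nn_integral_eq_integral) (auto simp: square_integrable_def)

lemma borel_measurable_cnj [measurable (raw)]:
  "f \<in> borel_measurable M \<Longrightarrow> (\<lambda>x. cnj (f x)) \<in> borel_measurable M"
  by (rule borel_measurable_continuous_on[of cnj]) (auto intro!: continuous_intros)

lemma square_integrable_mult:
  fixes f g :: "'a \<Rightarrow> complex"
  assumes "square_integrable M f" "square_integrable M g"
  shows "integrable M (\<lambda>x. cnj (f x) * g x)"
    and "norm (\<integral>x. cnj (f x) * g x \<partial>M) \<le> (\<integral>x. (norm (f x))\<^sup>2 \<partial>M) + (\<integral>x. (norm (g x))\<^sup>2 \<partial>M)"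
proof -
  have [measurable]: "f \<in> borel_measurable M" "g \<in> borel_measurable M"
    using assms by (auto simp: square_integrable_def)
  have I: "integrable M (\<lambda>x. (norm (f x))\<^sup>2 + (norm (g x))\<^sup>2)"
    using assms by (auto simp: square_integrable_def)
  have b: "norm (cnj (f x) * g x) \<le> (norm (f x))\<^sup>2 + (norm (g x))\<^sup>2" for x
  proof -
    have "0 \<le> (norm (f x) - norm (g x))\<^sup>2" by simp
    hence "2 * (norm (f x) * norm (g x)) \<le> (norm (f x))\<^sup>2 + (norm (g x))\<^sup>2"
      by (simp add: power2_diff)
    moreover have "0 \<le> norm (f x) * norm (g x)" by simp
    ultimately show ?thesis unfolding norm_mult complex_mod_cnj by linarith
  qed
  show J: "integrable M (\<lambda>x. cnj (f x) * g x)"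
    by (rule Bochner_Integration.integrable_bound[OF I]) (use b in auto)
  have "norm (\<integral>x. cnj (f x) * g x \<partial>M) \<le> (\<integral>x. norm (cnj (f x) * g x) \<partial>M)"
    by (rule integral_norm_bound)
  also have "\<dots> \<le> (\<integral>x. (norm (f x))\<^sup>2 + (norm (g x))\<^sup>2 \<partial>M)"
    by (rule integral_mono) (use J I b in auto)
  finally show "norm (\<integral>x. cnj (f x) * g x \<partial>M) \<le> (\<integral>x. (norm (f x))\<^sup>2 \<partial>M) + (\<integral>x. (norm (g x))\<^sup>2 \<partial>M)"
    using assms by (simp add: square_integrable_def)
qed

lemma square_integrable_add:
  fixes f g :: "'a \<Rightarrow> complex"
  assumes "square_integrable M f" "square_integrable M g"
  shows "square_integrable M (\<lambda>x. f x + g x)"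
    and "(\<integral>x. (norm (f x + g x))\<^sup>2 \<partial>M) \<le> 2 * (\<integral>x. (norm (f x))\<^sup>2 \<partial>M) + 2 * (\<integral>x. (norm (g x))\<^sup>2 \<partial>M)"
proof -
  have [measurable]: "f \<in> borel_measurable M" "g \<in> borel_measurable M"
    using assms by (auto simp: square_integrable_def)
  have I: "integrable M (\<lambda>x. 2 * (norm (f x))\<^sup>2 + 2 * (norm (g x))\<^sup>2)"
    using assms by (auto simp: square_integrable_def)
  have b: "(norm (f x + g x))\<^sup>2 \<le> 2 * (norm (f x))\<^sup>2 + 2 * (norm (g x))\<^sup>2" for x
  proof -
    have "(norm (f x + g x))\<^sup>2 \<le> (norm (f x) + norm (g x))\<^sup>2"
      by (rule power_mono[OF norm_triangle_ineq]) simp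
    moreover have "0 \<le> (norm (f x) - norm (g x))\<^sup>2" by simp
    ultimately show ?thesis by (simp add: power2_diff power2_sum)
  qed
  have J: "integrable M (\<lambda>x. (norm (f x + g x))\<^sup>2)"
    by (rule Bochner_Integration.integrable_bound[OF I]) (use b in auto)
  show "square_integrable M (\<lambda>x. f x + g x)"
    using J by (simp add: square_integrable_def)
  have "(\<integral>x. (norm (f x + g x))\<^sup>2 \<partial>M) \<le> (\<integral>x. 2 * (norm (f x))\<^sup>2 + 2 * (norm (g x))\<^sup>2 \<partial>M)"
    by (rule integral_mono[OF J I]) (rule b)
  thus "(\<integral>x. (norm (f x + g x))\<^sup>2 \<partial>M) \<le> 2 * (\<integral>x. (norm (f x))\<^sup>2 \<partial>M) + 2 * (\<integral>x. (norm (g x))\<^sup>2 \<partial>M)"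
    using assms by (simp add: square_integrable_def)
qed

lemma square_integrable_scale:
  fixes f :: "'a \<Rightarrow> complex"
  assumes "square_integrable M f"
  shows "square_integrable M (\<lambda>x. c * f x)"
  using assms by (auto simp: square_integrable_def norm_mult power_mult_distrib)


section \<open>The free Fock space\<close>

abbreviation half_line :: "real measure" where
  "half_line \<equiv> restrict_space lborel {0..}"

text \<open>Points of \<open>particle m\<close> are functions on the naturals that are \<^const>\<open>undefined\<close> outside
  \<open>{..<m}\<close>; \<open>particle 0\<close> is the one-point space, whose \<open>L\<^sup>2\<close> is the vacuum line.\<close>

definition particle :: "nat \<Rightarrow> (nat \<Rightarrow> real) measure" where
  "particle m = Pi\<^sub>M {..<m} (\<lambda>_. half_line)"

definition fock_fun :: "(nat \<Rightarrow> (nat \<Rightarrow> real) \<Rightarrow> complex) \<Rightarrow> bool" where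
  "fock_fun f \<longleftrightarrow> (\<forall>m. square_integrable (particle m) (f m)) \<and>
     summable (\<lambda>m. \<integral>x. (norm (f m x))\<^sup>2 \<partial>particle m)"

definition fock_rel ::
  "(nat \<Rightarrow> (nat \<Rightarrow> real) \<Rightarrow> complex) \<Rightarrow> (nat \<Rightarrow> (nat \<Rightarrow> real) \<Rightarrow> complex) \<Rightarrow> bool" where
  "fock_rel f g \<longleftrightarrow> fock_fun f \<and> fock_fun g \<and> (\<forall>m. AE x in particle m. f m x = g m x)"

lemma fock_fun_zero: "fock_fun (\<lambda>m x. 0)"
  by (simp add: fock_fun_def square_integrable_def)

lemma fock_fun_add:
  assumes "fock_fun f" "fock_fun g"
  shows "fock_fun (\<lambda>m x. f m x + g m x)"
proof -
  have "summable (\<lambda>m. 2 * (\<integral>x. (norm (f m x))\<^sup>2 \<partial>particle m) + 2 * (\<integral>x. (norm (g m x))\<^sup>2 \<partial>particle m))"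
    using assms by (intro summable_add summable_mult) (auto simp: fock_fun_def)
  hence "summable (\<lambda>m. \<integral>x. (norm (f m x + g m x))\<^sup>2 \<partial>particle m)"
    by (rule summable_comparison_test[rotated])
       (use assms in \<open>auto simp: fock_fun_def intro!: exI[of _ 0] square_integrable_add(2)\<close>)
  thus ?thesis using assms by (auto simp: fock_fun_def intro: square_integrable_add(1))
qed

lemma fock_fun_scale:
  assumes "fock_fun f"
  shows "fock_fun (\<lambda>m x. c * f m x)"
proof -
  have "summable (\<lambda>m. (norm c)\<^sup>2 * (\<integral>x. (norm (f m x))\<^sup>2 \<partial>particle m))"
    using assms by (intro summable_mult) (auto simp: fock_fun_def)
  thus ?thesis using assms
    by (auto simp: fock_fun_def norm_mult power_mult_distrib intro: square_integrable_scale)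
qed

lemma fock_fun_summable_inner:
  assumes "fock_fun f" "fock_fun g"
  shows "summable (\<lambda>m. \<integral>x. cnj (f m x) * g m x \<partial>particle m)"
proof (rule summable_comparison_test)
  show "\<exists>N. \<forall>m\<ge>N. norm (\<integral>x. cnj (f m x) * g m x \<partial>particle m) \<le>
      (\<integral>x. (norm (f m x))\<^sup>2 \<partial>particle m) + (\<integral>x. (norm (g m x))\<^sup>2 \<partial>particle m)"
    using assms by (auto simp: fock_fun_def intro!: exI[of _ 0] square_integrable_mult(2))
  show "summable (\<lambda>m. (\<integral>x. (norm (f m x))\<^sup>2 \<partial>particle m) + (\<integral>x. (norm (g m x))\<^sup>2 \<partial>particle m))"
    using assms by (intro summable_add) (auto simp: fock_fun_def)
qed

quotient_type fock = "nat \<Rightarrow> (nat \<Rightarrow> real) \<Rightarrow> complex" / partial: fock_rel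
proof (rule part_equivpI)
  show "\<exists>f. fock_rel f f"
    using fock_fun_zero by (auto simp: fock_rel_def)
  show "symp fock_rel"
    by (rule sympI) (auto simp: fock_rel_def eq_commute)
  show "transp fock_rel"
  proof (rule transpI)
    fix f g h assume *: "fock_rel f g" "fock_rel g h"
    have "AE x in particle m. f m x = h m x" for m
    proof -
      have "AE x in particle m. f m x = g m x" "AE x in particle m. g m x = h m x"
        using * by (auto simp: fock_rel_def)
      thus ?thesis by eventually_elim simp
    qed
    thus "fock_rel f h" using * by (auto simp: fock_rel_def)
  qed
qed

lift_definition cscale :: "complex \<Rightarrow> fock \<Rightarrow> fock" (infixr "*\<^sub>C" 75)
  is "\<lambda>c f m x. c * f m x"
  by (auto simp: fock_rel_def intro: fock_fun_scale)

lift_definition cinner :: "fock \<Rightarrow> fock \<Rightarrow> complex"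
  is "\<lambda>f g. \<Sum>m. \<integral>x. cnj (f m x) * g m x \<partial>particle m"
proof -
  fix f f' g g' assume *: "fock_rel f f'" "fock_rel g g'"
  have "(\<integral>x. cnj (f m x) * g m x \<partial>particle m) = (\<integral>x. cnj (f' m x) * g' m x \<partial>particle m)" for m
  proof (rule integral_cong_AE)
    have [measurable]: "f m \<in> borel_measurable (particle m)" "g m \<in> borel_measurable (particle m)"
      "f' m \<in> borel_measurable (particle m)" "g' m \<in> borel_measurable (particle m)"
      using * by (auto simp: fock_rel_def fock_fun_def square_integrable_def)
    show "(\<lambda>x. cnj (f m x) * g m x) \<in> borel_measurable (particle m)"
      "(\<lambda>x. cnj (f' m x) * g' m x) \<in> borel_measurable (particle m)"
      by measurable
    have "AE x in particle m. f m x = f' m x" "AE x in particle m. g m x = g' m x"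
      using * by (auto simp: fock_rel_def)
    thus "AE x in particle m. cnj (f m x) * g m x = cnj (f' m x) * g' m x"
      by eventually_elim simp
  qed
  thus "(\<Sum>m. \<integral>x. cnj (f m x) * g m x \<partial>particle m) = (\<Sum>m. \<integral>x. cnj (f' m x) * g' m x \<partial>particle m)"
    by simp
qed

lemma fock_rel_self: "fock_fun f \<Longrightarrow> g = f \<Longrightarrow> fock_rel f g"
  by (simp add: fock_rel_def)

lemma fock_rel_self_iff: "fock_rel f f \<longleftrightarrow> fock_fun f"
  by (simp add: fock_rel_def)

instantiation fock :: ab_group_add
begin

lift_definition zero_fock :: fock is "\<lambda>m x. 0"
  using fock_fun_zero by (simp add: fock_rel_def)

lift_definition plus_fock :: "fock \<Rightarrow> fock \<Rightarrow> fock" is "\<lambda>f g m x. f m x + g m x"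
proof -
  fix f f' g g' assume *: "fock_rel f f'" "fock_rel g g'"
  have "AE x in particle m. f m x + g m x = f' m x + g' m x" for m
  proof -
    have "AE x in particle m. f m x = f' m x" "AE x in particle m. g m x = g' m x"
      using * by (auto simp: fock_rel_def)
    thus ?thesis by eventually_elim simp
  qed
  thus "fock_rel (\<lambda>m x. f m x + g m x) (\<lambda>m x. f' m x + g' m x)"
    using * by (auto simp: fock_rel_def intro: fock_fun_add)
qed

definition uminus_fock :: "fock \<Rightarrow> fock" where "uminus_fock f = (- 1) *\<^sub>C f"

definition minus_fock :: "fock \<Rightarrow> fock \<Rightarrow> fock" where "minus_fock f g = f + - g"

instance
proof
  fix a b c :: fock
  show "a + b + c = a + (b + c)"
    by transfer (intro fock_rel_self fock_fun_add, simp_all add: fock_rel_self_iff add.assoc)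
  show "a + b = b + a"
    by transfer (intro fock_rel_self fock_fun_add, simp_all add: fock_rel_self_iff add.commute)
  show "0 + a = a"
    by transfer simp
  show "- a + a = 0"
    unfolding uminus_fock_def
    by transfer (simp add: fock_rel_self_iff fock_fun_zero)
  show "a - b = a + - b" by (simp add: minus_fock_def)
qed

end

lemma cscale_add_right: "c *\<^sub>C (f + g) = c *\<^sub>C f + c *\<^sub>C g"
  by transfer
     (intro fock_rel_self fock_fun_scale fock_fun_add, simp_all add: fock_rel_self_iff distrib_left)

lemma cscale_add_left: "(c + d) *\<^sub>C f = c *\<^sub>C f + d *\<^sub>C f"
  by transfer (intro fock_rel_self fock_fun_scale, simp_all add: fock_rel_self_iff distrib_right)

lemma cscale_cscale: "c *\<^sub>C d *\<^sub>C f = (c * d) *\<^sub>C f"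
  by transfer (intro fock_rel_self fock_fun_scale, simp_all add: fock_rel_self_iff mult.assoc)

lemma cscale_one: "1 *\<^sub>C f = f"
  by transfer simp

lemma cinner_add_right: "cinner f (g + h) = cinner f g + cinner f h"
proof (transfer, goal_cases)
  case (1 f g h)
  hence *: "fock_fun f" "fock_fun g" "fock_fun h" by (auto simp: fock_rel_def)
  have "(\<integral>x. cnj (f m x) * (g m x + h m x) \<partial>particle m) =
      (\<integral>x. cnj (f m x) * g m x \<partial>particle m) + (\<integral>x. cnj (f m x) * h m x \<partial>particle m)" for m
    unfolding distrib_left
    by (rule Bochner_Integration.integral_add)
       (use * in \<open>auto simp: fock_fun_def intro!: square_integrable_mult(1)\<close>)
  thus ?case
    using * by (simp add: suminf_add fock_fun_summable_inner)
qed

lemma cinner_cscale_right: "cinner f (c *\<^sub>C g) = c * cinner f g"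
proof (transfer, goal_cases)
  case (1 f c g)
  hence *: "fock_fun f" "fock_fun g" by (auto simp: fock_rel_def)
  have "(\<integral>x. cnj (f m x) * (c * g m x) \<partial>particle m) = c * (\<integral>x. cnj (f m x) * g m x \<partial>particle m)" for m
    by (simp add: mult.left_commute)
  thus ?case
    using * by (simp add: suminf_mult fock_fun_summable_inner)
qed

lemma cinner_commute: "cinner f g = cnj (cinner g f)"
proof (transfer, goal_cases)
  case (1 f g)
  hence *: "fock_fun f" "fock_fun g" by (auto simp: fock_rel_def)
  have "(\<integral>x. cnj (f m x) * g m x \<partial>particle m) = cnj (\<integral>x. cnj (g m x) * f m x \<partial>particle m)" for m
    using Bochner_Integration.integral_cnj[of "particle m" "\<lambda>x. cnj (g m x) * f m x"] by (simp add: mult.commute)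
  hence "(\<Sum>m. \<integral>x. cnj (f m x) * g m x \<partial>particle m) =
      (\<Sum>m. cnj (\<integral>x. cnj (g m x) * f m x \<partial>particle m))" by simp
  also have "\<dots> = cnj (\<Sum>m. \<integral>x. cnj (g m x) * f m x \<partial>particle m)"
    by (rule bounded_linear.suminf[OF bounded_linear_cnj, symmetric])
       (use * in \<open>auto intro: fock_fun_summable_inner\<close>)
  finally show ?case .
qed

lemma cinner_self:
  assumes "fock_fun f"
  shows "(\<Sum>m. \<integral>x. cnj (f m x) * f m x \<partial>particle m) =
    of_real (\<Sum>m. \<integral>x. (norm (f m x))\<^sup>2 \<partial>particle m)"
proof -
  have "(\<integral>x. cnj (f m x) * f m x \<partial>particle m) = of_real (\<integral>x. (norm (f m x))\<^sup>2 \<partial>particle m)" for m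
    unfolding integral_complex_of_real[symmetric] by (simp only: complex_norm_square mult.commute)
  thus ?thesis
    using assms by (simp add: suminf_of_real fock_fun_def)
qed

lemma cinner_self_nonneg: "0 \<le> Re (cinner f f)"
  by transfer (auto simp: fock_rel_def cinner_self fock_fun_def intro!: suminf_nonneg)

lemma cinner_self_eq_0: "Re (cinner f f) = 0 \<longleftrightarrow> f = 0"
proof (transfer, goal_cases)
  case (1 f)
  hence f: "fock_fun f" by (auto simp: fock_rel_def)
  have "(\<integral>x. (norm (f m x))\<^sup>2 \<partial>particle m) = 0 \<longleftrightarrow> (AE x in particle m. f m x = 0)" for m
    using f by (subst integral_nonneg_eq_0_iff_AE) (auto simp: fock_fun_def square_integrable_def)
  moreover have "(\<Sum>m. \<integral>x. (norm (f m x))\<^sup>2 \<partial>particle m) = 0 \<longleftrightarrow>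
      (\<forall>m. (\<integral>x. (norm (f m x))\<^sup>2 \<partial>particle m) = 0)"
    using f by (intro suminf_eq_zero_iff) (auto simp: fock_fun_def)
  ultimately show ?case
    by (simp add: cinner_self[OF f] fock_rel_def f fock_fun_zero)
qed

instantiation fock :: real_inner
begin

definition scaleR_fock :: "real \<Rightarrow> fock \<Rightarrow> fock" where "scaleR_fock r f = of_real r *\<^sub>C f"
definition inner_fock :: "fock \<Rightarrow> fock \<Rightarrow> real" where "inner_fock f g = Re (cinner f g)"
definition norm_fock :: "fock \<Rightarrow> real" where "norm_fock f = sqrt (inner f f)"
definition sgn_fock :: "fock \<Rightarrow> fock" where "sgn_fock f = inverse (norm f) *\<^sub>R f"
definition dist_fock :: "fock \<Rightarrow> fock \<Rightarrow> real" where "dist_fock f g = norm (f - g)"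
definition uniformity_fock :: "(fock \<times> fock) filter" where
  "uniformity_fock = (INF e\<in>{0 <..}. principal {(f, g). dist f g < e})"
definition open_fock :: "fock set \<Rightarrow> bool" where
  "open_fock U \<longleftrightarrow> (\<forall>x\<in>U. eventually (\<lambda>(x', y). x' = x \<longrightarrow> y \<in> U) uniformity)"

instance
proof
  fix a b c :: fock and r s :: real and U :: "fock set"
  show "r *\<^sub>R (a + b) = r *\<^sub>R a + r *\<^sub>R b" by (simp add: scaleR_fock_def cscale_add_right)
  show "(r + s) *\<^sub>R a = r *\<^sub>R a + s *\<^sub>R a" by (simp add: scaleR_fock_def cscale_add_left)
  show "r *\<^sub>R s *\<^sub>R a = (r * s) *\<^sub>R a" by (simp add: scaleR_fock_def cscale_cscale)
  show "1 *\<^sub>R a = a" by (simp add: scaleR_fock_def cscale_one)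
  show "sgn a = inverse (norm a) *\<^sub>R a" by (simp add: sgn_fock_def)
  show "dist a b = norm (a - b)" by (simp add: dist_fock_def)
  show "uniformity = (INF e\<in>{0 <..}. principal {(f, g :: fock). dist f g < e})"
    by (simp add: uniformity_fock_def)
  show "open U \<longleftrightarrow> (\<forall>x\<in>U. eventually (\<lambda>(x', y). x' = x \<longrightarrow> y \<in> U) uniformity)"
    by (simp add: open_fock_def)
  show "inner a b = inner b a"
    by (simp add: inner_fock_def cinner_commute[of a b])
  show "inner (a + b) c = inner a c + inner b c"
    by (simp add: inner_fock_def cinner_add_right cinner_commute[of "a + b" c]
        cinner_commute[of a c] cinner_commute[of b c])
  show "inner (r *\<^sub>R a) b = r * inner a b"
    by (simp add: inner_fock_def scaleR_fock_def cinner_cscale_right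
        cinner_commute[of "of_real r *\<^sub>C a" b] cinner_commute[of a b])
  show "0 \<le> inner a a" by (simp add: inner_fock_def cinner_self_nonneg)
  show "inner a a = 0 \<longleftrightarrow> a = 0" by (simp add: inner_fock_def cinner_self_eq_0)
  show "norm a = sqrt (inner a a)" by (simp add: norm_fock_def)
qed

end

global_interpretation complex_fock: vector_space cscale
  by standard (auto simp: cscale_add_right cscale_add_left cscale_cscale cscale_one)


subsection \<open>Creation and annihilation operators\<close>

interpretation half_line: sigma_finite_measure half_line
  by (rule sigma_finite_measure_restrict_space[OF lborel.sigma_finite_measure_axioms]) simp

interpretation half_lines: product_sigma_finite "\<lambda>_::nat. half_line"
  by (simp add: product_sigma_finite_def half_line.sigma_finite_measure_axioms)

lemma sigma_finite_particle: "sigma_finite_measure (particle m)"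
  unfolding particle_def by (rule half_lines.sigma_finite) simp

lemma measurable_case_nat_particle [measurable]:
  "(\<lambda>(x, y). case_nat y x) \<in> particle m \<Otimes>\<^sub>M half_line \<rightarrow>\<^sub>M particle (Suc m)"
proof -
  have "(\<lambda>w i. case_nat (snd w) (fst w) i) \<in> particle m \<Otimes>\<^sub>M half_line \<rightarrow>\<^sub>M particle (Suc m)"
    unfolding particle_def
  proof (rule measurable_PiM_single')
    fix i assume i: "i \<in> {..<Suc m}"
    show "(\<lambda>w. case_nat (snd w) (fst w) i) \<in> Pi\<^sub>M {..<m} (\<lambda>_. half_line) \<Otimes>\<^sub>M half_line \<rightarrow>\<^sub>M half_line"
    proof (cases i)
      case 0
      thus ?thesis by simp
    next
      case (Suc j)
      have "(\<lambda>w. fst w j) \<in> Pi\<^sub>M {..<m} (\<lambda>_. half_line) \<Otimes>\<^sub>M half_line \<rightarrow>\<^sub>M half_line"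
        by (rule measurable_compose[OF measurable_fst measurable_component_singleton]) (use i Suc in simp)
      thus ?thesis using Suc by simp
    qed
  next
    show "(\<lambda>w i. case_nat (snd w) (fst w) i) \<in> space (Pi\<^sub>M {..<m} (\<lambda>_. half_line) \<Otimes>\<^sub>M half_line)
        \<rightarrow> ({..<Suc m} \<rightarrow>\<^sub>E space half_line)"
    proof
      fix w assume "w \<in> space (Pi\<^sub>M {..<m} (\<lambda>_. half_line) \<Otimes>\<^sub>M half_line)"
      hence 1: "fst w \<in> {..<m} \<rightarrow>\<^sub>E space half_line" and 2: "snd w \<in> space half_line"
        unfolding space_pair_measure space_PiM by (simp_all only: mem_Times_iff)
      show "(\<lambda>i. case_nat (snd w) (fst w) i) \<in> {..<Suc m} \<rightarrow>\<^sub>E space half_line"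
      proof
        fix i assume "i \<in> {..<Suc m}"
        thus "case_nat (snd w) (fst w) i \<in> space half_line"
          using 2 PiE_mem[OF 1] by (cases i) simp_all
      next
        fix i assume "i \<notin> {..<Suc m}"
        thus "case_nat (snd w) (fst w) i = undefined"
          using PiE_arb[OF 1] by (cases i) simp_all
      qed
    qed
  qed
  thus ?thesis by (simp add: case_prod_beta')
qed

lemma measurable_head_particle [measurable]: "(\<lambda>z. z 0) \<in> particle (Suc m) \<rightarrow>\<^sub>M half_line"
  unfolding particle_def by (rule measurable_component_singleton) simp

lemma measurable_tail_particle [measurable]:
  "(\<lambda>z i. z (Suc i)) \<in> particle (Suc m) \<rightarrow>\<^sub>M particle m"
  unfolding particle_def
  by (rule measurable_PiM_single')
     (auto simp: space_PiM PiE_iff extensional_def)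

lemma particle_Suc:
  "distr (particle m \<Otimes>\<^sub>M half_line) (particle (Suc m)) (\<lambda>(x, y). case_nat y x) = particle (Suc m)"
  (is "?D = _")
proof -
  have "?D = Pi\<^sub>M {..<Suc m} (\<lambda>_. half_line)"
  proof (rule half_lines.PiM_eqI)
    show "finite {..<Suc m}" by simp
    show "sets ?D = sets (Pi\<^sub>M {..<Suc m} (\<lambda>_. half_line))" by (simp add: particle_def)
    fix A :: "nat \<Rightarrow> real set" assume A: "\<And>i. i \<in> {..<Suc m} \<Longrightarrow> A i \<in> sets half_line"
    have P: "Pi\<^sub>E {..<Suc m} A \<in> sets (particle (Suc m))"
      unfolding particle_def by (rule sets_PiM_I_finite) (use A in auto)
    have Q: "Pi\<^sub>E {..<m} (\<lambda>i. A (Suc i)) \<in> sets (particle m)"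
      unfolding particle_def by (rule sets_PiM_I_finite) (use A in auto)
    have "(\<lambda>(x, y). case_nat y x) -` Pi\<^sub>E {..<Suc m} A \<inter> space (particle m \<Otimes>\<^sub>M half_line) =
        Pi\<^sub>E {..<m} (\<lambda>i. A (Suc i)) \<times> A 0" (is "?L = ?R")
    proof (intro set_eqI iffI)
      fix w assume w: "w \<in> ?L"
      obtain x y where [simp]: "w = (x, y)" by (cases w)
      from w have c: "case_nat y x \<in> Pi\<^sub>E {..<Suc m} A" and x: "x \<in> extensional {..<m}"
        by (auto simp: space_pair_measure particle_def space_PiM PiE_def)
      have "y \<in> A 0" using PiE_mem[OF c, of 0] by simp
      moreover have "x i \<in> A (Suc i)" if "i < m" for i
        using PiE_mem[OF c, of "Suc i"] that by simp
      ultimately show "w \<in> ?R" using x by (auto simp: PiE_def)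
    next
      fix w assume w: "w \<in> ?R"
      obtain x y where [simp]: "w = (x, y)" by (cases w)
      have "w \<in> space (particle m \<Otimes>\<^sub>M half_line)"
        using w sets.sets_into_space[OF Q] sets.sets_into_space[OF A[of 0]]
        by (auto simp: space_pair_measure)
      moreover have "case_nat y x \<in> Pi\<^sub>E {..<Suc m} A"
        using w by (auto simp: PiE_iff extensional_def split: nat.split)
      ultimately show "w \<in> ?L" by simp
    qed
    hence "emeasure ?D (Pi\<^sub>E {..<Suc m} A) =
        emeasure (particle m \<Otimes>\<^sub>M half_line) (Pi\<^sub>E {..<m} (\<lambda>i. A (Suc i)) \<times> A 0)"
      using P by (simp add: emeasure_distr)
    also have "\<dots> = emeasure (particle m) (Pi\<^sub>E {..<m} (\<lambda>i. A (Suc i))) * emeasure half_line (A 0)"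
      using Q A by (intro half_line.emeasure_pair_measure_Times) auto
    also have "\<dots> = (\<Prod>i<Suc m. emeasure half_line (A i))"
      unfolding particle_def
      by (subst half_lines.emeasure_PiM) (use A in \<open>auto simp: prod.lessThan_Suc_shift mult.commute simp del: prod.lessThan_Suc\<close>)
    finally show "emeasure ?D (Pi\<^sub>E {..<Suc m} A) = (\<Prod>i<Suc m. emeasure half_line (A i))" .
  qed
  thus ?thesis by (simp add: particle_def)
qed

lemma nn_integral_particle_Suc:
  assumes [measurable]: "g \<in> borel_measurable (particle (Suc m))"
  shows "(\<integral>\<^sup>+z. g z \<partial>particle (Suc m)) = (\<integral>\<^sup>+x. \<integral>\<^sup>+y. g (case_nat y x) \<partial>half_line \<partial>particle m)"
proof -
  have "(\<integral>\<^sup>+z. g z \<partial>particle (Suc m)) =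
      (\<integral>\<^sup>+w. g (case w of (x, y) \<Rightarrow> case_nat y x) \<partial>(particle m \<Otimes>\<^sub>M half_line))"
    by (subst particle_Suc[symmetric]) (rule nn_integral_distr, auto)
  also have "\<dots> = (\<integral>\<^sup>+x. \<integral>\<^sup>+y. g (case_nat y x) \<partial>half_line \<partial>particle m)"
    by (subst half_line.nn_integral_fst[symmetric]) auto
  finally show ?thesis .
qed

lemma AE_particle_Suc:
  assumes "AE z in particle (Suc m). P z"
  shows "AE x in particle m. AE y in half_line. P (case_nat y x)"
proof -
  interpret pair_sigma_finite "particle m" half_line
    by (simp add: pair_sigma_finite_def sigma_finite_particle half_line.sigma_finite_measure_axioms)
  have "AE w in particle m \<Otimes>\<^sub>M half_line. P (case w of (x, y) \<Rightarrow> case_nat y x)"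
    using assms by (subst (asm) particle_Suc[symmetric]) (rule AE_distrD[OF measurable_case_nat_particle])
  from AE_pair[OF this] show ?thesis by simp
qed

lemma square_integrable_create:
  fixes h :: "real \<Rightarrow> real" and f :: "(nat \<Rightarrow> real) \<Rightarrow> complex"
  assumes h: "square_integrable half_line h" and f: "square_integrable (particle m) f"
  shows "square_integrable (particle (Suc m)) (\<lambda>z. of_real (h (z 0)) * f (\<lambda>i. z (Suc i)))"
    and "(\<integral>z. (norm (of_real (h (z 0)) * f (\<lambda>i. z (Suc i))))\<^sup>2 \<partial>particle (Suc m)) =
      (\<integral>y. (norm (h y))\<^sup>2 \<partial>half_line) * (\<integral>x. (norm (f x))\<^sup>2 \<partial>particle m)"
proof -
  have [measurable]: "h \<in> borel_measurable half_line" "f \<in> borel_measurable (particle m)"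
    using h f by (auto simp: square_integrable_def)
  let ?g = "\<lambda>z. of_real (h (z 0)) * f (\<lambda>i. z (Suc i))"
  have [measurable]: "?g \<in> borel_measurable (particle (Suc m))" by measurable
  have "(\<integral>\<^sup>+z. ennreal ((norm (?g z))\<^sup>2) \<partial>particle (Suc m)) =
      (\<integral>\<^sup>+x. \<integral>\<^sup>+y. ennreal ((norm (h y))\<^sup>2) * ennreal ((norm (f x))\<^sup>2) \<partial>half_line \<partial>particle m)"
    by (subst nn_integral_particle_Suc)
       (auto simp: norm_mult power_mult_distrib ennreal_mult)
  also have "\<dots> = (\<integral>\<^sup>+y. ennreal ((norm (h y))\<^sup>2) \<partial>half_line) * (\<integral>\<^sup>+x. ennreal ((norm (f x))\<^sup>2) \<partial>particle m)"
    by (simp add: nn_integral_multc nn_integral_cmult)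
  also have "\<dots> = ennreal ((\<integral>y. (norm (h y))\<^sup>2 \<partial>half_line) * (\<integral>x. (norm (f x))\<^sup>2 \<partial>particle m))"
    unfolding integral_norm_square_eq_nn[OF h, symmetric] integral_norm_square_eq_nn[OF f, symmetric]
    by (simp add: ennreal_mult)
  finally have *: "(\<integral>\<^sup>+z. ennreal ((norm (?g z))\<^sup>2) \<partial>particle (Suc m)) = \<dots>" .
  thus g: "square_integrable (particle (Suc m)) ?g"
    by (simp add: square_integrable_iff_nn)
  show "(\<integral>z. (norm (?g z))\<^sup>2 \<partial>particle (Suc m)) =
      (\<integral>y. (norm (h y))\<^sup>2 \<partial>half_line) * (\<integral>x. (norm (f x))\<^sup>2 \<partial>particle m)"
    using * unfolding integral_norm_square_eq_nn[OF g, symmetric]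
    by (subst (asm) ennreal_inj) auto
qed

lemma square_integrable_annihilate:
  fixes h :: "real \<Rightarrow> real" and f :: "(nat \<Rightarrow> real) \<Rightarrow> complex"
  assumes h: "square_integrable half_line h" and f: "square_integrable (particle (Suc m)) f"
  shows "square_integrable (particle m) (\<lambda>x. \<integral>y. of_real (h y) * f (case_nat y x) \<partial>half_line)"
    and "(\<integral>x. (norm (\<integral>y. of_real (h y) * f (case_nat y x) \<partial>half_line))\<^sup>2 \<partial>particle m) \<le>
      (\<integral>y. (norm (h y))\<^sup>2 \<partial>half_line) * (\<integral>z. (norm (f z))\<^sup>2 \<partial>particle (Suc m))"
proof -
  have [measurable]: "h \<in> borel_measurable half_line" "f \<in> borel_measurable (particle (Suc m))"
    using h f by (auto simp: square_integrable_def)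
  let ?k = "\<lambda>x y. of_real (h y) * f (case_nat y x)"
  let ?g = "\<lambda>x. \<integral>y. ?k x y \<partial>half_line"
  have f2 [measurable]: "(\<lambda>(x, y). f (case_nat y x)) \<in> borel_measurable (particle m \<Otimes>\<^sub>M half_line)"
    using measurable_compose[OF measurable_case_nat_particle \<open>f \<in> _\<close>] by (simp add: case_prod_beta')
  have [measurable]: "?g \<in> borel_measurable (particle m)"
    by (rule half_line.borel_measurable_lebesgue_integral) measurable
  have bound: "ennreal ((norm (?g x))\<^sup>2) \<le>
      (\<integral>\<^sup>+y. ennreal ((norm (h y))\<^sup>2) \<partial>half_line) * (\<integral>\<^sup>+y. ennreal ((norm (f (case_nat y x)))\<^sup>2) \<partial>half_line)"
    if x: "x \<in> space (particle m)" for x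
  proof -
    have [measurable]: "(\<lambda>y. f (case_nat y x)) \<in> borel_measurable half_line"
      using measurable_compose[OF measurable_Pair1'[OF x] f2] by simp
    have "ennreal (norm (?g x)) \<le> (\<integral>\<^sup>+y. ennreal (norm (?k x y)) \<partial>half_line)"
      by (cases "integrable half_line (?k x)")
         (auto simp: not_integrable_integral_eq intro: integral_norm_bound_ennreal)
    also have "\<dots> = (\<integral>\<^sup>+y. ennreal (norm (h y)) * ennreal (norm (f (case_nat y x))) \<partial>half_line)"
      by (simp add: norm_mult ennreal_mult)
    finally have "(ennreal (norm (?g x)))\<^sup>2 \<le>
        (\<integral>\<^sup>+y. ennreal (norm (h y)) * ennreal (norm (f (case_nat y x))) \<partial>half_line)\<^sup>2"
      by (rule power_mono) simp
    also have "\<dots> \<le> (\<integral>\<^sup>+y. (ennreal (norm (h y)))\<^sup>2 \<partial>half_line) *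
        (\<integral>\<^sup>+y. (ennreal (norm (f (case_nat y x))))\<^sup>2 \<partial>half_line)"
      by (rule Cauchy_Schwarz_nn_integral) measurable
    finally show ?thesis by (simp add: ennreal_power)
  qed
  have "(\<integral>\<^sup>+x. ennreal ((norm (?g x))\<^sup>2) \<partial>particle m) \<le>
      (\<integral>\<^sup>+x. (\<integral>\<^sup>+y. ennreal ((norm (h y))\<^sup>2) \<partial>half_line) *
        (\<integral>\<^sup>+y. ennreal ((norm (f (case_nat y x)))\<^sup>2) \<partial>half_line) \<partial>particle m)"
    by (rule nn_integral_mono) (rule bound)
  also have "\<dots> = (\<integral>\<^sup>+y. ennreal ((norm (h y))\<^sup>2) \<partial>half_line) * (\<integral>\<^sup>+z. ennreal ((norm (f z))\<^sup>2) \<partial>particle (Suc m))"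
  proof -
    have "(\<lambda>x. \<integral>\<^sup>+y. ennreal ((norm (f (case_nat y x)))\<^sup>2) \<partial>half_line) \<in> borel_measurable (particle m)"
      by (rule half_line.borel_measurable_nn_integral) (use f2 in \<open>measurable\<close>)
    thus ?thesis
      by (subst nn_integral_particle_Suc) (auto simp: nn_integral_cmult)
  qed
  also have "\<dots> = ennreal ((\<integral>y. (norm (h y))\<^sup>2 \<partial>half_line) * (\<integral>z. (norm (f z))\<^sup>2 \<partial>particle (Suc m)))"
    unfolding integral_norm_square_eq_nn[OF h, symmetric] integral_norm_square_eq_nn[OF f, symmetric]
    by (simp add: ennreal_mult)
  finally have *: "(\<integral>\<^sup>+x. ennreal ((norm (?g x))\<^sup>2) \<partial>particle m) \<le> \<dots>" .
  thus g: "square_integrable (particle m) ?g"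
    by (auto simp: square_integrable_iff_nn intro: le_less_trans)
  show "(\<integral>x. (norm (?g x))\<^sup>2 \<partial>particle m) \<le>
      (\<integral>y. (norm (h y))\<^sup>2 \<partial>half_line) * (\<integral>z. (norm (f z))\<^sup>2 \<partial>particle (Suc m))"
    using * unfolding integral_norm_square_eq_nn[OF g, symmetric]
    by (subst (asm) ennreal_le_iff) auto
qed

lift_definition vacuum :: fock is "\<lambda>m x. if m = 0 then 1 else 0"
proof -
  have "summable (\<lambda>m. \<integral>x. (norm (if m = 0 then 1 else 0 :: complex))\<^sup>2 \<partial>particle m)"
    by (rule summable_finite[of "{0}"]) auto
  moreover have "square_integrable (particle m) (\<lambda>x. if m = 0 then 1 else 0 :: complex)" for m
  proof (cases m)
    case 0
    have "emeasure (particle 0) (space (particle 0)) = 1"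
      by (simp add: particle_def space_PiM half_lines.emeasure_PiM[of "{}", simplified])
    hence "integrable (particle 0) (\<lambda>_. 1 :: real)"
      by (intro finite_measure.integrable_const finite_measureI) simp
    thus ?thesis using 0 by (simp add: square_integrable_def)
  qed (simp add: square_integrable_def)
  ultimately show "fock_rel (\<lambda>m x. if m = 0 then 1 else 0) (\<lambda>m x. if m = 0 then 1 else 0)"
    by (simp add: fock_rel_self_iff fock_fun_def)
qed

text \<open>The operators \<open>a\<^sup>+(h)\<close> and \<open>a\<^sup>-(h)\<close> for real-valued \<open>h \<in> L\<^sup>2(\<real>\<^sub>+)\<close>; for any other \<open>h\<close> they are
  set to zero.\<close>

lift_definition create :: "(real \<Rightarrow> real) \<Rightarrow> fock \<Rightarrow> fock"
  is "\<lambda>h f m x. if square_integrable half_line h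
        then case m of 0 \<Rightarrow> 0 | Suc k \<Rightarrow> of_real (h (x 0)) * f k (\<lambda>i. x (Suc i))
        else 0"
proof -
  fix h :: "real \<Rightarrow> real" and f g :: "nat \<Rightarrow> (nat \<Rightarrow> real) \<Rightarrow> complex"
  assume fg: "fock_rel f g"
  let ?c = "\<lambda>f m x. if square_integrable half_line h
        then case m of 0 \<Rightarrow> 0 | Suc k \<Rightarrow> of_real (h (x 0)) * f k (\<lambda>i. x (Suc i)) else 0 :: complex"
  show "fock_rel (?c f) (?c g)"
  proof (cases "square_integrable half_line h")
    case False
    thus ?thesis by (simp add: fock_rel_self_iff fock_fun_zero)
  next
    case h: True
    have mem: "fock_fun (?c u)" if u: "fock_fun u" for u
    proof -
      have "square_integrable (particle m) (?c u m)" for m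
        using u h by (cases m) (auto simp: fock_fun_def square_integrable_create square_integrable_def[of "particle 0"])
      moreover have "summable (\<lambda>m. \<integral>x. (norm (?c u (Suc m) x))\<^sup>2 \<partial>particle (Suc m))"
        using u h by (simp add: square_integrable_create(2) fock_fun_def summable_mult)
      ultimately show ?thesis
        unfolding fock_fun_def by (subst summable_Suc_iff[symmetric]) blast
    qed
    have "AE x in particle m. ?c f m x = ?c g m x" for m
    proof (cases m)
      case (Suc k)
      have [measurable]: "h \<in> borel_measurable half_line" "f k \<in> borel_measurable (particle k)"
          "g k \<in> borel_measurable (particle k)"
        using h fg by (auto simp: square_integrable_def fock_rel_def fock_fun_def)
      let ?d = "\<lambda>z. ennreal (norm (of_real (h (z 0)) * (f k (\<lambda>i. z (Suc i)) - g k (\<lambda>i. z (Suc i)))))"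
      have [measurable]: "?d \<in> borel_measurable (particle (Suc k))" by measurable
      have "(\<integral>\<^sup>+z. ?d z \<partial>particle (Suc k)) =
          (\<integral>\<^sup>+x. \<integral>\<^sup>+y. ennreal (norm (of_real (h y) * (f k x - g k x))) \<partial>half_line \<partial>particle k)"
        by (subst nn_integral_particle_Suc) auto
      also have "\<dots> = (\<integral>\<^sup>+x. 0 \<partial>particle k)"
      proof (rule nn_integral_cong_AE)
        have "AE x in particle k. f k x = g k x" using fg by (auto simp: fock_rel_def)
        thus "AE x in particle k.
            (\<integral>\<^sup>+y. ennreal (norm (of_real (h y) * (f k x - g k x))) \<partial>half_line) = 0"
          by eventually_elim simp
      qed
      finally have "(\<integral>\<^sup>+z. ?d z \<partial>particle (Suc k)) = 0" by simp
      hence "AE z in particle (Suc k). ?d z = 0"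
        by (subst (asm) nn_integral_0_iff_AE) measurable
      thus ?thesis unfolding Suc by eventually_elim (use h in auto)
    qed simp
    thus ?thesis using fg mem by (simp add: fock_rel_def)
  qed
qed

lift_definition annihilate :: "(real \<Rightarrow> real) \<Rightarrow> fock \<Rightarrow> fock"
  is "\<lambda>h f m x. if square_integrable half_line h
        then \<integral>y. of_real (h y) * f (Suc m) (case_nat y x) \<partial>half_line
        else 0"
proof -
  fix h :: "real \<Rightarrow> real" and f g :: "nat \<Rightarrow> (nat \<Rightarrow> real) \<Rightarrow> complex"
  assume fg: "fock_rel f g"
  let ?c = "\<lambda>f m x. if square_integrable half_line h
        then \<integral>y. of_real (h y) * f (Suc m) (case_nat y x) \<partial>half_line else 0 :: complex"
  show "fock_rel (?c f) (?c g)"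
  proof (cases "square_integrable half_line h")
    case False
    thus ?thesis by (simp add: fock_rel_self_iff fock_fun_zero)
  next
    case h: True
    have mem: "fock_fun (?c u)" if u: "fock_fun u" for u
    proof -
      have "square_integrable (particle m) (?c u m)" for m
        using u h by (simp add: fock_fun_def square_integrable_annihilate)
      moreover have "summable (\<lambda>m. \<integral>x. (norm (?c u m x))\<^sup>2 \<partial>particle m)"
      proof (rule summable_comparison_test)
        show "\<exists>N. \<forall>m\<ge>N. norm (\<integral>x. (norm (?c u m x))\<^sup>2 \<partial>particle m) \<le>
            (\<integral>y. (norm (h y))\<^sup>2 \<partial>half_line) * (\<integral>z. (norm (u (Suc m) z))\<^sup>2 \<partial>particle (Suc m))"
          using u h square_integrable_annihilate(2)[OF h] by (auto simp: fock_fun_def)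
        have "summable (\<lambda>m. \<integral>z. (norm (u m z))\<^sup>2 \<partial>particle m)"
          using u by (simp add: fock_fun_def)
        hence "summable (\<lambda>m. \<integral>z. (norm (u (Suc m) z))\<^sup>2 \<partial>particle (Suc m))"
          by (subst summable_Suc_iff)
        thus "summable (\<lambda>m. (\<integral>y. (norm (h y))\<^sup>2 \<partial>half_line) *
            (\<integral>z. (norm (u (Suc m) z))\<^sup>2 \<partial>particle (Suc m)))"
          by (rule summable_mult)
      qed
      ultimately show ?thesis by (simp add: fock_fun_def)
    qed
    have "AE x in particle m. ?c f m x = ?c g m x" for m
    proof -
      have [measurable]: "h \<in> borel_measurable half_line"
        using h by (simp add: square_integrable_def)
      have meas: "(\<lambda>y. u (Suc m) (case_nat y x)) \<in> borel_measurable half_line"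
        if "fock_fun u" "x \<in> space (particle m)" for u :: "nat \<Rightarrow> (nat \<Rightarrow> real) \<Rightarrow> complex" and x
      proof -
        have "u (Suc m) \<in> borel_measurable (particle (Suc m))"
          using that by (simp add: fock_fun_def square_integrable_def)
        from measurable_compose[OF measurable_compose[OF measurable_Pair1'[OF that(2)]
            measurable_case_nat_particle] this]
        show ?thesis by simp
      qed
      have "AE z in particle (Suc m). f (Suc m) z = g (Suc m) z"
        using fg by (simp add: fock_rel_def)
      from AE_particle_Suc[OF this] AE_space[of "particle m"]
      show ?thesis
      proof eventually_elim
        case (elim x)
        have [measurable]: "(\<lambda>y. f (Suc m) (case_nat y x)) \<in> borel_measurable half_line"
          "(\<lambda>y. g (Suc m) (case_nat y x)) \<in> borel_measurable half_line"
          using meas elim(2) fg by (auto simp: fock_rel_def)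
        have "(\<integral>y. of_real (h y) * f (Suc m) (case_nat y x) \<partial>half_line) =
            (\<integral>y. of_real (h y) * g (Suc m) (case_nat y x) \<partial>half_line)"
          by (rule integral_cong_AE) (use elim(1) in auto)
        thus ?case by simp
      qed
    qed
    thus ?thesis using fg mem by (simp add: fock_rel_def)
  qed
qed

lemma square_integrable_indicator_interval:
  "square_integrable half_line (indicator {0..<t} :: real \<Rightarrow> real)"
proof -
  have "integrable lborel (indicator {0..<t} :: real \<Rightarrow> real)"
    by (cases "0 \<le> t") (auto intro!: integrable_real_indicator simp: emeasure_lborel_Ico)
  hence "integrable half_line (indicator {0..<t} :: real \<Rightarrow> real)"
    using integrable_mult_indicator[of "{0..}" lborel "indicator {0..<t} :: real \<Rightarrow> real"]
    by (subst integrable_restrict_space) simp_all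
  moreover have "(norm (indicator {0..<t} y :: real))\<^sup>2 = indicator {0..<t} y" for y
    by (simp add: indicator_def)
  ultimately show ?thesis
    by (simp add: square_integrable_def borel_measurable_integrable)
qed

definition free_brownian :: "real \<Rightarrow> fock \<Rightarrow> fock" where
  "free_brownian t f = create (indicator {0..<t}) f + annihilate (indicator {0..<t}) f"


section \<open>The toy Fock space\<close>

definition toy_step :: "nat \<Rightarrow> nat \<Rightarrow> real \<Rightarrow> real" where
  "toy_step n i y = sqrt n * indicator {real i / real n ..< (real i + 1) / real n} y"

lemma square_integrable_toy_step: "square_integrable half_line (toy_step n i)"
proof -
  let ?I = "{real i / real n ..< (real i + 1) / real n}"
  have "integrable lborel (\<lambda>y. indicator ?I y * real n)"
    by (intro integrable_mult_left integrable_real_indicator)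
       (auto simp: emeasure_lborel_Ico divide_right_mono)
  hence "integrable half_line (\<lambda>y. indicator ?I y * real n)"
    using integrable_mult_indicator[of "{0..}" lborel "\<lambda>y. indicator ?I y * real n"]
    by (subst integrable_restrict_space) simp_all
  moreover have "(norm (toy_step n i y))\<^sup>2 = indicator ?I y * real n" for y
    by (auto simp: toy_step_def indicator_def)
  moreover have "toy_step n i \<in> borel_measurable half_line"
    unfolding toy_step_def by (rule measurable_restrict_space1) simp
  ultimately show ?thesis by (simp add: square_integrable_def)
qed

lift_definition toy_basis :: "nat \<Rightarrow> nat list \<Rightarrow> fock"
  is "\<lambda>n \<sigma> m x. if m = length \<sigma> then \<Prod>j<m. of_real (toy_step n (\<sigma> ! j) (x j)) else 0"
proof -
  fix n :: nat and \<sigma> :: "nat list"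
  let ?X = "\<lambda>m x. if m = length \<sigma> then \<Prod>j<m. of_real (toy_step n (\<sigma> ! j) (x j)) else 0 :: complex"
  have "square_integrable (particle m) (?X m)" for m
  proof (cases "m = length \<sigma>")
    case True
    have "(\<lambda>x. \<Prod>j<m. of_real (toy_step n (\<sigma> ! j) (x j)) :: complex) \<in> borel_measurable (particle m)"
    proof (rule borel_measurable_prod)
      fix j assume "j \<in> {..<m}"
      hence "(\<lambda>x. x j) \<in> particle m \<rightarrow>\<^sub>M half_line"
        unfolding particle_def by (rule measurable_component_singleton)
      from measurable_compose[OF this square_integrable_measurable[OF square_integrable_toy_step]]
      have "(\<lambda>x. toy_step n (\<sigma> ! j) (x j)) \<in> borel_measurable (particle m)" .
      thus "(\<lambda>x. of_real (toy_step n (\<sigma> ! j) (x j)) :: complex) \<in> borel_measurable (particle m)"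
        by (rule borel_measurable_continuous_on[rotated]) (intro continuous_intros)
    qed
    moreover have "integrable (particle m) (\<lambda>x. \<Prod>j<m. (norm (toy_step n (\<sigma> ! j) (x j)))\<^sup>2)"
      unfolding particle_def
      by (rule half_lines.product_integrable_prod)
         (use square_integrable_toy_step in \<open>auto simp: square_integrable_def\<close>)
    moreover have "(norm (?X m x))\<^sup>2 = (\<Prod>j<m. (norm (toy_step n (\<sigma> ! j) (x j)))\<^sup>2)" for x
      unfolding if_P[OF True] by (simp only: flip: prod_norm) (simp add: prod_power_distrib)
    ultimately show ?thesis using True by (simp add: square_integrable_def)
  qed (simp add: square_integrable_def)
  moreover have "summable (\<lambda>m. \<integral>x. (norm (?X m x))\<^sup>2 \<partial>particle m)"
    by (rule summable_finite[of "{length \<sigma>}"]) auto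
  ultimately show "fock_rel ?X ?X"
    by (simp add: fock_rel_self_iff fock_fun_def)
qed

lemma toy_basis_Nil: "toy_basis n [] = vacuum"
proof (transfer, goal_cases)
  case (1 n)
  have eq: "(\<lambda>m x. if m = length ([] :: nat list)
        then \<Prod>j<m. of_real (toy_step n ([] ! j) (x j)) else 0 :: complex) =
      (\<lambda>m x. if m = 0 then 1 else 0)" by (intro ext) simp
  show ?case unfolding eq by (rule vacuum.rsp)
qed

lemma toy_step_mult:
  assumes "n > 0"
  shows "toy_step n i y * toy_step n j y =
    (if i = j then real n * indicator {real i / real n ..< (real i + 1) / real n} y else 0)"
proof (cases "i = j")
  case True
  thus ?thesis by (simp add: toy_step_def indicator_def)
next
  case False
  have "toy_step n i y * toy_step n j y = 0"
  proof (rule ccontr)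
    assume "\<not> ?thesis"
    hence "y \<in> {real i / real n ..< (real i + 1) / real n}" "y \<in> {real j / real n ..< (real j + 1) / real n}"
      by (simp_all add: toy_step_def indicator_def split: if_splits)
    hence "real i \<le> y * n" "y * n < real i + 1" "real j \<le> y * n" "y * n < real j + 1"
      using assms by (simp_all add: pos_divide_le_eq pos_less_divide_eq)
    thus False using False by linarith
  qed
  thus ?thesis using False by simp
qed

lemma integral_toy_step:
  assumes "n > 0"
  shows "(\<integral>y. toy_step n i y * toy_step n j y \<partial>half_line) = of_bool (i = j)"
proof -
  let ?I = "{real i / real n ..< (real i + 1) / real n}"
  have sub: "?I \<subseteq> {0..}" 
  proof
    fix y assume "y \<in> ?I"
    hence "real i / real n \<le> y" by simp
    moreover have "0 \<le> real i / real n" by simp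
    ultimately have "0 \<le> y" by linarith
    thus "y \<in> {0..}" by simp
  qed
  have "(\<integral>y. indicat_real ?I y \<partial>half_line) = (\<integral>y. indicator {0..} y *\<^sub>R indicat_real ?I y \<partial>lborel)"
    by (rule integral_restrict_space) simp
  also have "\<dots> = (\<integral>y. indicat_real ?I y \<partial>lborel)"
    by (intro Bochner_Integration.integral_cong) (use sub in \<open>auto simp: indicator_def subset_iff\<close>)
  also have "\<dots> = (real i + 1) / real n - real i / real n"
    by (simp add: divide_right_mono)
  also have "\<dots> = 1 / real n" by (simp add: add_divide_distrib)
  finally have "(\<integral>y. indicat_real ?I y \<partial>half_line) = 1 / real n" .
  thus ?thesis using assms by (cases "i = j") (simp_all add: toy_step_mult[OF assms])
qed

lemma toy_basis_orthonormal:
  assumes "n > 0"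
  shows "cinner (toy_basis n \<sigma>) (toy_basis n \<tau>) = of_bool (\<sigma> = \<tau>)"
  using assms
proof (transfer, goal_cases)
  case (1 n \<sigma> \<tau>)
  have sq: "square_integrable half_line (\<lambda>y. complex_of_real (toy_step n i y))" for i
    using square_integrable_toy_step[of n i]
    by (auto simp: square_integrable_def intro: borel_measurable_continuous_on[rotated] continuous_intros)
  let ?X = "\<lambda>\<sigma> m x. if m = length \<sigma> then \<Prod>j<m. of_real (toy_step n (\<sigma> ! j) (x j)) else 0 :: complex"
  have I: "(\<integral>x. cnj (?X \<sigma> m x) * ?X \<tau> m x \<partial>particle m) = (if m = length \<sigma> then of_bool (\<sigma> = \<tau>) else 0)" for m
  proof (cases "m = length \<sigma> \<and> m = length \<tau>")
    case True
    have "(\<integral>x. cnj (?X \<sigma> m x) * ?X \<tau> m x \<partial>particle m) =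
        (\<integral>x. (\<Prod>j<m. of_real (toy_step n (\<sigma> ! j) (x j) * toy_step n (\<tau> ! j) (x j))) \<partial>particle m)"
      using True by (simp add: prod.distrib)
    also have "\<dots> = (\<Prod>j<m. \<integral>y. of_real (toy_step n (\<sigma> ! j) y * toy_step n (\<tau> ! j) y) \<partial>half_line)"
      unfolding particle_def
    proof (rule half_lines.product_integral_prod)
      fix j
      have "integrable half_line (\<lambda>y. cnj (of_real (toy_step n (\<sigma> ! j) y)) * of_real (toy_step n (\<tau> ! j) y))"
        by (rule square_integrable_mult(1)) (rule sq)+
      thus "integrable half_line (\<lambda>y. of_real (toy_step n (\<sigma> ! j) y * toy_step n (\<tau> ! j) y) :: complex)"
        by simp
    qed simp
    also have "\<dots> = (\<Prod>j<m. of_bool (\<sigma> ! j = \<tau> ! j))"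
      unfolding integral_complex_of_real integral_toy_step[OF 1(1)]
      by (rule prod.cong) (auto simp: of_bool_def)
    also have "\<dots> = of_bool (\<forall>j<m. \<sigma> ! j = \<tau> ! j)"
      by (auto simp: of_bool_def intro!: prod.neutral)
    also have "(\<forall>j<m. \<sigma> ! j = \<tau> ! j) \<longleftrightarrow> \<sigma> = \<tau>"
      using True by (auto simp: list_eq_iff_nth_eq)
    finally show ?thesis using True by simp
  qed auto
  show ?case unfolding I by (subst suminf_finite[of "{length \<sigma>}"]) auto
qed

definition toy_fock :: "nat \<Rightarrow> fock set" where
  "toy_fock n = closure (complex_fock.span (toy_basis n ` {\<sigma>. distinct_adj \<sigma>}))"

text \<open>The continuous linear operator that maps the orthonormal family \<open>toy_basis n \<sigma>\<close> (\<open>\<sigma>\<close> adapted)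
  to \<open>v \<sigma>\<close> and vanishes on its orthogonal complement; see \<open>toy_operator_basis\<close> and
  \<open>toy_operator_orthogonal\<close> below.\<close>

definition toy_operator :: "nat \<Rightarrow> (nat list \<Rightarrow> fock) \<Rightarrow> fock \<Rightarrow> fock" where
  "toy_operator n v f = (\<Sum>\<^sub>\<infinity>\<sigma>\<in>{\<sigma>. distinct_adj \<sigma>}. cinner (toy_basis n \<sigma>) f *\<^sub>C v \<sigma>)"

definition toy_create :: "nat \<Rightarrow> nat \<Rightarrow> fock \<Rightarrow> fock" where
  "toy_create n i =
     toy_operator n (\<lambda>\<sigma>. if \<sigma> = [] \<or> hd \<sigma> \<noteq> i then toy_basis n (i # \<sigma>) else 0)"

definition toy_annihilate :: "nat \<Rightarrow> nat \<Rightarrow> fock \<Rightarrow> fock" where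
  "toy_annihilate n i =
     toy_operator n (\<lambda>\<sigma>. if \<sigma> \<noteq> [] \<and> hd \<sigma> = i then toy_basis n (tl \<sigma>) else 0)"

lemma toy_operator_basis:
  assumes "n > 0" "distinct_adj \<sigma>"
  shows "toy_operator n v (toy_basis n \<sigma>) = v \<sigma>"
proof -
  have "toy_operator n v (toy_basis n \<sigma>) =
      (\<Sum>\<^sub>\<infinity>\<tau>\<in>{\<sigma>}. cinner (toy_basis n \<tau>) (toy_basis n \<sigma>) *\<^sub>C v \<tau>)"
    unfolding toy_operator_def
  proof (rule infsum_cong_neutral)
    fix \<tau> assume "\<tau> \<in> {\<sigma>. distinct_adj \<sigma>} - {\<sigma>}"
    hence "\<tau> \<noteq> \<sigma>" by simp
    thus "cinner (toy_basis n \<tau>) (toy_basis n \<sigma>) *\<^sub>C v \<tau> = 0"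
      by (simp add: toy_basis_orthonormal[OF assms(1)])
  qed (use assms in simp_all)
  also have "\<dots> = v \<sigma>"
    by (subst infsum_finite) (simp_all add: toy_basis_orthonormal[OF assms(1)])
  finally show ?thesis .
qed

lemma toy_operator_orthogonal:
  assumes "\<And>g. g \<in> toy_fock n \<Longrightarrow> cinner g f = 0"
  shows "toy_operator n v f = 0"
  unfolding toy_operator_def
proof (rule infsum_0)
  fix \<sigma> :: "nat list" assume "\<sigma> \<in> {\<sigma>. distinct_adj \<sigma>}"
  hence "toy_basis n \<sigma> \<in> complex_fock.span (toy_basis n ` {\<sigma>. distinct_adj \<sigma>})"
    by (intro complex_fock.span_base imageI)
  hence "toy_basis n \<sigma> \<in> toy_fock n"
    unfolding toy_fock_def by (rule subsetD[OF closure_subset])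
  thus "cinner (toy_basis n \<sigma>) f *\<^sub>C v \<sigma> = 0"
    using assms by simp
qed

definition toy_X :: "nat \<Rightarrow> nat \<Rightarrow> fock \<Rightarrow> fock" where
  "toy_X n i f = toy_create n i f + toy_annihilate n i f"

definition toy_W :: "nat \<Rightarrow> real \<Rightarrow> fock \<Rightarrow> fock" where
  "toy_W n t f = (1 / sqrt n) *\<^sub>R (\<Sum>i = 0..nat \<lfloor>real n * t\<rfloor>. toy_X n i f)"


section \<open>Bounded operators, distributions and freeness\<close>

definition bounded_clinear :: "(fock \<Rightarrow> fock) \<Rightarrow> bool" where
  "bounded_clinear T \<longleftrightarrow> bounded_linear T \<and> (\<forall>c f. T (c *\<^sub>C f) = c *\<^sub>C T f)"

text \<open>The bounded operators on a closed subspace \<open>H\<close>, each extended by zero to the orthogonal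
  complement of \<open>H\<close>. With this identification the unit of the algebra is the orthogonal
  projection onto \<open>H\<close>.\<close>

definition operators_on :: "fock set \<Rightarrow> (fock \<Rightarrow> fock) set" where
  "operators_on H = {T. bounded_clinear T \<and> T ` H \<subseteq> H \<and>
     (\<forall>f. (\<forall>g\<in>H. cinner g f = 0) \<longrightarrow> T f = 0)}"

definition orthogonal_projection :: "fock set \<Rightarrow> fock \<Rightarrow> fock" where
  "orthogonal_projection H f = (THE p. p \<in> H \<and> (\<forall>g\<in>H. cinner g (f - p) = 0))"

definition vacuum_state :: "(fock \<Rightarrow> fock) \<Rightarrow> complex" where
  "vacuum_state T = cinner vacuum (T vacuum)"

inductive_set generated_algebra :: "fock set \<Rightarrow> (fock \<Rightarrow> fock) set \<Rightarrow> (fock \<Rightarrow> fock) set"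
  for H S where
  unit: "orthogonal_projection H \<in> generated_algebra H S"
| gen: "T \<in> S \<Longrightarrow> T \<in> generated_algebra H S"
| add: "T \<in> generated_algebra H S \<Longrightarrow> U \<in> generated_algebra H S \<Longrightarrow>
    (\<lambda>f. T f + U f) \<in> generated_algebra H S"
| scale: "T \<in> generated_algebra H S \<Longrightarrow> (\<lambda>f. c *\<^sub>C T f) \<in> generated_algebra H S"
| mult: "T \<in> generated_algebra H S \<Longrightarrow> U \<in> generated_algebra H S \<Longrightarrow>
    T \<circ> U \<in> generated_algebra H S"

text \<open>The list \<open>js\<close> holds the indices \<open>j(1), ..., j(m)\<close> and \<open>bs\<close> the operators \<open>b\<^sub>1, ..., b\<^sub>m\<close>.\<close>

definition free_algebras :: "('i \<Rightarrow> (fock \<Rightarrow> fock) set) \<Rightarrow> bool" where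
  "free_algebras A \<longleftrightarrow>
     (\<forall>js bs. bs \<noteq> [] \<longrightarrow> length js = length bs \<longrightarrow>
        (\<forall>k<length bs. bs ! k \<in> A (js ! k) \<and> vacuum_state (bs ! k) = 0) \<longrightarrow>
        (\<forall>k. Suc k < length js \<longrightarrow> js ! k \<noteq> js ! Suc k) \<longrightarrow>
        vacuum_state (foldr (\<circ>) bs id) = 0)"

definition free_family :: "fock set \<Rightarrow> ('i \<Rightarrow> fock \<Rightarrow> fock) \<Rightarrow> bool" where
  "free_family H X \<longleftrightarrow>
     (\<forall>i. X i \<in> operators_on H) \<and> free_algebras (\<lambda>i. generated_algebra H {X i})"

text \<open>For \<open>k = 0\<close> the power of \<open>X\<close> should be the projection onto \<open>H\<close>; since the vacuum vector lies in
  the toy Fock spaces, the identity \<open>X ^^ 0\<close> has the same vacuum expectation.\<close>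

definition has_vacuum_distribution :: "fock set \<Rightarrow> (fock \<Rightarrow> fock) \<Rightarrow> real measure \<Rightarrow> bool" where
  "has_vacuum_distribution H X \<mu> \<longleftrightarrow>
     X \<in> operators_on H \<and> (\<forall>f g. cinner (X f) g = cinner f (X g)) \<and>
     prob_space \<mu> \<and> sets \<mu> = sets borel \<and> (\<exists>K. compact K \<and> (AE x in \<mu>. x \<in> K)) \<and>
     (\<forall>k. vacuum_state (X ^^ k) = of_real (\<integral>x. x ^ k \<partial>\<mu>))"

definition bernoulli :: "real measure" where
  "bernoulli = distr (measure_pmf (pmf_of_set {-1, 1})) borel (\<lambda>x. x)"

lemma emeasure_bernoulli:
  assumes "B \<in> sets borel"
  shows "emeasure bernoulli B =
    ennreal (1 / 2) * emeasure (return borel (-1)) B + ennreal (1 / 2) * emeasure (return borel 1) B"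
proof -
  have "ennreal (1 / 2) + ennreal (1 / 2) = 1"
    by (subst ennreal_plus[symmetric]) simp_all
  thus ?thesis
    using assms
    by (cases "1 \<in> B"; cases "-1 \<in> B")
       (simp_all add: bernoulli_def emeasure_distr emeasure_pmf_of_set Int_insert_left)
qed

definition strong_operator_limit :: "(nat \<Rightarrow> fock \<Rightarrow> fock) \<Rightarrow> (fock \<Rightarrow> fock) \<Rightarrow> bool" where
  "strong_operator_limit T S \<longleftrightarrow>
     (\<forall>\<^sub>F n in sequentially. bounded_clinear (T n)) \<and> bounded_clinear S \<and>
     limitin strong_operator_topology (\<lambda>n. Blinfun (T n)) (Blinfun S) sequentially"

end

(* The Fock space is complete, so orthogonal projections onto closed subspaces exist. Let P be the
   projection onto the toy Fock space of mesh 1/n. Then X_i = P (a^+(x_i) + a^-(x_i)) P, where x_i is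
   the normalised indicator of the i-th cell, because P kills exactly the non-adapted basis words.

   (1) X_i^2 = P, so the unital algebra generated by X_i is {a P + b X_i}, whose centred elements are
   the multiples b X_i; a product of such elements with neighbouring indices distinct sends the
   vacuum to a multiple of the basis vector of the index word, which is orthogonal to the vacuum.

   (2) By linearity W_t^(n) = P (a^+(h_n) + a^-(h_n)) P, where h_n is the indicator of an interval
   [0, t_n) with t <= t_n <= t + 1/n. Since |a^+-(h)| <= |h|, it remains to see that P tends strongly
   to the identity. The set of f with P f -> f is a closed subspace that contains the vacuum. It is
   invariant under a^+(1_[0,s)), since the non-adapted part of a^+(h_n) g has norm at most
   |g| / sqrt n for g in the toy Fock space. Its orthogonal complement is invariant under
   a^-(1_[0,s)), and induction on the number of particles shows that the complement is zero. *)
theory Submission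
  imports Defs
begin

section \<open>Completeness of the Fock space\<close>

text \<open>Orthogonal projections need completeness, and so far \<open>fock\<close> only carries an
  inner product; hence the Riesz-Fischer argument. The toy operators are infinite sums over words.
  Writing them as compressions gives convergence, linearity and boundedness together, and splits the
  limit into two facts: the grid interval tends to [0, t) with operator norm control, and P tends
  strongly to the identity. The second fact is the harder one. The toy spaces do not increase with
  n, so density of their union alone would not give it, and they are not invariant under creation by
  a grid interval, since words with two equal neighbours leave them. But among the cells that make
  up such an interval at most one repeats the first letter of a given adapted word, and it carries
  the weight 1 / sqrt n that undoes the normalisation of the cell. Distinct words have orthogonal
  defects, whence the rate. To see that the complement is zero, only intervals with rational
  endpoints are tested: each test fails on its own null set of slices, and only countably many null
  sets can be united.\<close>

lemma power2_norm_abs_fock: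
  assumes "fock_fun f"
  shows "(norm (abs_fock f))\<^sup>2 = (\<Sum>m. \<integral>x. (norm (f m x))\<^sup>2 \<partial>particle m)"
proof -
  have r: "fock_rel f f" using assms by (simp add: fock_rel_def)
  have "(norm (abs_fock f))\<^sup>2 = Re (cinner (abs_fock f) (abs_fock f))"
    by (simp add: norm_fock_def inner_fock_def cinner_self_nonneg)
  also have "\<dots> = (\<Sum>m. \<integral>x. (norm (f m x))\<^sup>2 \<partial>particle m)"
    by (simp add: cinner.abs_eq r cinner_self assms)
  finally show ?thesis .
qed

text \<open>The values lie in \<open>ennreal\<close>, so the squared norm makes sense before
  membership in the Fock space is known; a pointwise limit is recognised as a member by bounding its
  energy.\<close>

definition fock_energy :: "(nat \<Rightarrow> (nat \<Rightarrow> real) \<Rightarrow> complex) \<Rightarrow> ennreal" where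
  "fock_energy f = (\<Sum>m. \<integral>\<^sup>+x. ennreal ((norm (f m x))\<^sup>2) \<partial>particle m)"

lemma fock_energy_eq:
  assumes "fock_fun f"
  shows "fock_energy f = ennreal ((norm (abs_fock f))\<^sup>2)"
proof -
  have "fock_energy f = (\<Sum>m. ennreal (\<integral>x. (norm (f m x))\<^sup>2 \<partial>particle m))"
    unfolding fock_energy_def
    using assms by (intro suminf_cong) (simp add: integral_norm_square_eq_nn fock_fun_def)
  also have "\<dots> = ennreal ((norm (abs_fock f))\<^sup>2)"
    unfolding power2_norm_abs_fock[OF assms]
    by (rule suminf_ennreal2) (use assms in \<open>auto simp: fock_fun_def\<close>)
  finally show ?thesis .
qed

lemma fock_fun_if_energy:
  assumes "\<And>m. f m \<in> borel_measurable (particle m)" "fock_energy f < \<infinity>"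
  shows "fock_fun f"
proof -
  have fin: "(\<integral>\<^sup>+x. ennreal ((norm (f m x))\<^sup>2) \<partial>particle m) < \<infinity>" for m
  proof -
    have "sum (\<lambda>m. \<integral>\<^sup>+x. ennreal ((norm (f m x))\<^sup>2) \<partial>particle m) {m} \<le> fock_energy f"
      unfolding fock_energy_def by (rule sum_le_suminf) auto
    thus ?thesis using assms(2) by (simp add: order_le_less_trans)
  qed
  hence sq: "square_integrable (particle m) (f m)" for m
    using assms(1) by (simp add: square_integrable_iff_nn)
  have "fock_energy f = (\<Sum>m. ennreal (\<integral>x. (norm (f m x))\<^sup>2 \<partial>particle m))"
    unfolding fock_energy_def by (intro suminf_cong) (simp add: integral_norm_square_eq_nn[OF sq])
  hence "summable (\<lambda>m. \<integral>x. (norm (f m x))\<^sup>2 \<partial>particle m)"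
    using assms(2) by (intro summable_suminf_not_top) auto
  thus ?thesis using sq by (simp add: fock_fun_def)
qed

lemma ex_abs_fock: "\<exists>f. fock_fun f \<and> F = abs_fock f"
  using Quotient_fock by (metis Quotient_abs_rep Quotient_rep_reflp fock_rel_self_iff)

lemma abs_fock_diff:
  assumes "fock_fun f" "fock_fun g"
  shows "abs_fock f - abs_fock g = abs_fock (\<lambda>m x. f m x - g m x)"
    and "fock_fun (\<lambda>m x. f m x - g m x)"
proof -
  have eq: "(\<lambda>m x. f m x + (- 1) * g m x) = (\<lambda>m x. f m x - g m x)" by simp
  have r: "fock_rel f f" "fock_rel g g" "fock_rel (\<lambda>m x. (- 1) * g m x) (\<lambda>m x. (- 1) * g m x)"
    using assms fock_fun_scale[of g "-1"] by (auto simp: fock_rel_self_iff)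
  show "abs_fock f - abs_fock g = abs_fock (\<lambda>m x. f m x - g m x)"
    unfolding minus_fock_def uminus_fock_def cscale.abs_eq[OF r(2)] plus_fock.abs_eq[OF r(1,3)] eq ..
  show "fock_fun (\<lambda>m x. f m x - g m x)"
    using fock_fun_add[OF assms(1) fock_fun_scale[OF assms(2), of "-1"]] by simp
qed

text \<open>The weights 4^k turn the bounds (1/8)^k into the summable (1/2)^k. Hence the weighted
  series of squares is finite almost everywhere, its terms tend to 0, and the increments are
  eventually at most (1/2)^k.\<close>

lemma AE_convergent_if_geometric:
  fixes f :: "nat \<Rightarrow> 'a \<Rightarrow> complex"
  assumes [measurable]: "\<And>k. f k \<in> borel_measurable M"
    and bound: "\<And>k. (\<integral>\<^sup>+x. ennreal ((norm (f (Suc k) x - f k x))\<^sup>2) \<partial>M) \<le> ennreal ((1/8) ^ k)"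
  shows "AE x in M. convergent (\<lambda>k. f k x)"
proof -
  let ?s = "\<lambda>x. \<Sum>k. ennreal (4 ^ k) * ennreal ((norm (f (Suc k) x - f k x))\<^sup>2)"
  have "(\<integral>\<^sup>+x. ?s x \<partial>M) = (\<Sum>k. ennreal (4 ^ k) * (\<integral>\<^sup>+x. ennreal ((norm (f (Suc k) x - f k x))\<^sup>2) \<partial>M))"
    by (subst nn_integral_suminf) (auto simp: nn_integral_cmult)
  also have "\<dots> \<le> (\<Sum>k. ennreal (4 ^ k) * ennreal ((1/8) ^ k))"
    by (intro suminf_le mult_left_mono bound) auto
  also have "\<dots> = (\<Sum>k. ennreal ((1/2) ^ k))"
    by (intro suminf_cong) (simp flip: ennreal_mult power_mult_distrib)
  also have "\<dots> = ennreal (\<Sum>k. (1/2) ^ k)"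
    by (intro suminf_ennreal2) auto
  also have "\<dots> < \<infinity>" by simp
  finally have "AE x in M. ?s x \<noteq> \<infinity>"
    by (intro nn_integral_PInf_AE) auto
  thus ?thesis
  proof eventually_elim
    case (elim x)
    let ?d = "\<lambda>k. f (Suc k) x - f k x"
    have "summable (\<lambda>k. 4 ^ k * (norm (?d k))\<^sup>2)"
    proof (rule summable_suminf_not_top)
      show "(\<Sum>k. ennreal (4 ^ k * (norm (?d k))\<^sup>2)) \<noteq> top"
        using elim by (simp add: ennreal_mult)
    qed simp
    hence "(\<lambda>k. 4 ^ k * (norm (?d k))\<^sup>2) \<longlonglongrightarrow> 0" by (rule summable_LIMSEQ_zero)
    hence "\<forall>\<^sub>F k in sequentially. 4 ^ k * (norm (?d k))\<^sup>2 < 1"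
      by (rule order_tendstoD) simp
    hence "\<forall>\<^sub>F k in sequentially. norm (?d k) \<le> (1/2) ^ k"
    proof eventually_elim
      case (elim k)
      moreover have "((2 :: real) ^ k)\<^sup>2 = 4 ^ k" by (simp add: power2_eq_square flip: power_mult_distrib)
      ultimately have "(2 ^ k * norm (?d k))\<^sup>2 < 1\<^sup>2"
        by (simp add: power_mult_distrib)
      hence "2 ^ k * norm (?d k) < 1" by (rule power_less_imp_less_base) simp
      thus ?case by (simp add: power_one_over field_simps)
    qed
    hence "summable ?d"
      by (rule summable_comparison_test_ev) simp
    hence "convergent (\<lambda>n. \<Sum>k<n. ?d k)" by (simp add: summable_iff_convergent)
    hence "convergent (\<lambda>n. (\<Sum>k<n. ?d k) + f 0 x)"
      by (intro convergent_add convergent_const)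
    thus ?case unfolding sum_lessThan_telescope[of "\<lambda>k. f k x"] by simp
  qed
qed

text \<open>Fatou's lemma twice: on each particle space, and for the counting measure over the
  particle number.\<close>

lemma fock_energy_liminf:
  assumes [measurable]: "\<And>j m. f j m \<in> borel_measurable (particle m)"
  assumes lim: "\<And>m. AE x in particle m. (\<lambda>j. f j m x) \<longlonglongrightarrow> g m x"
  shows "fock_energy g \<le> liminf (\<lambda>j. fock_energy (f j))"
proof -
  let ?e = "\<lambda>u m. \<integral>\<^sup>+x. ennreal ((norm (u m x :: complex))\<^sup>2) \<partial>particle m"
  have "?e g m \<le> liminf (\<lambda>j. ?e (f j) m)" for m
  proof -
    have "?e g m = (\<integral>\<^sup>+x. liminf (\<lambda>j. ennreal ((norm (f j m x))\<^sup>2)) \<partial>particle m)"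
    proof (rule nn_integral_cong_AE)
      show "AE x in particle m. ennreal ((norm (g m x))\<^sup>2) = liminf (\<lambda>j. ennreal ((norm (f j m x))\<^sup>2))"
        using lim
      proof eventually_elim
        case (elim x)
        hence "(\<lambda>j. ennreal ((norm (f j m x))\<^sup>2)) \<longlonglongrightarrow> ennreal ((norm (g m x))\<^sup>2)"
          by (intro tendsto_intros)
        thus ?case by (rule lim_imp_Liminf[OF trivial_limit_sequentially, symmetric])
      qed
    qed
    also have "\<dots> \<le> liminf (\<lambda>j. ?e (f j) m)"
      by (rule nn_integral_liminf) measurable
    finally show ?thesis .
  qed
  hence "fock_energy g \<le> (\<Sum>m. liminf (\<lambda>j. ?e (f j) m))"
    unfolding fock_energy_def by (intro suminf_le) auto
  also have "\<dots> \<le> liminf (\<lambda>j. fock_energy (f j))"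
    unfolding fock_energy_def nn_integral_count_space_nat[symmetric]
    by (rule nn_integral_liminf) simp
  finally show ?thesis .
qed

text \<open>Riesz-Fischer: a rapidly converging subsequence has an almost everywhere limit in every
  component, and Fatou, with one index fixed, turns the Cauchy estimate into a bound on the distance
  to that limit.\<close>

instance fock :: complete_space
proof
  fix F :: "nat \<Rightarrow> fock"
  assume F: "Cauchy F"
  have "\<exists>N. \<forall>i\<ge>N. \<forall>j\<ge>N. dist (F i) (F j) < (1/8) ^ k" for k
    using F unfolding Cauchy_def by simp
  then obtain N where N: "\<And>k i j. i \<ge> N k \<Longrightarrow> j \<ge> N k \<Longrightarrow> dist (F i) (F j) < (1/8) ^ k"
    by metis
  \<comment> \<open>The summand \<open>k\<close> makes \<open>r\<close> strictly increasing; the sum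
    makes \<open>r k\<close> dominate every \<open>N j\<close> with j \<le> k.\<close>
  define r where "r k = k + (\<Sum>j\<le>k. N j)" for k
  have r: "strict_mono r" by (auto simp: strict_mono_Suc_iff r_def)
  have rN: "N k \<le> r j" if "k \<le> j" for k j
    unfolding r_def using that by (auto intro!: trans_le_add2 member_le_sum)
  have "\<forall>k. \<exists>f. fock_fun f \<and> F (r k) = abs_fock f" using ex_abs_fock by blast
  then obtain f where "\<forall>k. fock_fun (f k) \<and> F (r k) = abs_fock (f k)"
    by (rule choice[THEN exE])
  hence f: "\<And>k. fock_fun (f k)" "\<And>k. F (r k) = abs_fock (f k)" by auto
  have meas [measurable]: "f k m \<in> borel_measurable (particle m)" for k m
    using f(1)[of k] by (auto simp: fock_fun_def square_integrable_def)
  have en: "fock_energy (\<lambda>m x. f j m x - f k m x) = ennreal ((dist (F (r j)) (F (r k)))\<^sup>2)" for j k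
    unfolding dist_norm f(2) by (simp add: abs_fock_diff fock_energy_eq f(1))
  have small: "fock_energy (\<lambda>m x. f j m x - f k m x) \<le> ennreal ((1/8) ^ l)" if "l \<le> j" "l \<le> k" for j k l
  proof -
    have d: "dist (F (r j)) (F (r k)) < (1/8) ^ l"
      by (rule N) (use rN that in auto)
    hence "(dist (F (r j)) (F (r k)))\<^sup>2 \<le> ((1/8) ^ l)\<^sup>2" by (intro power_mono) auto
    also have "\<dots> \<le> (1/8) ^ l"
      by (simp add: power_le_one power2_eq_square mult_left_le)
    finally show ?thesis unfolding en by (rule ennreal_leI)
  qed
  have conv: "AE x in particle m. convergent (\<lambda>k. f k m x)" for m
  proof (rule AE_convergent_if_geometric)
    fix k
    have "sum (\<lambda>m. \<integral>\<^sup>+x. ennreal ((norm (f (Suc k) m x - f k m x))\<^sup>2) \<partial>particle m) {m} \<le>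
        fock_energy (\<lambda>m x. f (Suc k) m x - f k m x)"
      unfolding fock_energy_def by (rule sum_le_suminf) auto
    also have "\<dots> \<le> ennreal ((1/8) ^ k)" by (rule small) auto
    finally show "(\<integral>\<^sup>+x. ennreal ((norm (f (Suc k) m x - f k m x))\<^sup>2) \<partial>particle m) \<le> ennreal ((1/8) ^ k)"
      by simp
  qed simp
  \<comment> \<open>Where the sequence diverges, \<open>lim\<close> still yields a measurable
    function, and this happens only on a null set.\<close>
  define g where "g m x = lim (\<lambda>k. f k m x)" for m x
  have gm [measurable]: "g m \<in> borel_measurable (particle m)" for m
    unfolding g_def by measurable
  have bound: "fock_energy (\<lambda>m x. g m x - f k m x) \<le> ennreal ((1/8) ^ k)" for k
  proof -
    have "fock_energy (\<lambda>m x. g m x - f k m x) \<le> liminf (\<lambda>j. fock_energy (\<lambda>m x. f j m x - f k m x))"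
    proof (rule fock_energy_liminf)
      fix m
      show "AE x in particle m. (\<lambda>j. f j m x - f k m x) \<longlonglongrightarrow> g m x - f k m x"
        using conv[of m] by eventually_elim (auto simp: g_def convergent_LIMSEQ_iff intro!: tendsto_intros)
    qed measurable
    also have "\<dots> \<le> ennreal ((1/8) ^ k)"
    proof (rule Liminf_le)
      show "\<forall>\<^sub>F j in sequentially. fock_energy (\<lambda>m x. f j m x - f k m x) \<le> ennreal ((1/8) ^ k)"
        using eventually_ge_at_top[of k] by eventually_elim (rule small, auto)
    qed simp
    finally show ?thesis .
  qed
  have df: "fock_fun (\<lambda>m x. g m x - f k m x)" for k
    by (rule fock_fun_if_energy) (use bound[of k] in \<open>auto intro: order_le_less_trans\<close>)
  from fock_fun_add[OF df[of 0] f(1)[of 0]] have g: "fock_fun g" by simp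
  have le: "(norm (abs_fock g - F (r k)))\<^sup>2 \<le> (1/8) ^ k" for k
    using bound[of k] unfolding f(2)[of k] abs_fock_diff(1)[OF g f(1)[of k]] fock_energy_eq[OF df[of k]]
    by (subst (asm) ennreal_le_iff) auto
  have
 "(\<lambda>k. (norm (abs_fock g - F (r k)))\<^sup>2) \<longlonglongrightarrow> 0"
    
  proof (rule tendsto_sandwich[of "\<lambda>_. 0"])
    show "(\<lambda>k. (1/8 :: real) ^ k) \<longlonglongrightarrow> 0" by (rule LIMSEQ_realpow_zero) auto
  qed (use le in \<open>simp_all only: zero_le_power2 eventually_True tendsto_const\<close>)
  hence "(\<lambda>k. norm (abs_fock g - F (r k))) \<longlonglongrightarrow> 0"
    using tendsto_real_sqrt by fastforce
  hence "(F \<circ> r) \<longlonglongrightarrow> abs_fock g"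
    by (simp add: tendsto_iff dist_norm norm_minus_commute)
  from Cauchy_converges_subseq[OF F r this] show "convergent F"
    by (auto simp: convergent_def)
qed


section \<open>Bounded operators\<close>

lemma cinner_add_left: "cinner (f + g) h = cinner f h + cinner g h"
  by (simp add: cinner_commute[of "f + g" h] cinner_commute[of f h] cinner_commute[of g h] cinner_add_right)

lemma cinner_cscale_left: "cinner (c *\<^sub>C f) g = cnj c * cinner f g"
  by (simp add: cinner_commute[of "c *\<^sub>C f" g] cinner_commute[of f g] cinner_cscale_right)

lemma cinner_zero_right [simp]: "cinner f 0 = 0"
  using cinner_add_right[of f 0 0] by simp

lemma cinner_zero_left [simp]: "cinner 0 f = 0"
  by (simp add: cinner_commute[of 0 f])

lemma cinner_diff_right: "cinner f (g - h) = cinner f g - cinner f h"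
  using cinner_add_right[of f "g - h" h] by simp

lemma cinner_diff_left: "cinner (f - g) h = cinner f h - cinner g h"
  by (simp add: cinner_commute[of "f - g" h] cinner_commute[of f h] cinner_commute[of g h] cinner_diff_right)

lemma cinner_sum_right: "cinner f (\<Sum>i\<in>A. g i) = (\<Sum>i\<in>A. cinner f (g i))"
  by (induction A rule: infinite_finite_induct) (auto simp: cinner_add_right)

lemma cinner_sum_left: "cinner (\<Sum>i\<in>A. g i) f = (\<Sum>i\<in>A. cinner (g i) f)"
  by (induction A rule: infinite_finite_induct) (auto simp: cinner_add_left)

lemma cinner_same: "cinner f f = of_real ((norm f)\<^sup>2)"
proof (rule complex_eqI)
  show "Re (cinner f f) = Re (of_real ((norm f)\<^sup>2))"
    by (simp add: power2_norm_eq_inner inner_fock_def)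
  show "Im (cinner f f) = Im (of_real ((norm f)\<^sup>2))"
    using arg_cong[OF cinner_commute[of f f], of Im] by simp
qed

lemma cinner_ext:
  assumes "\<And>g. cinner g a = cinner g b"
  shows "a = b"
proof -
  have "cinner (a - b) (a - b) = 0" using assms by (simp add: cinner_diff_right)
  thus ?thesis by (simp add: cinner_same)
qed

lemma norm_cscale: "norm (c *\<^sub>C f) = norm c * norm f"
proof -
  have "of_real ((norm (c *\<^sub>C f))\<^sup>2) = (of_real ((norm c * norm f)\<^sup>2) :: complex)"
    unfolding cinner_same[symmetric] cinner_cscale_left cinner_cscale_right
    by (simp add: cinner_same power_mult_distrib complex_norm_square flip: mult.assoc)
       (simp add: complex_norm_square[of c, simplified])
  hence "(norm (c *\<^sub>C f))\<^sup>2 = (norm c * norm f)\<^sup>2" by (simp only: of_real_eq_iff)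
  thus ?thesis by (rule power2_eq_imp_eq) auto
qed

lemma norm_cinner_le: "norm (cinner f g) \<le> norm f * norm g"
proof (cases "cinner f g = 0")
  case False
  \<comment> \<open>A unimodular factor that rotates the inner product onto the positive real axis,
    where the real Cauchy-Schwarz inequality applies.\<close>
  let ?c = "cnj (cinner f g) / norm (cinner f g)"
  have "cinner f (?c *\<^sub>C g) = of_real (norm (cinner f g))"
    using False by (simp add: cinner_cscale_right complex_norm_square[symmetric] mult.commute power2_eq_square)
  hence "norm (cinner f g) = inner f (?c *\<^sub>C g)" by (simp add: inner_fock_def)
  also have "\<dots> \<le> norm f * norm (?c *\<^sub>C g)" by (rule norm_cauchy_schwarz)
  also have "\<dots> = norm f * norm g" using False by (simp add: norm_cscale norm_divide)
  finally show ?thesis .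
qed simp

lemma scaleR_eq_cscale: "r *\<^sub>R f = of_real r *\<^sub>C f"
  by (rule scaleR_fock_def)

lemma bounded_clinearI:
  assumes "\<And>f g. T (f + g) = T f + T g" "\<And>c f. T (c *\<^sub>C f) = c *\<^sub>C T f"
    "\<And>f. norm (T f) \<le> norm f * K"
  shows "bounded_clinear T"
  unfolding bounded_clinear_def
proof
  show "bounded_linear T"
    by (rule bounded_linear_intro[of T K]) (use assms in \<open>auto simp: scaleR_eq_cscale\<close>)
qed (use assms in auto)

lemma bounded_clinear_bounded_linear: "bounded_clinear T \<Longrightarrow> bounded_linear T"
  by (simp add: bounded_clinear_def)

lemma bounded_clinear_cscale: "bounded_clinear T \<Longrightarrow> T (c *\<^sub>C f) = c *\<^sub>C T f"
  by (simp add: bounded_clinear_def)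

lemma bounded_clinear_add: "bounded_clinear T \<Longrightarrow> T (f + g) = T f + T g"
  by (simp add: bounded_clinear_def bounded_linear.linear linear_add)

lemma bounded_clinear_diff: "bounded_clinear T \<Longrightarrow> T (f - g) = T f - T g"
  by (simp add: bounded_clinear_def bounded_linear.linear linear_diff)

lemma bounded_clinear_zero: "bounded_clinear T \<Longrightarrow> T 0 = 0"
  by (simp add: bounded_clinear_def bounded_linear.linear linear_0)

lemma bounded_clinear_sum: "bounded_clinear T \<Longrightarrow> T (\<Sum>i\<in>A. f i) = (\<Sum>i\<in>A. T (f i))"
  by (simp add: bounded_clinear_def bounded_linear.linear linear_sum)

lemma bounded_clinear_compose:
  assumes "bounded_clinear T" "bounded_clinear U"
  shows "bounded_clinear (\<lambda>f. T (U f))"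
  using assms bounded_linear_compose[of T U] by (auto simp: bounded_clinear_def)

lemma bounded_linear_cscale: "bounded_linear (\<lambda>f. c *\<^sub>C f)"
  by (rule bounded_linear_intro[of _ "norm c"])
     (auto simp: cscale_add_right scaleR_eq_cscale cscale_cscale mult.commute norm_cscale)

lemma bounded_linear_cinner_left: "bounded_linear (\<lambda>f. cinner f g)"
  by (rule bounded_linear_intro[of _ "norm g"])
     (auto simp: cinner_add_left scaleR_eq_cscale cinner_cscale_left scaleR_conv_of_real norm_cinner_le)

lemma bounded_clinear_plus:
  assumes "bounded_clinear T" "bounded_clinear U"
  shows "bounded_clinear (\<lambda>f. T f + U f)"
  using assms by (auto simp: bounded_clinear_def cscale_add_right intro: bounded_linear_add)

lemma bounded_clinear_cmult:
  assumes "bounded_clinear T"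
  shows "bounded_clinear (\<lambda>f. c *\<^sub>C T f)"
  using assms bounded_linear_compose[OF bounded_linear_cscale, of T]
  by (auto simp: bounded_clinear_def cscale_cscale mult.commute)

lemma bounded_clinear_id: "bounded_clinear (\<lambda>f. f)"
  by (simp add: bounded_clinear_def bounded_linear_ident)

lemma bounded_clinear_minus:
  assumes "bounded_clinear T" "bounded_clinear U"
  shows "bounded_clinear (\<lambda>f. T f - U f)"
  using bounded_clinear_plus[OF assms(1) bounded_clinear_cmult[OF assms(2), of "-1"]]
  unfolding minus_fock_def uminus_fock_def .

text \<open>Linearity of \<open>S\<close> is seen by testing against all vectors, the bound from |S
  f|^2 = <T (S f), f>. This spares a check of linearity on representatives for annihilation,
  creation and projection operators alike.\<close>

lemma adjoint_bounded_clinear: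
  assumes adj: "\<And>f g. cinner (T f) g = cinner f (S g)"
    and bound: "\<And>f. norm (T f) \<le> norm f * K"
  shows "bounded_clinear S" and "norm (S f) \<le> norm f * K"
proof -
  show *: "norm (S f) \<le> norm f * K" for f
  proof (cases "S f = 0")
    case True
    have "0 \<le> norm (T f)" by simp
    also have "\<dots> \<le> norm f * K" by (rule bound)
    finally show ?thesis using True by simp
  next
    case False
    have "norm (S f) * norm (S f) = norm (cinner (T (S f)) f)"
      unfolding adj cinner_same by (simp add: power2_eq_square norm_mult)
    also have "\<dots> \<le> norm (T (S f)) * norm f" by (rule norm_cinner_le)
    also have "\<dots> \<le> (norm (S f) * K) * norm f" by (intro mult_right_mono bound) simp
    finally have "norm (S f) * norm (S f) \<le> norm (S f) * (norm f * K)" by (simp add: mult_ac)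
    thus ?thesis using False by (subst (asm) mult_le_cancel_left_pos) auto
  qed
  show "bounded_clinear S"
  proof (rule bounded_clinearI[of _ K])
    show "S (f + g) = S f + S g" for f g
      by (rule cinner_ext) (simp add: adj[symmetric] cinner_add_right)
    show "S (c *\<^sub>C f) = c *\<^sub>C S f" for c f
      by (rule cinner_ext) (simp add: adj[symmetric] cinner_cscale_right)
  qed (rule *)
qed


section \<open>Orthogonal projections\<close>

text \<open>The parallelogram law makes a minimising sequence for the distance Cauchy; comparing its
  limit \<open>p\<close> with \<open>p + c g\<close> gives orthogonality.\<close>

lemma closed_subspace_projection:
  fixes S :: "'a::{real_inner, complete_space} set"
  assumes S: "closed S" "subspace S"
  obtains p where "p \<in> S" "\<And>g. g \<in> S \<Longrightarrow> inner g (f - p) = 0"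
proof -
  define d where "d = (INF g\<in>S. norm (f - g))"
  have ne: "S \<noteq> {}" using S subspace_0 by auto
  have bdd: "bdd_below ((\<lambda>g. norm (f - g)) ` S)" by (rule bdd_belowI2[of _ 0]) simp
  have d: "d \<le> norm (f - g)" if "g \<in> S" for g
    unfolding d_def by (rule cINF_lower[OF bdd that])
  have d0: "0 \<le> d" unfolding d_def by (rule cINF_greatest[OF ne]) simp
  have "\<exists>g\<in>S. norm (f - g) < d + 1 / real (Suc n)" for n
    using cINF_less_iff[OF ne bdd, of "d + 1 / real (Suc n)"] unfolding d_def by simp
  then obtain q where q: "\<And>n. q n \<in> S" "\<And>n. norm (f - q n) < d + 1 / real (Suc n)"
    by metis
  have lim: "(\<lambda>n. norm (f - q n)) \<longlonglongrightarrow> d"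
  proof (rule tendsto_sandwich[of "\<lambda>_. d" _ _ "\<lambda>n. d + 1 / real (Suc n)"])
    show "(\<lambda>n. d + 1 / real (Suc n)) \<longlonglongrightarrow> d"
      using tendsto_add[OF tendsto_const[of d] LIMSEQ_inverse_real_of_nat] by (simp add: inverse_eq_divide)
    show "\<forall>\<^sub>F n in sequentially. norm (f - q n) \<le> d + 1 / real (Suc n)"
      using q(2) by (intro always_eventually) (auto intro: less_imp_le)
  qed (use d q in auto)
  \<comment> \<open>parallelogram law; the midpoint of \<open>q m\<close> and \<open>q n\<close> is again in \<open>S\<close>\<close>
  have par: "(norm (q m - q n))\<^sup>2 \<le> 2 * (norm (f - q m))\<^sup>2 + 2 * (norm (f - q n))\<^sup>2 - 4 * d\<^sup>2" for m n
  proof -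
    have "(1/2) *\<^sub>R (q m + q n) \<in> S"
      using q S by (intro subspace_scale subspace_add) auto
    from d[OF this] have "d\<^sup>2 \<le> (norm (f - (1/2) *\<^sub>R (q m + q n)))\<^sup>2"
      using d0 by (intro power_mono) auto
    thus ?thesis
      by (simp add: power2_norm_eq_inner inner_diff_left inner_diff_right inner_add_left inner_add_right inner_commute field_simps)
  qed
  have "Cauchy q"
  proof (rule metric_CauchyI)
    fix e :: real assume e: "0 < e"
    have "(\<lambda>n. (norm (f - q n))\<^sup>2) \<longlonglongrightarrow> d\<^sup>2" by (intro tendsto_intros lim)
    hence "\<forall>\<^sub>F n in sequentially. (norm (f - q n))\<^sup>2 < d\<^sup>2 + e\<^sup>2 / 4"
      by (rule order_tendstoD) (use e in simp)
    \<comment> \<open>With the margin e^2 / 4 for both indices the right-hand side of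
      \<open>par\<close> stays below e^2.\<close>
    then obtain N where N: "\<And>n. n \<ge> N \<Longrightarrow> (norm (f - q n))\<^sup>2 < d\<^sup>2 + e\<^sup>2 / 4"
      by (auto simp: eventually_sequentially)
    have "dist (q m) (q n) < e" if "m \<ge> N" "n \<ge> N" for m n
    proof -
      have "(norm (q m - q n))\<^sup>2 < e\<^sup>2"
        using par[of m n] N[OF that(1)] N[OF that(2)] by simp
      hence "norm (q m - q n) < e" by (rule power_less_imp_less_base) (use e in simp)
      thus ?thesis by (simp add: dist_norm)
    qed
    thus "\<exists>N. \<forall>m\<ge>N. \<forall>n\<ge>N. dist (q m) (q n) < e" by blast
  qed
  then obtain p where p: "q \<longlonglongrightarrow> p" using Cauchy_convergent_iff convergent_def by blast
  have pS: "p \<in> S" using closed_sequentially[OF S(1)] q(1) p by blast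
  have "(\<lambda>n. norm (f - q n)) \<longlonglongrightarrow> norm (f - p)" by (intro tendsto_intros p)
  hence pd: "norm (f - p) = d" using lim LIMSEQ_unique by blast
  have "inner g (f - p) = 0" if g: "g \<in> S" for g
  proof (cases "g = 0")
    case False
    \<comment> \<open>The minimiser of the quadratic polynomial c -> |f - p - c g|^2.\<close>
    define c where "c = inner g (f - p) / inner g g"
    have "p + c *\<^sub>R g \<in> S" using S g pS by (intro subspace_add subspace_scale) auto
    from d[OF this] have "(norm (f - p))\<^sup>2 \<le> (norm (f - p - c *\<^sub>R g))\<^sup>2"
      using pd by (intro power_mono) (auto simp: diff_diff_add)
    also have "\<dots> = (norm (f - p))\<^sup>2 - 2 * c * inner g (f - p) + c\<^sup>2 * inner g g"
    proof -
      have "(norm (u - c *\<^sub>R g))\<^sup>2 = (norm u)\<^sup>2 - 2 * c * inner g u + c\<^sup>2 * inner g g" for u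
        by (simp add: power2_norm_eq_inner inner_diff_left inner_diff_right inner_commute[of u g] power2_eq_square[of c] algebra_simps)
      thus ?thesis .
    qed
    also have "\<dots> = (norm (f - p))\<^sup>2 - (inner g (f - p))\<^sup>2 / inner g g"
      using False by (simp add: c_def power2_eq_square)
    finally have "(inner g (f - p))\<^sup>2 / inner g g \<le> 0" by simp
    moreover have "inner g g > 0" using False by simp
    ultimately show ?thesis by (simp add: divide_le_0_iff)
  qed simp
  with pS that show ?thesis by blast
qed

section \<open>Projections onto closed complex subspaces\<close>

definition closed_csubspace :: "fock set \<Rightarrow> bool" where
  "closed_csubspace H \<longleftrightarrow> closed H \<and> complex_fock.subspace H"

lemma orthogonal_projection_unique:
  assumes H: "closed_csubspace H"
    and p: "p \<in> H" "\<And>g. g \<in> H \<Longrightarrow> cinner g (f - p) = 0"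
  shows "orthogonal_projection H f = p"
  unfolding orthogonal_projection_def
proof (rule the_equality)
  fix q assume q: "q \<in> H \<and> (\<forall>g\<in>H. cinner g (f - q) = 0)"
  have "q - p \<in> H"
    using H p q by (auto simp: closed_csubspace_def intro: complex_fock.subspace_diff)
  hence "cinner (q - p) (f - p) = 0" "cinner (q - p) (f - q) = 0" using p q by auto
  hence "cinner (q - p) (q - p) = 0" by (simp add: cinner_diff_right)
  thus "q = p" by (simp add: cinner_same)
qed (use p in auto)

lemma orthogonal_projection:
  assumes H: "closed_csubspace H"
  shows orthogonal_projection_in: "orthogonal_projection H f \<in> H"
    and cinner_orthogonal_projection: "g \<in> H \<Longrightarrow> cinner g (f - orthogonal_projection H f) = 0"
proof -
  have "subspace H"
    using H unfolding closed_csubspace_def complex_fock.subspace_def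
    by (auto intro!: subspaceI simp: scaleR_eq_cscale)
  then obtain p where p: "p \<in> H" "\<And>g. g \<in> H \<Longrightarrow> inner g (f - p) = 0"
    using H closed_subspace_projection[of H f] by (auto simp: closed_csubspace_def)
  \<comment> \<open>Real orthogonality only controls the real part; the imaginary part is the real
    inner product with i times \<open>g\<close>, which again lies in \<open>H\<close>.\<close>
  have orth: "cinner g (f - p) = 0" if g: "g \<in> H" for g
  proof (rule complex_eqI)
    show "Re (cinner g (f - p)) = Re 0" using p(2)[OF g] by (simp add: inner_fock_def)
    have "\<i> *\<^sub>C g \<in> H"
      using H g by (auto simp: closed_csubspace_def intro: complex_fock.subspace_scale)
    from p(2)[OF this] show "Im (cinner g (f - p)) = Im 0"
      by (simp add: inner_fock_def cinner_cscale_left)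
  qed
  have eq: "orthogonal_projection H f = p"
    using orthogonal_projection_unique[OF H p(1) orth] .
  show "orthogonal_projection H f \<in> H" using eq p by simp
  show "g \<in> H \<Longrightarrow> cinner g (f - orthogonal_projection H f) = 0" using eq orth by simp
qed

lemma orthogonal_projection_ident:
  assumes "closed_csubspace H" "f \<in> H"
  shows "orthogonal_projection H f = f"
  by (rule orthogonal_projection_unique) (use assms in auto)

lemma orthogonal_projection_eq_zero:
  assumes "closed_csubspace H" "\<And>g. g \<in> H \<Longrightarrow> cinner g f = 0"
  shows "orthogonal_projection H f = 0"
  by (rule orthogonal_projection_unique)
     (use assms in \<open>auto simp: closed_csubspace_def complex_fock.subspace_0\<close>)

text \<open>Both sides equal the inner product of the two projections.\<close>

lemma orthogonal_projection_self_adjoint: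
  assumes H: "closed_csubspace H"
  shows "cinner (orthogonal_projection H f) g = cinner f (orthogonal_projection H g)"
proof -
  let ?P = "orthogonal_projection H"
  have "cinner (?P f) (g - ?P g) = 0" "cinner (?P g) (f - ?P f) = 0"
    using orthogonal_projection[OF H] by auto
  hence "cinner (?P f) g = cinner (?P f) (?P g)" "cinner (?P g) f = cinner (?P g) (?P f)"
    by (simp_all add: cinner_diff_right)
  thus ?thesis by (metis cinner_commute)
qed

lemma norm_orthogonal_projection_le:
  assumes H: "closed_csubspace H"
  shows "norm (orthogonal_projection H f) \<le> norm f"
proof -
  let ?p = "orthogonal_projection H f"
  have "cinner ?p (f - ?p) = 0"
    using orthogonal_projection[OF H] by auto
  hence "cinner ?p ?p = cinner ?p f" by (simp add: cinner_diff_right)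
  hence "norm ?p * norm ?p \<le> norm ?p * norm f"
    using norm_cinner_le[of ?p f] by (metis cinner_same norm_of_real abs_power2 abs_norm_cancel power2_eq_square abs_mult)
  thus ?thesis by (cases "?p = 0") auto
qed

lemma bounded_clinear_orthogonal_projection:
  assumes "closed_csubspace H"
  shows "bounded_clinear (orthogonal_projection H)"
  by (rule adjoint_bounded_clinear(1)[of "orthogonal_projection H" _ 1])
     (use assms in \<open>auto simp: orthogonal_projection_self_adjoint norm_orthogonal_projection_le\<close>)

text \<open>Pythagoras. It allows the distance of a vector to a toy Fock space to be estimated
  through any explicit candidate in that space.\<close>

lemma norm_diff_orthogonal_projection_le:
  assumes H: "closed_csubspace H" and g: "g \<in> H"
  shows "norm (f - orthogonal_projection H f) \<le> norm (f - g)"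
proof -
  let ?p = "orthogonal_projection H f"
  have "?p - g \<in> H"
    using H g orthogonal_projection(1)[OF H] by (auto simp: closed_csubspace_def intro: complex_fock.subspace_diff)
  hence *: "inner (?p - g) (f - ?p) = 0"
    using orthogonal_projection(2)[OF H] by (simp add: inner_fock_def)
  have "(norm (f - g))\<^sup>2 = (norm ((f - ?p) + (?p - g)))\<^sup>2" by simp
  also have "\<dots> = (norm (f - ?p))\<^sup>2 + (norm (?p - g))\<^sup>2"
    by (rule norm_add_Pythagorean) (use * in \<open>simp add: orthogonal_def inner_commute\<close>)
  finally have "(norm (f - ?p))\<^sup>2 \<le> (norm (f - g))\<^sup>2" by simp
  thus ?thesis by (rule power2_le_imp_le) simp
qed

lemma closed_csubspace_eq_UNIV:
  assumes H: "closed_csubspace H"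
    and "\<And>f. (\<And>g. g \<in> H \<Longrightarrow> cinner g f = 0) \<Longrightarrow> f = 0"
  shows "H = UNIV"
proof -
  have "f \<in> H" for f
    using assms(2)[of "f - orthogonal_projection H f"] orthogonal_projection[OF H, where f = f] by simp
  thus ?thesis by blast
qed


section \<open>Creation, annihilation and field operators\<close>

definition hnorm :: "(real \<Rightarrow> real) \<Rightarrow> real" where
  "hnorm h = sqrt (\<integral>y. (h y)\<^sup>2 \<partial>half_line)"

text \<open>Free creation tensors with \<open>h\<close> on the left without any symmetrisation, so
  it is an isometry up to the factor \<open>hnorm h\<close>, independently of the particle
  number.\<close>

lemma norm_create:
  assumes h: "square_integrable half_line h"
  shows "norm (create h F) = hnorm h * norm F"
proof -
  obtain f where f: "fock_fun f" and F: "F = abs_fock f" using ex_abs_fock by blast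
  let ?c = "\<lambda>m x. if square_integrable half_line h
        then case m of 0 \<Rightarrow> 0 | Suc k \<Rightarrow> of_real (h (x 0)) * f k (\<lambda>i. x (Suc i)) else 0 :: complex"
  have r: "fock_rel f f" using f by (simp add: fock_rel_self_iff)
  have cF: "create h F = abs_fock ?c" unfolding F by (rule create.abs_eq[OF r])
  have c: "fock_fun ?c" using create.rsp r by (auto simp: rel_fun_def fock_rel_self_iff[symmetric])
  have "(norm (create h F))\<^sup>2 = (\<Sum>m. \<integral>x. (norm (?c m x))\<^sup>2 \<partial>particle m)"
    unfolding cF by (rule power2_norm_abs_fock[OF c])
  also have "\<dots> = (\<Sum>m. \<integral>x. (norm (?c (Suc m) x))\<^sup>2 \<partial>particle (Suc m))"
    by (subst suminf_split_head) (use c in \<open>auto simp: fock_fun_def h\<close>)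
  also have "\<dots> = (\<Sum>m. (hnorm h)\<^sup>2 * (\<integral>x. (norm (f m x))\<^sup>2 \<partial>particle m))"
  proof (rule suminf_cong)
    fix m
    have "square_integrable (particle m) (f m)" using f by (simp add: fock_fun_def)
    from square_integrable_create(2)[OF h this]
    show "(\<integral>x. (norm (?c (Suc m) x))\<^sup>2 \<partial>particle (Suc m)) = (hnorm h)\<^sup>2 * (\<integral>x. (norm (f m x))\<^sup>2 \<partial>particle m)"
      using h by (simp add: hnorm_def)
  qed
  also have "\<dots> = (hnorm h * norm F)\<^sup>2"
    using f by (simp add: suminf_mult fock_fun_def F power2_norm_abs_fock power_mult_distrib)
  finally show ?thesis
    by (rule power2_eq_imp_eq) (auto simp: hnorm_def)
qed

text \<open>By \<open>particle_Suc\<close> the head coordinate can be split off, and Fubini moves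
  \<open>h\<close> from one factor to the other; no conjugate appears because \<open>h\<close> is
  real-valued.\<close>

lemma cinner_create:
  assumes h: "square_integrable half_line h"
  shows "cinner (create h F) G = cinner F (annihilate h G)"
proof -
  obtain f g where f: "fock_fun f" and F: "F = abs_fock f" and g: "fock_fun g" and G: "G = abs_fock g"
    using ex_abs_fock by metis
  let ?c = "\<lambda>m x. if square_integrable half_line h
        then case m of 0 \<Rightarrow> 0 | Suc k \<Rightarrow> of_real (h (x 0)) * f k (\<lambda>i. x (Suc i)) else 0 :: complex"
  let ?a = "\<lambda>m x. if square_integrable half_line h
        then \<integral>y. of_real (h y) * g (Suc m) (case_nat y x) \<partial>half_line else 0 :: complex"
  have rf: "fock_rel f f" and rg: "fock_rel g g" using f g by (simp_all add: fock_rel_self_iff)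
  have cr: "fock_rel ?c ?c" using create.rsp rf by (auto simp: rel_fun_def)
  have ar: "fock_rel ?a ?a" using annihilate.rsp rg by (auto simp: rel_fun_def)
  have cF: "create h F = abs_fock ?c" unfolding F by (rule create.abs_eq[OF rf])
  have aG: "annihilate h G = abs_fock ?a" unfolding G by (rule annihilate.abs_eq[OF rg])
  have eq: "(\<integral>x. cnj (?c (Suc m) x) * g (Suc m) x \<partial>particle (Suc m)) =
      (\<integral>x. cnj (f m x) * ?a m x \<partial>particle m)" for m
  proof -
    interpret pair_sigma_finite "particle m" half_line
      by (simp add: pair_sigma_finite_def sigma_finite_particle half_line.sigma_finite_measure_axioms)
    let ?k = "\<lambda>z. cnj (?c (Suc m) z) * g (Suc m) z"
    have "square_integrable (particle (Suc m)) (?c (Suc m))" "square_integrable (particle (Suc m)) (g (Suc m))"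
      using cr g by (simp_all only: fock_fun_def fock_rel_self_iff)
    hence I: "integrable (particle (Suc m)) ?k" by (rule square_integrable_mult(1))
    hence I2: "integrable (particle m \<Otimes>\<^sub>M half_line) (\<lambda>w. ?k (case w of (x, y) \<Rightarrow> case_nat y x))"
      by (subst (asm) particle_Suc[symmetric]) (rule integrable_distr[OF measurable_case_nat_particle])
    have "(\<integral>z. ?k z \<partial>particle (Suc m)) =
        (\<integral>w. ?k (case w of (x, y) \<Rightarrow> case_nat y x) \<partial>(particle m \<Otimes>\<^sub>M half_line))"
      by (subst particle_Suc[symmetric]) 
         (rule integral_distr, rule measurable_case_nat_particle, rule borel_measurable_integrable[OF I])
    also have "\<dots> = (\<integral>x. \<integral>y. ?k (case (x, y) of (x, y) \<Rightarrow> case_nat y x) \<partial>half_line \<partial>particle m)"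
      by (rule integral_fst'[symmetric, OF I2])
    also have "\<dots> = (\<integral>x. cnj (f m x) * ?a m x \<partial>particle m)"
    proof (rule Bochner_Integration.integral_cong[OF refl])
      fix x
      have "?k (case (x, y) of (x, y) \<Rightarrow> case_nat y x) =
          cnj (f m x) * (of_real (h y) * g (Suc m) (case_nat y x))" for y
        using h by simp
      thus "(\<integral>y. ?k (case (x, y) of (x, y) \<Rightarrow> case_nat y x) \<partial>half_line) = cnj (f m x) * ?a m x"
        using h by (simp only: if_True integral_mult_right_zero)
    qed
    finally show ?thesis .
  qed
  have "cinner (create h F) G = (\<Sum>m. \<integral>x. cnj (?c m x) * g m x \<partial>particle m)"
    unfolding cF unfolding G by (rule cinner.abs_eq[OF cr rg])
  also have "\<dots> = (\<Sum>m. \<integral>x. cnj (?c (Suc m) x) * g (Suc m) x \<partial>particle (Suc m))"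
    by (subst suminf_split_head[OF fock_fun_summable_inner])
       (use cr g in \<open>auto simp: fock_rel_self_iff h\<close>)
  also have "\<dots> = (\<Sum>m. \<integral>x. cnj (f m x) * ?a m x \<partial>particle m)" unfolding eq ..
  also have "\<dots> = cinner F (annihilate h G)"
    unfolding aG unfolding F by (rule cinner.abs_eq[OF rf ar, symmetric])
  finally show ?thesis .
qed

text \<open>Everything is inherited from the adjoint \<open>create h\<close>, whose norm is
  explicit.\<close>

lemma annihilate_adjoint:
  assumes h: "square_integrable half_line h"
  shows bounded_clinear_annihilate: "bounded_clinear (annihilate h)"
    and norm_annihilate_le: "norm (annihilate h F) \<le> hnorm h * norm F"
proof -
  have "norm (create h F) \<le> norm F * hnorm h" for F
    using norm_create[OF h, of F] by (simp add: mult.commute[of "norm F"])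
  note * = adjoint_bounded_clinear[of "create h" "annihilate h" "hnorm h", OF cinner_create[OF h] this]
  show "bounded_clinear (annihilate h)" by (rule *(1))
  show "norm (annihilate h F) \<le> hnorm h * norm F"
    using *(2)[of F] by (simp add: mult.commute[of "norm F"])
qed

lemma cinner_annihilate:
  assumes h: "square_integrable half_line h"
  shows "cinner (annihilate h F) G = cinner F (create h G)"
  by (simp add: cinner_commute[of "annihilate h F" G] cinner_commute[of F "create h G"] cinner_create[OF h])

lemma bounded_clinear_create:
  assumes h: "square_integrable half_line h"
  shows "bounded_clinear (create h)"
proof (rule adjoint_bounded_clinear(1)[of "annihilate h" _ "hnorm h"])
  show "cinner (annihilate h F) G = cinner F (create h G)" for F G by (rule cinner_annihilate[OF h])
  show "norm (annihilate h F) \<le> norm F * hnorm h" for F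
    using norm_annihilate_le[OF h, of F] by (simp add: mult.commute[of "norm F"])
qed

text \<open>Additivity and homogeneity in the one-particle function in a single rule. The rules for
  \<open>annihilate\<close> and \<open>field_op\<close> have the same shape, so that
  \<open>grid_sum\<close> can take the operator family as a parameter.\<close>

lemma create_linear_combination:
  assumes "square_integrable half_line h" "square_integrable half_line k" "square_integrable half_line l"
    and "\<And>y. l y = h y + c * k y"
  shows "create l F = create h F + of_real c *\<^sub>C create k F"
  using assms
proof (transfer, goal_cases)
  case (1 h k l c f)
  let ?c = "\<lambda>l m x. if square_integrable half_line l
        then case m of 0 \<Rightarrow> 0 | Suc k \<Rightarrow> of_real (l (x 0)) * f k (\<lambda>i. x (Suc i)) else 0 :: complex"
  have "fock_rel (?c l) (?c l)"
    using create.rsp[THEN rel_funD, OF refl[of l], THEN rel_funD, OF 1(5)] .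
  moreover have "(\<lambda>m x. ?c h m x + of_real c * ?c k m x) = ?c l"
    using 1 by (intro ext) (auto split: nat.split simp: algebra_simps)
  ultimately show ?case by simp
qed

lemma annihilate_linear_combination:
  assumes "square_integrable half_line h" "square_integrable half_line k" "square_integrable half_line l"
    and "\<And>y. l y = h y + c * k y"
  shows "annihilate l F = annihilate h F + of_real c *\<^sub>C annihilate k F"
proof (rule cinner_ext)
  fix G
  show "cinner G (annihilate l F) = cinner G (annihilate h F + of_real c *\<^sub>C annihilate k F)"
    using assms(1-3)
    by (simp add: cinner_create[symmetric] cinner_add_right cinner_cscale_right
        create_linear_combination[OF assms] cinner_add_left cinner_cscale_left)
qed

text \<open>For the indicator of \<open>{0..<t}\<close> this is \<open>free_brownian t\<close>; for
  a cell function its compression to the toy space is \<open>toy_X\<close>.\<close>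

definition field_op :: "(real \<Rightarrow> real) \<Rightarrow> fock \<Rightarrow> fock" where
  "field_op h f = create h f + annihilate h f"

lemma bounded_clinear_field_op:
  "square_integrable half_line h \<Longrightarrow> bounded_clinear (field_op h)"
  unfolding field_op_def
  by (intro bounded_clinear_plus bounded_clinear_create bounded_clinear_annihilate)

lemma norm_field_op_le:
  "square_integrable half_line h \<Longrightarrow> norm (field_op h f) \<le> 2 * hnorm h * norm f"
  unfolding field_op_def
  using norm_triangle_ineq[of "create h f" "annihilate h f"] norm_create[of h f] norm_annihilate_le[of h f]
  by simp

lemma cinner_field_op:
  "square_integrable half_line h \<Longrightarrow> cinner (field_op h f) g = cinner f (field_op h g)"
  unfolding field_op_def
  by (simp add: cinner_add_left cinner_add_right cinner_create cinner_annihilate)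

lemma field_op_linear_combination:
  assumes "square_integrable half_line h" "square_integrable half_line k" "square_integrable half_line l"
    and "\<And>y. l y = h y + c * k y"
  shows "field_op l F = field_op h F + of_real c *\<^sub>C field_op k F"
  unfolding field_op_def create_linear_combination[OF assms] annihilate_linear_combination[OF assms]
  by (simp add: cscale_add_right algebra_simps)


section \<open>Toy operators as compressions\<close>

text \<open>Non-adapted words are produced here as well; removing them is left to the
  projection.\<close>

lemma create_toy_basis: "create (toy_step n i) (toy_basis n \<sigma>) = toy_basis n (i # \<sigma>)"
proof (transfer, goal_cases)
  case (1 n i \<sigma>)
  let ?X = "\<lambda>\<sigma> m x. if m = length \<sigma> then \<Prod>j<m. of_real (toy_step n (\<sigma> ! j) (x j)) else 0 :: complex"
  have "(\<lambda>m x. if square_integrable half_line (toy_step n i)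
        then case m of 0 \<Rightarrow> 0 | Suc k \<Rightarrow> of_real (toy_step n i (x 0)) * ?X \<sigma> k (\<lambda>i. x (Suc i)) else 0) =
      ?X (i # \<sigma>)"
    by (intro ext)
       (auto simp: square_integrable_toy_step prod.lessThan_Suc_shift simp del: prod.lessThan_Suc split: nat.split)
  moreover have "fock_rel (?X (i # \<sigma>)) (?X (i # \<sigma>))"
    using toy_basis.rsp[THEN rel_funD, OF refl[of n], THEN rel_funD, OF refl[of "i # \<sigma>"]] .
  ultimately show ?case by simp
qed

lemma annihilate_toy_basis_Nil: "annihilate (toy_step n i) (toy_basis n []) = 0"
proof (transfer, goal_cases)
  case (1 n i)
  let ?X = "\<lambda>m x. if m = length ([] :: nat list) then \<Prod>j<m. of_real (toy_step n ([] ! j) (x j)) else 0 :: complex"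
  have "?X (Suc m) x = 0" for m x by simp
  thus ?case
    by (simp only: mult_zero_right Bochner_Integration.integral_zero if_cancel fock_rel_self_iff fock_fun_zero)
qed

lemma annihilate_toy_basis_Cons:
  assumes "n > 0"
  shows "annihilate (toy_step n i) (toy_basis n (j # \<sigma>)) = (if i = j then toy_basis n \<sigma> else 0)"
proof -
  have "annihilate (toy_step n i) (toy_basis n (j # \<sigma>)) = of_bool (i = j) *\<^sub>C toy_basis n \<sigma>"
    using assms
  proof (transfer, goal_cases)
    case (1 n i j \<sigma>)
    let ?X = "\<lambda>\<sigma> m x. if m = length \<sigma> then \<Prod>j<m. of_real (toy_step n (\<sigma> ! j) (x j)) else 0 :: complex"
    have int: "(\<integral>y. of_real (toy_step n i y) * of_real (toy_step n j y) \<partial>half_line) = (of_bool (i = j) :: complex)"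
      unfolding of_real_mult[symmetric] integral_complex_of_real integral_toy_step[OF 1] by simp
    have "(\<integral>y. of_real (toy_step n i y) * ?X (j # \<sigma>) (Suc m) (case_nat y x) \<partial>half_line) =
        of_bool (i = j) * ?X \<sigma> m x" for m x
    proof -
      have "of_real (toy_step n i y) * ?X (j # \<sigma>) (Suc m) (case_nat y x) =
          of_real (toy_step n i y) * of_real (toy_step n j y) * ?X \<sigma> m x" for y
        by (auto simp: prod.lessThan_Suc_shift simp del: prod.lessThan_Suc)
      thus ?thesis by (simp only: integral_mult_left_zero int)
    qed
    moreover have "fock_rel (?X \<sigma>) (?X \<sigma>)"
      using toy_basis.rsp[THEN rel_funD, OF refl[of n], THEN rel_funD, OF refl[of \<sigma>]] .
    hence "fock_rel (\<lambda>m x. of_bool (i = j) * ?X \<sigma> m x) (\<lambda>m x. of_bool (i = j) * ?X \<sigma> m x)"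
      using fock_fun_scale[of "?X \<sigma>" "of_bool (i = j)"] by (simp only: fock_rel_self_iff)
    ultimately show ?case by (simp only: square_integrable_toy_step if_True)
  qed
  thus ?thesis by (simp add: cscale_one)
qed

section \<open>The toy Fock space as a closed subspace and its projection\<close>

lemma closed_csubspace_closure_span: "closed_csubspace (closure (complex_fock.span B))"
  unfolding closed_csubspace_def complex_fock.subspace_def
proof (intro conjI ballI allI)
  let ?S = "complex_fock.span B"
  show "0 \<in> closure ?S" using closure_subset complex_fock.span_zero by blast
  show "x + y \<in> closure ?S" if xy: "x \<in> closure ?S" "y \<in> closure ?S" for x y
  proof -
    obtain u v where "\<And>n. u n \<in> ?S" "u \<longlonglongrightarrow> x" "\<And>n. v n \<in> ?S" "v \<longlonglongrightarrow> y"
      using xy unfolding closure_sequential by blast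
    thus ?thesis unfolding closure_sequential
      by (intro exI[of _ "\<lambda>n. u n + v n"]) (auto intro: complex_fock.span_add tendsto_intros)
  qed
  show "c *\<^sub>C x \<in> closure ?S" if x: "x \<in> closure ?S" for c x
  proof -
    obtain u where "\<And>n. u n \<in> ?S" "u \<longlonglongrightarrow> x"
      using x unfolding closure_sequential by blast
    thus ?thesis unfolding closure_sequential
      by (intro exI[of _ "\<lambda>n. c *\<^sub>C u n"])
         (auto intro: complex_fock.span_scale bounded_linear.tendsto[OF bounded_linear_cscale])
  qed
qed simp

lemma closed_csubspace_toy_fock: "closed_csubspace (toy_fock n)"
  unfolding toy_fock_def by (rule closed_csubspace_closure_span)

abbreviation toy_proj :: "nat \<Rightarrow> fock \<Rightarrow> fock" where
  "toy_proj n \<equiv> orthogonal_projection (toy_fock n)"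

lemmas toy_proj_in = orthogonal_projection_in[OF closed_csubspace_toy_fock]
lemmas toy_proj_orth = cinner_orthogonal_projection[OF closed_csubspace_toy_fock]
lemmas toy_proj_ident = orthogonal_projection_ident[OF closed_csubspace_toy_fock]
lemmas toy_proj_eq_zero = orthogonal_projection_eq_zero[OF closed_csubspace_toy_fock]
lemmas toy_proj_self_adjoint = orthogonal_projection_self_adjoint[OF closed_csubspace_toy_fock]
lemmas norm_toy_proj_le = norm_orthogonal_projection_le[OF closed_csubspace_toy_fock]
lemmas bounded_clinear_toy_proj = bounded_clinear_orthogonal_projection[OF closed_csubspace_toy_fock]
lemmas norm_diff_toy_proj_le = norm_diff_orthogonal_projection_le[OF closed_csubspace_toy_fock]

lemma toy_proj_idem: "toy_proj n (toy_proj n f) = toy_proj n f"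
  by (rule toy_proj_ident[OF toy_proj_in])

lemma toy_basis_in_toy_fock:
  assumes "distinct_adj \<sigma>"
  shows "toy_basis n \<sigma> \<in> toy_fock n"
  unfolding toy_fock_def using assms
  by (intro subsetD[OF closure_subset] complex_fock.span_base) auto

lemma toy_span_explicit:
  assumes "f \<in> complex_fock.span (toy_basis n ` {\<sigma>. distinct_adj \<sigma>})"
  obtains A c where "finite A" "A \<subseteq> {\<sigma>. distinct_adj \<sigma>}" "f = (\<Sum>\<sigma>\<in>A. c \<sigma> *\<^sub>C toy_basis n \<sigma>)"
proof -
  obtain t r where t: "finite t" "t \<subseteq> toy_basis n ` {\<sigma>. distinct_adj \<sigma>}" and f: "f = (\<Sum>a\<in>t. r a *\<^sub>C a)"
    using assms unfolding complex_fock.span_explicit by blast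
  obtain A where A: "A \<subseteq> {\<sigma>. distinct_adj \<sigma>}" "inj_on (toy_basis n) A" "t = toy_basis n ` A"
    using subset_image_inj[of t "toy_basis n" "{\<sigma>. distinct_adj \<sigma>}"] t(2) by blast
  have "finite A" using A t(1) finite_imageD by blast
  moreover have "f = (\<Sum>\<sigma>\<in>A. r (toy_basis n \<sigma>) *\<^sub>C toy_basis n \<sigma>)"
    unfolding f A(3) by (simp add: sum.reindex[OF A(2)])
  ultimately show ?thesis using that[of A "\<lambda>\<sigma>. r (toy_basis n \<sigma>)"] A(1) by simp
qed

text \<open>A property that cuts out a closed set passes from finite combinations of adapted words
  to the closure of their span.\<close>

lemma toy_fock_induct:
  assumes "closed {f. P f}"
    and "\<And>A c. finite A \<Longrightarrow> A \<subseteq> {\<sigma>. distinct_adj \<sigma>} \<Longrightarrow> P (\<Sum>\<sigma>\<in>A. c \<sigma> *\<^sub>C toy_basis n \<sigma>)"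
    and "f \<in> toy_fock n"
  shows "P f"
proof -
  have "complex_fock.span (toy_basis n ` {\<sigma>. distinct_adj \<sigma>}) \<subseteq> {f. P f}"
    using assms(2) by (auto elim!: toy_span_explicit)
  from closure_minimal[OF this assms(1)] show ?thesis using assms(3) by (auto simp: toy_fock_def)
qed

lemma toy_fock_eqI:
  assumes "bounded_clinear T" "bounded_clinear U"
    and "\<And>\<sigma>. distinct_adj \<sigma> \<Longrightarrow> T (toy_basis n \<sigma>) = U (toy_basis n \<sigma>)" and "f \<in> toy_fock n"
  shows "T f = U f"
proof (rule toy_fock_induct[where P = "\<lambda>f. T f = U f", OF _ _ assms(4)])
  have "continuous_on UNIV T" "continuous_on UNIV U"
    by (intro linear_continuous_on bounded_clinear_bounded_linear assms)+
  thus "closed {f. T f = U f}" by (rule closed_Collect_eq)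
qed (use assms(3) in \<open>auto simp: bounded_clinear_sum[OF assms(1)] bounded_clinear_sum[OF assms(2)]
       bounded_clinear_cscale[OF assms(1)] bounded_clinear_cscale[OF assms(2)] intro!: sum.cong\<close>)

text \<open>The vectors of all words, adapted or not, form one orthonormal family, so this vector is
  orthogonal to the span of the adapted ones and hence to its closure.\<close>

lemma toy_proj_basis_nonadapted:
  assumes "n > 0" "\<not> distinct_adj \<sigma>"
  shows "toy_proj n (toy_basis n \<sigma>) = 0"
proof (rule toy_proj_eq_zero)
  fix g assume "g \<in> toy_fock n"
  thus "cinner g (toy_basis n \<sigma>) = 0"
  proof (rule toy_fock_induct[rotated 2])
    have "continuous_on UNIV (\<lambda>g. cinner g (toy_basis n \<sigma>))"
      by (rule linear_continuous_on[OF bounded_linear_cinner_left])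
    thus "closed {g. cinner g (toy_basis n \<sigma>) = 0}" by (intro closed_Collect_eq) auto
    fix A :: "nat list set" and c :: "nat list \<Rightarrow> complex" assume "A \<subseteq> {\<sigma>. distinct_adj \<sigma>}"
    thus "cinner (\<Sum>\<tau>\<in>A. c \<tau> *\<^sub>C toy_basis n \<tau>) (toy_basis n \<sigma>) = 0"
      using assms(2)
      by (auto simp: cinner_sum_left cinner_cscale_left toy_basis_orthonormal[OF assms(1)] intro!: sum.neutral)
  qed
qed

text \<open>Pythagoras along a relabelling \<open>u\<close> of the words; the defect estimate needs
  the one that doubles the first letter.\<close>

lemma norm_sum_toy_basis:
  assumes n: "n > 0" and A: "finite A" "inj_on u A"
  shows "(norm (\<Sum>\<sigma>\<in>A. c \<sigma> *\<^sub>C toy_basis n (u \<sigma>)))\<^sup>2 = (\<Sum>\<sigma>\<in>A. (norm (c \<sigma>))\<^sup>2)"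
proof -
  let ?f = "\<Sum>\<sigma>\<in>A. c \<sigma> *\<^sub>C toy_basis n (u \<sigma>)"
  have "of_real ((norm ?f)\<^sup>2) = (\<Sum>\<sigma>\<in>A. \<Sum>\<tau>\<in>A. c \<sigma> * (cnj (c \<tau>) * of_bool (u \<tau> = u \<sigma>)))"
    by (simp only: cinner_same[symmetric] cinner_sum_left cinner_sum_right cinner_cscale_left
        cinner_cscale_right toy_basis_orthonormal[OF n] sum_distrib_left mult_ac)
  also have "\<dots> = (\<Sum>\<sigma>\<in>A. \<Sum>\<tau>\<in>A. if \<tau> = \<sigma> then c \<sigma> * cnj (c \<sigma>) else 0)"
    using A(2) by (intro sum.cong refl) (auto simp: inj_on_def)
  also have "\<dots> = of_real (\<Sum>\<sigma>\<in>A. (norm (c \<sigma>))\<^sup>2)"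
    using A(1) by (simp add: complex_norm_square[symmetric])
  finally show ?thesis by (simp only: of_real_eq_iff)
qed

text \<open>Approximate the projection by a finite combination \<open>g\<close> over
  \<open>A\<close>. For every finite \<open>B\<close> containing \<open>A\<close> the partial sum is
  the best approximation within the span of \<open>B\<close>, so it is at least as close as
  \<open>g\<close>.\<close>

lemma has_sum_toy_proj:
  assumes n: "n > 0"
  shows "((\<lambda>\<sigma>. cinner (toy_basis n \<sigma>) f *\<^sub>C toy_basis n \<sigma>) has_sum toy_proj n f) {\<sigma>. distinct_adj \<sigma>}"
  unfolding has_sum_def tendsto_iff
proof (intro allI impI)
  fix e :: real assume e: "0 < e"
  let ?p = "toy_proj n f"
  obtain g where g: "g \<in> complex_fock.span (toy_basis n ` {\<sigma>. distinct_adj \<sigma>})" "dist g ?p < e"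
    using toy_proj_in[of n f] e unfolding toy_fock_def closure_approachable by blast
  from g(1) obtain A c where A: "finite A" "A \<subseteq> {\<sigma>. distinct_adj \<sigma>}"
      and gA: "g = (\<Sum>\<sigma>\<in>A. c \<sigma> *\<^sub>C toy_basis n \<sigma>)" by (rule toy_span_explicit)
  have "dist (\<Sum>\<sigma>\<in>B. cinner (toy_basis n \<sigma>) f *\<^sub>C toy_basis n \<sigma>) ?p < e"
    if B: "finite B" "A \<subseteq> B" "B \<subseteq> {\<sigma>. distinct_adj \<sigma>}" for B
  proof -
    let ?s = "\<Sum>\<sigma>\<in>B. cinner (toy_basis n \<sigma>) f *\<^sub>C toy_basis n \<sigma>"
    have orth: "cinner (toy_basis n \<sigma>) (?p - ?s) = 0" if "\<sigma> \<in> B" for \<sigma>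
    proof -
      have "cinner (toy_basis n \<sigma>) (f - ?p) = 0"
        using that B(3) by (intro toy_proj_orth toy_basis_in_toy_fock) auto
      moreover have "cinner (toy_basis n \<sigma>) ?s =
          (\<Sum>\<tau>\<in>B. if \<tau> = \<sigma> then cinner (toy_basis n \<sigma>) f else 0)"
        unfolding cinner_sum_right
        by (intro sum.cong) (auto simp: cinner_cscale_right toy_basis_orthonormal[OF n])
      ultimately show ?thesis using that B(1) by (simp add: cinner_diff_right)
    qed
    have "cinner (?s - g) (?p - ?s) = 0"
    proof -
      have "cinner ?s (?p - ?s) = 0" "cinner g (?p - ?s) = 0"
        unfolding gA cinner_sum_left cinner_cscale_left using orth B(2) by (auto intro!: sum.neutral)
      thus ?thesis by (simp add: cinner_diff_left)
    qed
    hence "orthogonal (?p - ?s) (?s - g)"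
      by (simp add: orthogonal_def inner_commute[of "?p - ?s"]) (simp add: inner_fock_def)
    from norm_add_Pythagorean[OF this] have "(norm (?p - ?s))\<^sup>2 \<le> (norm (?p - g))\<^sup>2" by simp
    hence "norm (?p - ?s) \<le> norm (?p - g)" by (rule power2_le_imp_le) simp
    thus ?thesis using g(2) by (simp add: dist_norm norm_minus_commute)
  qed
  thus "\<forall>\<^sub>F B in finite_subsets_at_top {\<sigma>. distinct_adj \<sigma>}.
      dist (\<Sum>\<sigma>\<in>B. cinner (toy_basis n \<sigma>) f *\<^sub>C toy_basis n \<sigma>) ?p < e"
    unfolding eventually_finite_subsets_at_top using A by blast
qed

text \<open>A bounded operator may be applied termwise to the expansion of the projection. This
  establishes summability, without which \<open>infsum\<close> would return its default 0.\<close>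

lemma toy_operator_eq:
  assumes n: "n > 0" and T: "bounded_clinear T"
    and v: "\<And>\<sigma>. distinct_adj \<sigma> \<Longrightarrow> v \<sigma> = T (toy_basis n \<sigma>)"
  shows "toy_operator n v f = T (toy_proj n f)"
proof -
  have "((\<lambda>\<sigma>. T (cinner (toy_basis n \<sigma>) f *\<^sub>C toy_basis n \<sigma>)) has_sum T (toy_proj n f)) {\<sigma>. distinct_adj \<sigma>}"
    by (rule has_sum_bounded_linear[OF bounded_clinear_bounded_linear[OF T] has_sum_toy_proj[OF n]])
  hence "((\<lambda>\<sigma>. cinner (toy_basis n \<sigma>) f *\<^sub>C v \<sigma>) has_sum T (toy_proj n f)) {\<sigma>. distinct_adj \<sigma>}"
    by (rule has_sum_cong[THEN iffD1, rotated]) (simp add: bounded_clinear_cscale[OF T] v)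
  thus ?thesis unfolding toy_operator_def by (rule infsumI)
qed

lemma toy_create_eq:
  assumes n: "n > 0"
  shows "toy_create n i f = toy_proj n (create (toy_step n i) (toy_proj n f))"
  unfolding toy_create_def
proof (rule toy_operator_eq[OF n])
  show "bounded_clinear (\<lambda>f. toy_proj n (create (toy_step n i) f))"
    by (intro bounded_clinear_compose[OF bounded_clinear_toy_proj] bounded_clinear_create square_integrable_toy_step)
  show "(if \<sigma> = [] \<or> hd \<sigma> \<noteq> i then toy_basis n (i # \<sigma>) else 0) =
      toy_proj n (create (toy_step n i) (toy_basis n \<sigma>))" if "distinct_adj \<sigma>" for \<sigma>
    using that by (auto simp: create_toy_basis distinct_adj_Cons toy_proj_ident toy_basis_in_toy_fock
        toy_proj_basis_nonadapted[OF n])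
qed

lemma toy_annihilate_eq:
  assumes n: "n > 0"
  shows "toy_annihilate n i f = toy_proj n (annihilate (toy_step n i) (toy_proj n f))"
  unfolding toy_annihilate_def
proof (rule toy_operator_eq[OF n])
  show "bounded_clinear (\<lambda>f. toy_proj n (annihilate (toy_step n i) f))"
    by (intro bounded_clinear_compose[OF bounded_clinear_toy_proj] bounded_clinear_annihilate square_integrable_toy_step)
  show "(if \<sigma> \<noteq> [] \<and> hd \<sigma> = i then toy_basis n (tl \<sigma>) else 0) =
      toy_proj n (annihilate (toy_step n i) (toy_basis n \<sigma>))" if "distinct_adj \<sigma>" for \<sigma>
    using that
    by (cases \<sigma>) (auto simp: annihilate_toy_basis_Nil annihilate_toy_basis_Cons[OF n] toy_proj_ident
        toy_basis_in_toy_fock bounded_clinear_zero[OF bounded_clinear_toy_proj] dest: distinct_adj_ConsD)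
qed

lemma toy_X_eq:
  assumes "n > 0"
  shows "toy_X n i f = toy_proj n (field_op (toy_step n i) (toy_proj n f))"
  unfolding toy_X_def toy_create_eq[OF assms] toy_annihilate_eq[OF assms] field_op_def
  by (simp add: bounded_clinear_add[OF bounded_clinear_toy_proj])


section \<open>Freeness and distribution\<close>

lemma toy_X_basis:
  assumes "n > 0" "distinct_adj \<sigma>"
  shows "toy_X n i (toy_basis n \<sigma>) =
    (if \<sigma> \<noteq> [] \<and> hd \<sigma> = i then toy_basis n (tl \<sigma>) else toy_basis n (i # \<sigma>))"
  unfolding toy_X_def toy_create_def toy_annihilate_def toy_operator_basis[OF assms] by auto

lemma bounded_clinear_toy_X:
  assumes "n > 0"
  shows "bounded_clinear (toy_X n i)"
  unfolding toy_X_eq[OF assms, abs_def]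
  by (intro bounded_clinear_compose[OF bounded_clinear_toy_proj]
      bounded_clinear_compose[OF bounded_clinear_field_op] bounded_clinear_toy_proj square_integrable_toy_step)

lemma toy_proj_toy_X: "n > 0 \<Longrightarrow> toy_proj n (toy_X n i f) = toy_X n i f"
  by (simp add: toy_X_eq toy_proj_idem)

lemma toy_X_toy_proj: "n > 0 \<Longrightarrow> toy_X n i (toy_proj n f) = toy_X n i f"
  by (simp add: toy_X_eq toy_proj_idem)

lemma cinner_toy_X: "n > 0 \<Longrightarrow> cinner (toy_X n i f) g = cinner f (toy_X n i g)"
  by (simp add: toy_X_eq toy_proj_self_adjoint cinner_field_op square_integrable_toy_step)

lemma toy_X_in_operators_on:
  assumes n: "n > 0"
  shows "toy_X n i \<in> operators_on (toy_fock n)"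
  unfolding operators_on_def
proof (intro CollectI conjI allI impI)
  show "bounded_clinear (toy_X n i)" by (rule bounded_clinear_toy_X[OF n])
  show "toy_X n i ` toy_fock n \<subseteq> toy_fock n"
    using toy_proj_in by (auto simp: toy_X_eq[OF n])
  fix f assume "\<forall>g\<in>toy_fock n. cinner g f = 0"
  hence "toy_proj n f = 0" by (intro toy_proj_eq_zero) auto
  thus "toy_X n i f = 0"
    using toy_X_toy_proj[OF n, of i f] bounded_clinear_zero[OF bounded_clinear_toy_X[OF n, of i]] by simp
qed

text \<open>On adapted words \<open>toy_X n i\<close> toggles a leading letter \<open>i\<close>: the
  tail of an adapted word starting with \<open>i\<close> does not start with \<open>i\<close> again,
  so a second application undoes the first.\<close>

lemma toy_X_square:
  assumes n: "n > 0"
  shows "toy_X n i (toy_X n i f) = toy_proj n f"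
proof -
  have "toy_X n i (toy_X n i (toy_proj n f)) = toy_proj n f"
  proof (rule toy_fock_eqI[where U = "\<lambda>f. f"])
    show "bounded_clinear (\<lambda>f. toy_X n i (toy_X n i f))"
      by (intro bounded_clinear_compose[OF bounded_clinear_toy_X] bounded_clinear_toy_X n)
    show "toy_X n i (toy_X n i (toy_basis n \<sigma>)) = toy_basis n \<sigma>" if "distinct_adj \<sigma>" for \<sigma>
      using that by (cases \<sigma>) (auto simp: toy_X_basis[OF n] distinct_adj_Cons)
  qed (rule bounded_clinear_id, rule toy_proj_in)
  thus ?thesis by (simp add: toy_X_toy_proj[OF n])
qed

lemma generated_algebra_toy_X:
  assumes n: "n > 0" and "T \<in> generated_algebra (toy_fock n) {toy_X n i}"
  shows "\<exists>a b. T = (\<lambda>f. a *\<^sub>C toy_proj n f + b *\<^sub>C toy_X n i f)"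
  using assms(2)
proof induction
  case unit
  show ?case by (rule exI[of _ 1], rule exI[of _ 0]) (simp add: cscale_one)
next
  case (gen T)
  thus ?case by (intro exI[of _ 0] exI[of _ 1]) (simp add: cscale_one)
next
  case (add T U)
  then obtain a b c d where "T = (\<lambda>f. a *\<^sub>C toy_proj n f + b *\<^sub>C toy_X n i f)"
    "U = (\<lambda>f. c *\<^sub>C toy_proj n f + d *\<^sub>C toy_X n i f)" by blast
  thus ?case by (intro exI[of _ "a + c"] exI[of _ "b + d"]) (simp add: cscale_add_left algebra_simps)
next
  case (scale T c)
  then obtain a b where "T = (\<lambda>f. a *\<^sub>C toy_proj n f + b *\<^sub>C toy_X n i f)" by blast
  thus ?case by (intro exI[of _ "c * a"] exI[of _ "c * b"]) (simp add: cscale_add_right cscale_cscale)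
next
  case (mult T U)
  then obtain a b c d where TU: "T = (\<lambda>f. a *\<^sub>C toy_proj n f + b *\<^sub>C toy_X n i f)"
    "U = (\<lambda>f. c *\<^sub>C toy_proj n f + d *\<^sub>C toy_X n i f)" by blast
  note P = bounded_clinear_toy_proj[of n] and X = bounded_clinear_toy_X[OF n, of i]
  \<comment> \<open>Multiplication as in the group algebra of the two-element group, with the
    projection as unit.\<close>
  have "(T \<circ> U) f = (a * c + b * d) *\<^sub>C toy_proj n f + (a * d + b * c) *\<^sub>C toy_X n i f" for f
    by (simp add: TU bounded_clinear_add[OF P] bounded_clinear_add[OF X] bounded_clinear_cscale[OF P]
        bounded_clinear_cscale[OF X] toy_proj_idem toy_proj_toy_X[OF n] toy_X_toy_proj[OF n]
        toy_X_square[OF n] cscale_add_right cscale_add_left cscale_cscale algebra_simps)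
  thus ?case by (intro exI ext)
qed

lemma cinner_vacuum_toy_basis:
  "n > 0 \<Longrightarrow> cinner vacuum (toy_basis n \<sigma>) = of_bool (\<sigma> = [])"
  unfolding toy_basis_Nil[symmetric, of n] by (subst toy_basis_orthonormal) auto

lemma centered_generated_algebra_toy_X:
  assumes n: "n > 0" and T: "T \<in> generated_algebra (toy_fock n) {toy_X n i}" "vacuum_state T = 0"
  shows "\<exists>b. T = (\<lambda>f. b *\<^sub>C toy_X n i f)"
proof -
  obtain a b where ab: "T = (\<lambda>f. a *\<^sub>C toy_proj n f + b *\<^sub>C toy_X n i f)"
    using generated_algebra_toy_X[OF n T(1)] by blast
  have "T vacuum = a *\<^sub>C toy_basis n [] + b *\<^sub>C toy_basis n [i]"
    unfolding ab using toy_basis_in_toy_fock[of "[]" n] toy_X_basis[OF n, of "[]" i]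
    by (simp add: toy_basis_Nil toy_proj_ident)
  hence "a = 0"
    using T(2) by (simp add: vacuum_state_def cinner_add_right cinner_cscale_right cinner_vacuum_toy_basis[OF n])
  thus ?thesis using ab by auto
qed

text \<open>In the composition the last operator of the list acts first, so the word grows at its
  head; since neighbouring letters differ, every operator creates and none annihilates.\<close>

lemma foldr_toy_X_vacuum:
  assumes n: "n > 0"
  shows "length js = length bs \<Longrightarrow> distinct_adj js \<Longrightarrow>
    (\<forall>k<length bs. \<exists>b. bs ! k = (\<lambda>f. b *\<^sub>C toy_X n (js ! k) f)) \<Longrightarrow>
    \<exists>b. foldr (\<circ>) bs id vacuum = b *\<^sub>C toy_basis n js"
proof (induction js bs rule: list_induct2)
  case Nil
  show ?case by (rule exI[of _ 1]) (simp add: toy_basis_Nil cscale_one)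
next
  case (Cons j js u bs)
  have "\<forall>k<length bs. \<exists>b. bs ! k = (\<lambda>f. b *\<^sub>C toy_X n (js ! k) f)"
  proof (intro allI impI)
    fix k assume "k < length bs"
    thus "\<exists>b. bs ! k = (\<lambda>f. b *\<^sub>C toy_X n (js ! k) f)"
      using Cons.prems(2)[rule_format, of "Suc k"] by simp
  qed
  from Cons.IH[OF distinct_adj_ConsD[OF Cons.prems(1)] this]
  obtain b where b: "foldr (\<circ>) bs id vacuum = b *\<^sub>C toy_basis n js" ..
  obtain c where "u = (\<lambda>f. c *\<^sub>C toy_X n j f)"
    using Cons.prems(2)[rule_format, of 0] by auto
  hence "foldr (\<circ>) (u # bs) id vacuum = (c * b) *\<^sub>C toy_basis n (j # js)"
    using Cons.prems(1)
    by (auto simp: b bounded_clinear_cscale[OF bounded_clinear_toy_X[OF n]] cscale_cscale toy_X_basis[OF n]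
        distinct_adj_Cons)
  thus ?case ..
qed

lemma free_family_toy_X:
  assumes n: "n > 0"
  shows "free_family (toy_fock n) (toy_X n)"
  unfolding free_family_def free_algebras_def
proof (intro conjI allI impI)
  show "toy_X n i \<in> operators_on (toy_fock n)" for i by (rule toy_X_in_operators_on[OF n])
  fix js :: "nat list" and bs
  assume ne: "bs \<noteq> []" and len: "length js = length bs"
    and bs: "\<forall>k<length bs. bs ! k \<in> generated_algebra (toy_fock n) {toy_X n (js ! k)} \<and> vacuum_state (bs ! k) = 0"
    and js: "\<forall>k. Suc k < length js \<longrightarrow> js ! k \<noteq> js ! Suc k"
  have "distinct_adj js" using js by (auto simp: distinct_adj_conv_nth)
  moreover have "\<forall>k<length bs. \<exists>b. bs ! k = (\<lambda>f. b *\<^sub>C toy_X n (js ! k) f)"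
    using bs centered_generated_algebra_toy_X[OF n] by blast
  ultimately obtain b where "foldr (\<circ>) bs id vacuum = b *\<^sub>C toy_basis n js"
    using foldr_toy_X_vacuum[OF n len] by blast
  thus "vacuum_state (foldr (\<circ>) bs id) = 0"
    using ne len by (auto simp: vacuum_state_def cinner_cscale_right cinner_vacuum_toy_basis[OF n])
qed

text \<open>Starting from the vacuum only the words \<open>[]\<close> and \<open>[i]\<close> are
  ever reached; this parity is that of the moments of the symmetric two-point distribution.\<close>

lemma toy_X_power_vacuum:
  assumes n: "n > 0"
  shows "(toy_X n i ^^ k) vacuum = (if even k then vacuum else toy_basis n [i])"
proof (induction k)
  case (Suc k)
  thus ?case using toy_X_basis[OF n, of "[]" i] toy_X_basis[OF n, of "[i]" i] by (simp add: toy_basis_Nil)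
qed simp

lemma has_vacuum_distribution_toy_X:
  assumes n: "n > 0"
  shows "has_vacuum_distribution (toy_fock n) (toy_X n i) bernoulli"
  unfolding has_vacuum_distribution_def
proof (intro conjI allI)
  show "toy_X n i \<in> operators_on (toy_fock n)" by (rule toy_X_in_operators_on[OF n])
  show "cinner (toy_X n i f) g = cinner f (toy_X n i g)" for f g by (rule cinner_toy_X[OF n])
  show "prob_space bernoulli"
    unfolding bernoulli_def by (intro prob_space.prob_space_distr measure_pmf.prob_space_axioms) simp
  show "sets bernoulli = sets borel" by (simp add: bernoulli_def)
  have "AE x in bernoulli. x \<in> {-1, 1}"
    unfolding bernoulli_def by (subst AE_distr_iff) (auto simp: AE_measure_pmf_iff)
  thus "\<exists>K. compact K \<and> (AE x in bernoulli. x \<in> K)"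
    by (intro exI[of _ "{-1, 1 :: real}"]) (simp add: finite_imp_compact)
  fix k
  have "(\<integral>x. x ^ k \<partial>bernoulli) = (if even k then 1 else 0)"
    unfolding bernoulli_def by (subst integral_distr) (simp_all add: integral_pmf_of_set)
  moreover have "cinner vacuum vacuum = 1" using cinner_vacuum_toy_basis[OF n, of "[]"] by (simp add: toy_basis_Nil)
  ultimately show "vacuum_state (toy_X n i ^^ k) = of_real (\<integral>x. x ^ k \<partial>bernoulli)"
    by (simp add: vacuum_state_def toy_X_power_vacuum[OF n] cinner_vacuum_toy_basis[OF n])
qed


section \<open>Functions with vanishing interval integrals\<close>

lemma square_integrable_of_real:
  "square_integrable M h \<Longrightarrow> square_integrable M (\<lambda>x. complex_of_real (h x))"
  unfolding square_integrable_def by (auto intro: borel_measurable_continuous_on[rotated] continuous_intros)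

text \<open>Dominated convergence extends the hypothesis to real endpoints, a Dynkin argument to all
  Borel sets, and a function with vanishing integrals over all measurable sets is zero almost
  everywhere.\<close>

lemma AE_zero_if_interval_integrals_zero:
  fixes u :: "real \<Rightarrow> complex"
  assumes u: "square_integrable half_line u"
    and zero: "\<And>k l :: nat. (\<integral>y. of_real (indicator {0..<real k / real l} y) * u y \<partial>half_line) = 0"
  shows "AE y in half_line. u y = 0"
proof -
  have [measurable]: "u \<in> borel_measurable half_line" using u by (simp add: square_integrable_def)
  have int: "integrable half_line (\<lambda>y. of_real (indicator {0..<s} y) * u y)" for s
    using square_integrable_mult(1)[OF square_integrable_of_real[OF square_integrable_indicator_interval] u]
    by simp
  have meas [measurable]: "A \<in> sets borel \<Longrightarrow> indicat_real A \<in> borel_measurable half_line" for A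
    by (rule measurable_restrict_space1) simp
  have zero_real: "(\<integral>y. of_real (indicator {0..<s} y) * u y \<partial>half_line) = 0" for s
  proof (cases "s \<ge> 0")
    case True
    \<comment> \<open>Approximation from below makes the half-open indicators converge at every
      point, including the endpoint \<open>s\<close>.\<close>
    define q where "q l = real (nat \<lfloor>real (Suc l) * s\<rfloor>) / real (Suc l)" for l
    have q_le: "q l \<le> s" for l
      using True by (simp add: q_def divide_le_eq mult.commute)
    have "s - inverse (real (Suc l)) \<le> q l" for l
    proof -
      have "real (Suc l) * s - 1 \<le> of_int \<lfloor>real (Suc l) * s\<rfloor>" by linarith
      hence "(real (Suc l) * s - 1) / real (Suc l) \<le> q l"
        unfolding q_def using True by (intro divide_right_mono) (simp_all del: of_nat_Suc)
      thus ?thesis by (simp add: diff_divide_distrib inverse_eq_divide del: of_nat_Suc)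
    qed
    moreover have "(\<lambda>l. s - inverse (real (Suc l))) \<longlonglongrightarrow> s"
      using tendsto_diff[OF tendsto_const[of s] LIMSEQ_inverse_real_of_nat] by simp
    ultimately have q: "q \<longlonglongrightarrow> s"
      using q_le by (intro tendsto_sandwich[of "\<lambda>l. s - inverse (real (Suc l))" q sequentially "\<lambda>_. s"])
         (auto simp del: of_nat_Suc)
    have "(\<lambda>l. \<integral>y. of_real (indicator {0..<q l} y) * u y \<partial>half_line) \<longlonglongrightarrow>
        (\<integral>y. of_real (indicator {0..<s} y) * u y \<partial>half_line)"
    proof (rule integral_dominated_convergence[where w = "\<lambda>y. norm (of_real (indicator {0..<s} y) * u y)"])
      show "integrable half_line (\<lambda>y. norm (of_real (indicator {0..<s} y) * u y))"
        by (rule integrable_norm[OF int])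
      show "AE y in half_line. (\<lambda>l. of_real (indicator {0..<q l} y) * u y) \<longlonglongrightarrow>
          of_real (indicator {0..<s} y) * u y"
      proof (intro always_eventually allI)
        fix y
        have "\<forall>\<^sub>F l in sequentially. indicat_real {0..<q l} y = indicat_real {0..<s} y"
        proof (cases "y < s")
          case True
          with q have "\<forall>\<^sub>F l in sequentially. y < q l" by (intro order_tendstoD)
          thus ?thesis by eventually_elim (use True in \<open>auto simp: indicator_def\<close>)
        next
          case False
          hence "\<not> y < q l" for l using q_le[of l] by simp
          thus ?thesis using False by (simp add: indicator_def)
        qed
        hence "\<forall>\<^sub>F l in sequentially. of_real (indicator {0..<q l} y) * u y = of_real (indicator {0..<s} y) * u y"
          by eventually_elim simp
        thus "(\<lambda>l. of_real (indicator {0..<q l} y) * u y) \<longlonglongrightarrow> of_real (indicator {0..<s} y) * u y"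
          by (rule tendsto_eventually)
      qed
      show "AE y in half_line. norm (of_real (indicator {0..<q l} y) * u y) \<le>
          norm (of_real (indicator {0..<s} y) * u y)" for l
        using q_le[of l] by (intro always_eventually allI) (auto simp: indicator_def norm_mult)
      show "(\<lambda>y. of_real (indicator {0..<q l} y) * u y) \<in> borel_measurable half_line" for l
        by (rule borel_measurable_integrable[OF int])
    qed (rule borel_measurable_integrable[OF int])
    moreover have "(\<integral>y. of_real (indicator {0..<q l} y) * u y \<partial>half_line) = 0" for l
      unfolding q_def by (rule zero)
    ultimately show ?thesis by (simp add: LIMSEQ_const_iff)
  qed simp
  \<comment> \<open>The half line has infinite measure, so \<open>u\<close> itself may fail to be
    integrable; cutting off at \<open>K\<close> repairs this.\<close>
  have "AE y in half_line. of_real (indicator {0..<real K} y) * u y = 0" for K :: nat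
  proof (rule half_line.density_unique_banach[where f' = "\<lambda>_. 0"])
    let ?v = "\<lambda>y. of_real (indicator {0..<real K} y) * u y"
    show v: "integrable half_line ?v" by (rule int)
    have setint: "integrable half_line (\<lambda>y. indicator A y *\<^sub>R ?v y)" if "A \<in> sets borel" for A
    proof (rule Bochner_Integration.integrable_bound[OF v])
      show "(\<lambda>y. indicat_real A y *\<^sub>R ?v y) \<in> borel_measurable half_line"
        using that borel_measurable_integrable[OF v] meas by (intro borel_measurable_scaleR)
    qed (auto simp: indicator_def)
    \<comment> \<open>The rays \<open>{..<a}\<close> form an intersection-stable generator of the
      Borel sets. On them the cut-off integral is an interval integral, and complements work because
      the total integral is the one with s = K.\<close>
    have stable: "Int_stable (range lessThan :: real set set)"
    proof (rule Int_stableI)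
      fix a b :: "real set" assume "a \<in> range lessThan" "b \<in> range lessThan"
      then obtain x y where "a = {..<x}" "b = {..<y}" by auto
      hence "a \<inter> b = {..<min x y}" by auto
      thus "a \<inter> b \<in> range lessThan" by simp
    qed
    have sub: "(range lessThan :: real set set) \<subseteq> Pow UNIV" by simp
    have "(\<integral>y. indicator A y *\<^sub>R ?v y \<partial>half_line) = 0"
      if "A \<in> sigma_sets UNIV (range lessThan)" for A :: "real set"
      using stable sub that
    proof (induction A rule: sigma_sets_induct_disjoint)
      case (basic A)
      then obtain a where "A = {..<a}" by auto
      hence "indicator A y *\<^sub>R ?v y = of_real (indicator {0..<min a (real K)} y) * u y" for y
        by (simp add: indicator_def)
      thus ?case by (simp only: zero_real)
    next
      case empty
      show ?case by simp
    next
      case (compl A)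
      have A: "A \<in> sets borel" using compl(1) by (simp add: borel_Iio)
      have "(\<integral>y. indicator (UNIV - A) y *\<^sub>R ?v y \<partial>half_line) = (\<integral>y. ?v y - indicator A y *\<^sub>R ?v y \<partial>half_line)"
        by (intro Bochner_Integration.integral_cong) (auto simp: indicator_def)
      also have "\<dots> = 0"
        unfolding Bochner_Integration.integral_diff[OF v setint[OF A]] compl(2) zero_real by simp
      finally show ?case .
    next
      case (union A)
      have A: "A i \<in> sets borel" for i using union(2) by (auto simp: borel_Iio)
      \<comment> \<open>A Borel set need not be measurable for \<open>half_line\<close> before it is
        intersected with \<open>{0..}\<close>.\<close>
      have half: "(\<integral>y. indicator B y *\<^sub>R ?v y \<partial>half_line) = (LINT y:B \<inter> {0..}|half_line. ?v y)" for B
        unfolding set_lebesgue_integral_def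
        by (intro Bochner_Integration.integral_cong) (auto simp: indicator_def space_restrict_space)
      have "(\<Union>i. A i) \<in> sets borel" using A by auto
      from setint[OF this] have "integrable half_line (\<lambda>y. indicator (\<Union>i. A i \<inter> {0..}) y *\<^sub>R ?v y)"
        by (rule Bochner_Integration.integrable_cong[THEN iffD1, OF refl, rotated])
           (auto simp: indicator_def space_restrict_space)
      hence "(LINT y:(\<Union>i. A i \<inter> {0..})|half_line. ?v y) = (\<Sum>i. LINT y:A i \<inter> {0..}|half_line. ?v y)"
        using A union(1)
        by (intro lebesgue_integral_countable_add)
           (auto simp: set_integrable_def sets_restrict_space disjoint_family_on_def)
      moreover have "(LINT y:A i \<inter> {0..}|half_line. ?v y) = 0" for i
        unfolding half[symmetric] by (rule union(3))
      ultimately show ?case unfolding half by simp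
    qed
    moreover have "A \<in> sigma_sets UNIV (range lessThan)" if "A \<in> sets half_line" for A :: "real set"
    proof -
      have "A \<in> sets borel" using that by (auto simp: sets_restrict_space)
      thus ?thesis by (simp add: borel_Iio)
    qed
    ultimately show "set_lebesgue_integral half_line A ?v = set_lebesgue_integral half_line A (\<lambda>_. 0)"
      if "A \<in> sets half_line" for A
      using that by (simp add: set_lebesgue_integral_def)
  qed simp
  hence "AE y in half_line. \<forall>K::nat. of_real (indicator {0..<real K} y) * u y = 0"
    by (rule AE_all_countable[THEN iffD2, OF allI])
  thus ?thesis using AE_space[of half_line]
  proof eventually_elim
    case (elim y)
    obtain K :: nat where "y < real K" using reals_Archimedean2 by blast
    thus ?case using elim(1)[rule_format, of K] elim(2) by (simp add: space_restrict_space)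
  qed
qed

text \<open>By Tonelli almost every slice is square integrable. The exceptional null sets of the
  countably many pairs \<open>k\<close>, \<open>l\<close> unite to one null set, outside of which
  each slice satisfies the one-dimensional criterion.\<close>

lemma AE_zero_if_slice_integrals_zero:
  fixes g :: "(nat \<Rightarrow> real) \<Rightarrow> complex"
  assumes g: "square_integrable (particle (Suc m)) g"
    and zero: "\<And>k l :: nat. AE x in particle m.
      (\<integral>y. of_real (indicator {0..<real k / real l} y) * g (case_nat y x) \<partial>half_line) = 0"
  shows "AE z in particle (Suc m). g z = 0"
proof -
  have [measurable]: "g \<in> borel_measurable (particle (Suc m))" using g by (simp add: square_integrable_def)
  have g2 [measurable]: "(\<lambda>(x, y). g (case_nat y x)) \<in> borel_measurable (particle m \<Otimes>\<^sub>M half_line)"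
    using measurable_compose[OF measurable_case_nat_particle \<open>g \<in> _\<close>] by (simp add: case_prod_beta')
  let ?N = "\<lambda>x. \<integral>\<^sup>+y. ennreal ((norm (g (case_nat y x)))\<^sup>2) \<partial>half_line"
  have [measurable]: "?N \<in> borel_measurable (particle m)"
    by (rule half_line.borel_measurable_nn_integral) (use g2 in \<open>measurable\<close>)
  have N: "(\<integral>\<^sup>+z. ennreal ((norm (g z))\<^sup>2) \<partial>particle (Suc m)) = (\<integral>\<^sup>+x. ?N x \<partial>particle m)"
    by (rule nn_integral_particle_Suc) simp
  have "(\<integral>\<^sup>+z. ennreal ((norm (g z))\<^sup>2) \<partial>particle (Suc m)) < \<infinity>"
    using g by (simp add: square_integrable_iff_nn)
  hence "AE x in particle m. ?N x \<noteq> \<infinity>"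
    unfolding N by (intro nn_integral_PInf_AE) auto
  moreover have "AE x in particle m. \<forall>k l :: nat.
      (\<integral>y. of_real (indicator {0..<real k / real l} y) * g (case_nat y x) \<partial>half_line) = 0"
    using zero by (simp add: AE_all_countable)
  ultimately have "AE x in particle m. ?N x = 0" using AE_space[of "particle m"]
  proof eventually_elim
    case (elim x)
    have m [measurable]: "(\<lambda>y. g (case_nat y x)) \<in> borel_measurable half_line"
      using measurable_compose[OF measurable_Pair1'[OF elim(3)] g2] by simp
    have "square_integrable half_line (\<lambda>y. g (case_nat y x))"
      using elim(1) m by (auto simp: square_integrable_iff_nn top.not_eq_extremum)
    from AE_zero_if_interval_integrals_zero[OF this] elim(2)
    have "AE y in half_line. g (case_nat y x) = 0" by blast
    hence "AE y in half_line. ennreal ((norm (g (case_nat y x)))\<^sup>2) = 0"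
      by eventually_elim simp
    thus ?case by (subst nn_integral_0_iff_AE) auto
  qed
  hence "(\<integral>\<^sup>+x. ?N x \<partial>particle m) = 0" by (subst nn_integral_0_iff_AE) auto
  hence "(\<integral>\<^sup>+z. ennreal ((norm (g z))\<^sup>2) \<partial>particle (Suc m)) = 0" unfolding N .
  hence "AE z in particle (Suc m). ennreal ((norm (g z))\<^sup>2) = 0"
    by (subst (asm) nn_integral_0_iff_AE) auto
  thus ?thesis by eventually_elim simp
qed


section \<open>Strong convergence\<close>

lemma indicator_interval:
  assumes "0 \<le> a" "a \<le> b"
  shows square_integrable_interval: "square_integrable half_line (indicator {a..<b} :: real \<Rightarrow> real)"
    and hnorm_interval: "hnorm (indicator {a..<b}) = sqrt (b - a)"
proof -
  have "integrable lborel (indicator {a..<b} :: real \<Rightarrow> real)"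
    using assms by (auto intro!: integrable_real_indicator simp: emeasure_lborel_Ico)
  hence int: "integrable half_line (indicator {a..<b} :: real \<Rightarrow> real)"
    using integrable_mult_indicator[of "{0..}" lborel "indicator {a..<b} :: real \<Rightarrow> real"]
    by (subst integrable_restrict_space) simp_all
  have sq: "(indicator {a..<b} y :: real)\<^sup>2 = indicator {a..<b} y" for y
    by (simp add: indicator_def)
  show "square_integrable half_line (indicator {a..<b} :: real \<Rightarrow> real)"
    using int sq by (simp add: square_integrable_def borel_measurable_integrable)
  have "(\<integral>y. indicat_real {a..<b} y \<partial>half_line) = (\<integral>y. indicator {0..} y *\<^sub>R indicat_real {a..<b} y \<partial>lborel)"
    by (rule integral_restrict_space) simp
  also have "\<dots> = (\<integral>y. indicat_real {a..<b} y \<partial>lborel)"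
    by (intro Bochner_Integration.integral_cong) (use assms in \<open>auto simp: indicator_def\<close>)
  also have "\<dots> = b - a" using assms by simp
  finally show "hnorm (indicator {a..<b}) = sqrt (b - a)"
    by (simp add: hnorm_def sq)
qed

text \<open>The factor 1 fits the pattern \<open>h y + c * k y\<close> of the linear combination
  rules.\<close>

lemma indicator_interval_extend:
  fixes a b y :: real
  shows
  "0 \<le> a \<Longrightarrow> a \<le> b \<Longrightarrow> indicat_real {0..<b} y = indicator {0..<a} y + 1 * indicator {a..<b} y"
  by (auto simp: indicator_def)

text \<open>Cells are added one at a time; the factor 1 / sqrt n cancels the height sqrt n of
  \<open>toy_step\<close>. The parameter \<open>T\<close> stands for \<open>create\<close> or
  \<open>field_op\<close>.\<close>

lemma grid_sum:
  assumes n: "n > 0"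
    and T: "\<And>h k l c F. square_integrable half_line h \<Longrightarrow> square_integrable half_line k \<Longrightarrow>
      square_integrable half_line l \<Longrightarrow> (\<And>y. l y = h y + c * k y) \<Longrightarrow>
      T l F = T h F + complex_of_real c *\<^sub>C T k F"
  shows "T (indicator {0..<real N / real n}) F = of_real (1 / sqrt n) *\<^sub>C (\<Sum>i<N. T (toy_step n i) F)"
proof (induction N)
  case 0
  have "square_integrable half_line (indicator {0..<real 0 / real n} :: real \<Rightarrow> real)"
    by (rule square_integrable_indicator_interval)
  \<comment> \<open>All three functions are the zero function, so T 0 = T 0 + T 0.\<close>
  from T[OF this this this, of 1 F]
  have "T (indicator {0..<real 0 / real n}) F = 0" by (simp only: of_real_1 cscale_one) simp
  thus ?case by (simp only: lessThan_0 sum.empty complex_fock.scale_zero_right)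
next
  case (Suc N)
  have "indicat_real {0..<real (Suc N) / real n} y =
      indicator {0..<real N / real n} y + 1 / sqrt n * toy_step n N y" for y
  proof -
    have "1 / sqrt n * toy_step n N y = indicator {real N / real n..<real (Suc N) / real n} y"
      using n by (simp add: toy_step_def add.commute)
    thus ?thesis
      using indicator_interval_extend[of "real N / real n" "real (Suc N) / real n" y]
      by (simp add: divide_right_mono)
  qed
  from T[OF square_integrable_indicator_interval square_integrable_toy_step
      square_integrable_indicator_interval this, of F]
  show ?case unfolding Suc by (simp add: cscale_add_right)
qed

text \<open>The sum includes its upper index, so the number of cells is one more than that index;
  this is the source of \<open>Suc\<close>.\<close>

lemma toy_W_eq:
  assumes n: "n > 0"
  shows "toy_W n t f =
    toy_proj n (field_op (indicator {0..<real (Suc (nat \<lfloor>real n * t\<rfloor>)) / real n}) (toy_proj n f))"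
proof -
  let ?N = "Suc (nat \<lfloor>real n * t\<rfloor>)"
  have "field_op (indicator {0..<real ?N / real n}) (toy_proj n f) =
      of_real (1 / sqrt n) *\<^sub>C (\<Sum>i<?N. field_op (toy_step n i) (toy_proj n f))"
    by (rule grid_sum[OF n field_op_linear_combination])
  hence "toy_proj n (field_op (indicator {0..<real ?N / real n}) (toy_proj n f)) =
      of_real (1 / sqrt n) *\<^sub>C (\<Sum>i<?N. toy_X n i f)"
    by (simp only: bounded_clinear_cscale[OF bounded_clinear_toy_proj]
        bounded_clinear_sum[OF bounded_clinear_toy_proj] toy_X_eq[OF n])
  thus ?thesis
    unfolding toy_W_def scaleR_eq_cscale by (simp only: lessThan_Suc_atMost atLeast0AtMost)
qed

lemma bounded_clinear_toy_W:
  assumes "n > 0"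
  shows "bounded_clinear (toy_W n t)"
  unfolding toy_W_eq[OF assms, abs_def]
  by (intro bounded_clinear_compose[OF bounded_clinear_toy_proj]
      bounded_clinear_compose[OF bounded_clinear_field_op] bounded_clinear_toy_proj
      square_integrable_indicator_interval)

text \<open>The adapted words prevent a created particle from landing on the first cell of the state; this
  defect is what the next estimate controls.\<close>

lemma norm_create_grid_defect_le:
  assumes n: "n > 0" and g: "g \<in> toy_fock n"
  shows "norm (create (indicator {0..<real N / real n}) g -
    toy_proj n (create (indicator {0..<real N / real n}) g)) \<le> norm g / sqrt n"
proof -
  define T where "T g = create (indicator {0..<real N / real n}) g -
    toy_proj n (create (indicator {0..<real N / real n}) g)" for g
  have T: "bounded_clinear T"
    unfolding T_def
    by (intro bounded_clinear_minus bounded_clinear_compose[OF bounded_clinear_toy_proj]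
        bounded_clinear_create square_integrable_indicator_interval)
  \<comment> \<open>The weight of the only cell that can spoil adaptedness, the one of the first
    letter; it contributes only if that cell lies among the first \<open>N\<close>.\<close>
  define d :: "nat list \<Rightarrow> complex" where
    "d \<sigma> = (if \<sigma> \<noteq> [] \<and> hd \<sigma> < N then of_real (1 / sqrt n) else 0)" for \<sigma>
  have Tb: "T (toy_basis n \<sigma>) = d \<sigma> *\<^sub>C toy_basis n (hd \<sigma> # \<sigma>)" if \<sigma>: "distinct_adj \<sigma>" for \<sigma>
  proof -
    have create: "create (indicator {0..<real N / real n}) (toy_basis n \<sigma>) =
        of_real (1 / sqrt n) *\<^sub>C (\<Sum>i<N. toy_basis n (i # \<sigma>))"
      unfolding create_toy_basis[symmetric] by (rule grid_sum[OF n create_linear_combination])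
    have defect: "toy_basis n (i # \<sigma>) - toy_proj n (toy_basis n (i # \<sigma>)) =
        (if \<sigma> \<noteq> [] \<and> i = hd \<sigma> then toy_basis n (hd \<sigma> # \<sigma>) else 0)" for i
      using \<sigma> by (auto simp: toy_proj_ident toy_basis_in_toy_fock toy_proj_basis_nonadapted[OF n] distinct_adj_Cons)
    have "T (toy_basis n \<sigma>) = of_real (1 / sqrt n) *\<^sub>C
        ((\<Sum>i<N. toy_basis n (i # \<sigma>)) - (\<Sum>i<N. toy_proj n (toy_basis n (i # \<sigma>))))"
      unfolding T_def create bounded_clinear_cscale[OF bounded_clinear_toy_proj]
        bounded_clinear_sum[OF bounded_clinear_toy_proj]
      by (rule bounded_linear.linear[OF bounded_linear_cscale, THEN linear_diff, symmetric])
    also have "(\<Sum>i<N. toy_basis n (i # \<sigma>)) - (\<Sum>i<N. toy_proj n (toy_basis n (i # \<sigma>))) =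
        (\<Sum>i<N. if \<sigma> \<noteq> [] \<and> i = hd \<sigma> then toy_basis n (hd \<sigma> # \<sigma>) else 0)"
      unfolding sum_subtractf[symmetric] defect ..
    also have "\<dots> = (if \<sigma> \<noteq> [] \<and> hd \<sigma> < N then toy_basis n (hd \<sigma> # \<sigma>) else 0)"
      by (cases "\<sigma> = []") auto
    finally show ?thesis by (auto simp: d_def)
  qed
  have "norm (T g) \<le> norm g / sqrt n"
  proof (rule toy_fock_induct[OF _ _ g])
    show "closed {f. norm (T f) \<le> norm f / sqrt n}"
      by (intro closed_Collect_le continuous_intros
          linear_continuous_on[OF bounded_clinear_bounded_linear[OF T]]) (use n in auto)
    fix A :: "nat list set" and c :: "nat list \<Rightarrow> complex"
    assume A: "finite A" "A \<subseteq> {\<sigma>. distinct_adj \<sigma>}"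
    let ?f = "\<Sum>\<sigma>\<in>A. c \<sigma> *\<^sub>C toy_basis n \<sigma>"
    \<comment> \<open>Doubling the first letter is injective on words, so the defects of distinct
      words are orthogonal and the bound on single coefficients carries over to the norm.\<close>
    have "T ?f = (\<Sum>\<sigma>\<in>A. (c \<sigma> * d \<sigma>) *\<^sub>C toy_basis n (hd \<sigma> # \<sigma>))"
      unfolding bounded_clinear_sum[OF T] bounded_clinear_cscale[OF T] cscale_cscale[symmetric]
      by (intro sum.cong) (use A Tb in auto)
    hence "(norm (T ?f))\<^sup>2 = (\<Sum>\<sigma>\<in>A. (norm (c \<sigma> * d \<sigma>))\<^sup>2)"
      using norm_sum_toy_basis[OF n A(1), of "\<lambda>\<sigma>. hd \<sigma> # \<sigma>" "\<lambda>\<sigma>. c \<sigma> * d \<sigma>"] by (simp add: inj_on_def)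
    also have "\<dots> \<le> (\<Sum>\<sigma>\<in>A. (norm (c \<sigma>))\<^sup>2 * (1 / n))"
      by (intro sum_mono) (auto simp: d_def norm_mult norm_divide power_mult_distrib power_divide)
    also have "\<dots> = (norm ?f)\<^sup>2 * (1 / n)"
      using norm_sum_toy_basis[OF n A(1), of "\<lambda>\<sigma>. \<sigma>" c] by (simp only: sum_distrib_right inj_on_id2)
    also have "\<dots> = (norm ?f / sqrt n)\<^sup>2" by (simp add: power_divide)
    finally show "norm (T ?f) \<le> norm ?f / sqrt n"
      by (rule power2_le_imp_le) simp
  qed
  thus ?thesis by (simp only: T_def)
qed

text \<open>For t \<ge> 0 and n > 0, the least grid point strictly beyond \<open>t\<close>.\<close>

definition grid_end :: "nat \<Rightarrow> real \<Rightarrow> real" where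
  "grid_end n t = real (Suc (nat \<lfloor>real n * t\<rfloor>)) / real n"

lemma grid_end:
  assumes "n > 0" "t \<ge> 0"
  shows "t \<le> grid_end n t" "grid_end n t - t \<le> 1 / real n"
proof -
  have "real (nat \<lfloor>real n * t\<rfloor>) = of_int \<lfloor>real n * t\<rfloor>" using assms by simp
  hence "real n * t \<le> real (Suc (nat \<lfloor>real n * t\<rfloor>))" "real (Suc (nat \<lfloor>real n * t\<rfloor>)) \<le> real n * t + 1"
    by linarith+
  thus "t \<le> grid_end n t" "grid_end n t - t \<le> 1 / real n"
    using assms(1) by (simp_all add: grid_end_def field_simps)
qed

text \<open>The two indicators differ by that of an interval of length at most 1 / n, whose L^2 norm
  is at most 1 / sqrt n. Thus moving the endpoint costs little even in operator norm.\<close>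

lemma grid_approximation:
  assumes n: "n > 0" and t: "t \<ge> 0"
  shows norm_create_grid_le:
      "norm (create (indicator {0..<grid_end n t}) F - create (indicator {0..<t}) F) \<le> norm F / sqrt n"
    and norm_field_op_grid_le:
      "norm (field_op (indicator {0..<grid_end n t}) F - field_op (indicator {0..<t}) F) \<le> 2 * norm F / sqrt n"
proof -
  let ?k = "indicat_real {t..<grid_end n t}"
  have k: "square_integrable half_line ?k" "hnorm ?k = sqrt (grid_end n t - t)"
    using indicator_interval[OF t grid_end(1)[OF n t]] by auto
  have hk: "hnorm ?k \<le> 1 / sqrt n"
    using real_sqrt_le_mono[OF grid_end(2)[OF n t]] by (simp add: k(2) real_sqrt_divide)
  note comb = square_integrable_indicator_interval k(1) square_integrable_indicator_interval
    indicator_interval_extend[OF t grid_end(1)[OF n t]]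
  have "norm (create (indicator {0..<grid_end n t}) F - create (indicator {0..<t}) F) = hnorm ?k * norm F"
    unfolding create_linear_combination[OF comb] by (simp add: cscale_one norm_create[OF k(1)])
  also have "\<dots> \<le> 1 / sqrt n * norm F" by (intro mult_right_mono hk) simp
  finally show "norm (create (indicator {0..<grid_end n t}) F - create (indicator {0..<t}) F) \<le> norm F / sqrt n"
    by simp
  have "norm (field_op (indicator {0..<grid_end n t}) F - field_op (indicator {0..<t}) F) \<le> 2 * hnorm ?k * norm F"
    unfolding field_op_linear_combination[OF comb] using norm_field_op_le[OF k(1), of F] by (simp add: cscale_one)
  also have "\<dots> \<le> 2 * (1 / sqrt n) * norm F" by (intro mult_right_mono mult_left_mono hk) simp_all
  finally show "norm (field_op (indicator {0..<grid_end n t}) F - field_op (indicator {0..<t}) F) \<le> 2 * norm F / sqrt n"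
    by simp
qed

section \<open>Strong convergence of the projections to the identity\<close>

lemma inverse_sqrt_tendsto_zero: "(\<lambda>n. c / sqrt (real n)) \<longlonglongrightarrow> 0"
  by real_asymp

text \<open>The candidate in the toy space is the projection of the vector created from
  \<open>toy_proj n f\<close> by the grid interval. Its error has three sources: replacing
  \<open>f\<close> by its projection, moving the endpoint to the grid, and the defect of
  adaptedness.\<close>

lemma toy_proj_create_tendsto:
  assumes f: "(\<lambda>n. toy_proj n f) \<longlonglongrightarrow> f" and s: "s \<ge> 0"
  shows "(\<lambda>n. toy_proj n (create (indicator {0..<s}) f)) \<longlonglongrightarrow> create (indicator {0..<s}) f"
proof -
  let ?h = "indicat_real {0..<s}" and ?v = "create (indicator {0..<s}) f"
  let ?b = "\<lambda>n. hnorm ?h * norm (f - toy_proj n f) + (norm f / sqrt n + norm f / sqrt n)"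
  have h: "square_integrable half_line ?h" by (rule square_integrable_indicator_interval)
  have le: "norm (toy_proj n ?v - ?v) \<le> ?b n" if n: "n > 0" for n
  proof -
    let ?g = "toy_proj n f" and ?hn = "indicat_real {0..<grid_end n s}"
    have "norm (?v - toy_proj n ?v) \<le> norm (?v - toy_proj n (create ?hn ?g))"
      by (rule norm_diff_toy_proj_le[OF toy_proj_in])
    also have "?v - toy_proj n (create ?hn ?g) = (create ?h f - create ?h ?g) +
        ((create ?h ?g - create ?hn ?g) + (create ?hn ?g - toy_proj n (create ?hn ?g)))" by simp
    also have "norm \<dots> \<le> norm (create ?h f - create ?h ?g) +
        (norm (create ?h ?g - create ?hn ?g) + norm (create ?hn ?g - toy_proj n (create ?hn ?g)))"
      by (intro order_trans[OF norm_triangle_ineq] add_left_mono norm_triangle_ineq)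
    also have "\<dots> \<le> ?b n"
    proof (intro add_mono)
      show "norm (create ?h f - create ?h ?g) \<le> hnorm ?h * norm (f - ?g)"
        unfolding bounded_clinear_diff[OF bounded_clinear_create[OF h], symmetric] norm_create[OF h] ..
      have g: "norm ?g / sqrt n \<le> norm f / sqrt n"
        by (intro divide_right_mono norm_toy_proj_le) simp
      show "norm (create ?h ?g - create ?hn ?g) \<le> norm f / sqrt n"
        using norm_create_grid_le[OF n s, of ?g] g by (simp add: norm_minus_commute)
      show "norm (create ?hn ?g - toy_proj n (create ?hn ?g)) \<le> norm f / sqrt n"
        using norm_create_grid_defect_le[OF n toy_proj_in[of n f], of "Suc (nat \<lfloor>real n * s\<rfloor>)"] g
        by (simp only: grid_end_def)
    qed
    finally show ?thesis by (simp add: norm_minus_commute)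
  qed
  have "?b \<longlonglongrightarrow> hnorm ?h * norm (f - f) + (0 + 0)"
    by (intro tendsto_intros inverse_sqrt_tendsto_zero f)
  hence b: "?b \<longlonglongrightarrow> 0" by simp
  have "(\<lambda>n. toy_proj n ?v - ?v) \<longlonglongrightarrow> 0"
    by (rule Lim_null_comparison[OF eventually_mono[OF eventually_gt_at_top[of 0] le] b])
  thus ?thesis by (simp add: LIM_zero_iff)
qed

text \<open>Closedness rests on the uniform bound 1 for the norms of the projections, through an e /
  3 argument.\<close>

lemma closed_csubspace_toy_limit: "closed_csubspace {f. (\<lambda>n. toy_proj n f) \<longlonglongrightarrow> f}"
  unfolding closed_csubspace_def complex_fock.subspace_def
proof (intro conjI ballI allI)
  note P = bounded_clinear_toy_proj
  show "closed {f. (\<lambda>n. toy_proj n f) \<longlonglongrightarrow> f}"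
    unfolding closed_sequential_limits
  proof (intro allI impI, elim conjE)
    fix g f assume g: "\<forall>k. g k \<in> {f. (\<lambda>n. toy_proj n f) \<longlonglongrightarrow> f}" and gf: "g \<longlonglongrightarrow> f"
    have "\<forall>\<^sub>F n in sequentially. dist (toy_proj n f) f < e" if e: "e > 0" for e
    proof -
      have "\<forall>\<^sub>F k in sequentially. dist (g k) f < e / 3" using gf e by (intro tendstoD) auto
      then obtain k where k: "norm (f - g k) < e / 3"
        by (auto simp: eventually_sequentially dist_norm norm_minus_commute)
      have "\<forall>\<^sub>F n in sequentially. dist (toy_proj n (g k)) (g k) < e / 3"
        using g e by (intro tendstoD) auto
      thus ?thesis
      proof eventually_elim
        case (elim n)
        have "toy_proj n f - f = toy_proj n (f - g k) + ((toy_proj n (g k) - g k) - (f - g k))"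
          by (simp add: bounded_clinear_diff[OF P])
        also have "norm \<dots> \<le> norm (toy_proj n (f - g k)) + (norm (toy_proj n (g k) - g k) + norm (f - g k))"
          by (intro order_trans[OF norm_triangle_ineq] add_left_mono norm_triangle_ineq4)
        also have "\<dots> < e"
          using k elim norm_toy_proj_le[of n "f - g k"] by (simp add: dist_norm)
        finally show ?case by (simp add: dist_norm)
      qed
    qed
    thus "f \<in> {f. (\<lambda>n. toy_proj n f) \<longlonglongrightarrow> f}" by (simp add: tendsto_iff)
  qed
  show "0 \<in> {f. (\<lambda>n. toy_proj n f) \<longlonglongrightarrow> f}" by (simp add: bounded_clinear_zero[OF P])
  show "f + g \<in> {f. (\<lambda>n. toy_proj n f) \<longlonglongrightarrow> f}"
    if "f \<in> {f. (\<lambda>n. toy_proj n f) \<longlonglongrightarrow> f}" "g \<in> {f. (\<lambda>n. toy_proj n f) \<longlonglongrightarrow> f}" for f g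
    using that by (simp add: bounded_clinear_add[OF P] tendsto_add)
  show "c *\<^sub>C f \<in> {f. (\<lambda>n. toy_proj n f) \<longlonglongrightarrow> f}"
    if "f \<in> {f. (\<lambda>n. toy_proj n f) \<longlonglongrightarrow> f}" for c f
    using that by (simp add: bounded_clinear_cscale[OF P] bounded_linear.tendsto[OF bounded_linear_cscale])
qed

text \<open>Cyclicity of the vacuum. For \<open>u\<close> orthogonal to \<open>H\<close> the
  annihilated vector is too, and its \<open>m\<close>-particle component consists of the slice
  integrals of the next component of \<open>u\<close>; if they all vanish, so does that
  component.\<close>

lemma fock_cyclic:
  assumes H: "closed_csubspace H" and vac: "vacuum \<in> H"
    and create: "\<And>f s. f \<in> H \<Longrightarrow> s \<ge> 0 \<Longrightarrow> create (indicator {0..<s}) f \<in> H"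
  shows "H = UNIV"
proof (rule closed_csubspace_eq_UNIV[OF H])
  \<comment> \<open>The vector \<open>u\<close> varies in the induction, because the hypothesis is
    applied to its annihilated images.\<close>
  have AE: "fock_fun u \<Longrightarrow> (\<And>g. g \<in> H \<Longrightarrow> cinner g (abs_fock u) = 0) \<Longrightarrow> AE x in particle m. u m x = 0" for m u
  proof (induction m arbitrary: u)
    case 0
    have r: "fock_rel u u" using 0(1) by (simp add: fock_rel_self_iff)
    have "0 = cinner vacuum (abs_fock u)" using 0(2)[OF vac] by simp
    also have "\<dots> = (\<Sum>m. \<integral>x. cnj (if m = 0 then 1 else 0) * u m x \<partial>particle m)"
      unfolding vacuum_def by (rule cinner.abs_eq[OF vacuum.rsp r])
    also have "\<dots> = (\<Sum>m. if m = 0 then \<integral>x. u 0 x \<partial>particle 0 else 0)"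
      by (intro suminf_cong) auto
    also have "\<dots> = (\<integral>x. u 0 x \<partial>particle 0)"
      by (subst suminf_finite[of "{0}"]) auto
    \<comment> \<open>\<open>particle 0\<close> is a single point of mass 1, so the integral is an
      evaluation.\<close>
    also have "\<dots> = u 0 (\<lambda>_. undefined)"
      by (simp add: particle_def PiM_empty lebesgue_integral_count_space_finite)
    finally have "u 0 (\<lambda>_. undefined) = 0" ..
    moreover have "particle 0 = count_space {\<lambda>_. undefined}" by (simp add: particle_def PiM_empty)
    ultimately show ?case by (simp only: AE_count_space) simp
  next
    case (Suc m)
    have r: "fock_rel u u" using Suc(2) by (simp add: fock_rel_self_iff)
    have "AE x in particle m. (\<integral>y. of_real (indicator {0..<real k / real l} y) * u (Suc m) (case_nat y x) \<partial>half_line) = 0"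
      for k l :: nat
    proof -
      let ?h = "indicat_real {0..<real k / real l}"
      let ?a = "\<lambda>m x. if square_integrable half_line ?h
          then \<integral>y. of_real (?h y) * u (Suc m) (case_nat y x) \<partial>half_line else 0 :: complex"
      have h: "square_integrable half_line ?h" by (rule square_integrable_indicator_interval)
      have "annihilate ?h (abs_fock u) = abs_fock ?a" by (rule annihilate.abs_eq[OF r])
      hence "cinner g (abs_fock ?a) = 0" if "g \<in> H" for g
        using Suc(3)[OF create[OF that, of "real k / real l"]] cinner_create[OF h, of g "abs_fock u"]
        by (simp only: zero_le_divide_iff of_nat_0_le_iff simp_thms)
      moreover have "fock_fun ?a"
        using annihilate.rsp[THEN rel_funD, OF refl[of ?h], THEN rel_funD, OF r] by (simp only: fock_rel_self_iff)
      ultimately have "AE x in particle m. ?a m x = 0" by (intro Suc.IH)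
      thus ?thesis using h by simp
    qed
    thus ?case
      using Suc(2) by (intro AE_zero_if_slice_integrals_zero) (auto simp: fock_fun_def)
  qed
  fix f assume f: "\<And>g. g \<in> H \<Longrightarrow> cinner g f = 0"
  obtain u where u: "fock_fun u" "f = abs_fock u" using ex_abs_fock by blast
  have "fock_rel u (\<lambda>m x. 0)"
    using AE[OF u(1)] f u by (simp add: fock_rel_def fock_fun_zero)
  thus "f = 0" unfolding u(2) zero_fock_def by (rule Quotient_rel_abs[OF Quotient_fock])
qed

lemma toy_proj_tendsto: "(\<lambda>n. toy_proj n f) \<longlonglongrightarrow> f"
proof -
  have "{f. (\<lambda>n. toy_proj n f) \<longlonglongrightarrow> f} = UNIV"
  proof (rule fock_cyclic[OF closed_csubspace_toy_limit])
    have "toy_proj n vacuum = vacuum" for n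
      using toy_basis_in_toy_fock[of "[]" n] by (simp add: toy_basis_Nil toy_proj_ident)
    thus "vacuum \<in> {f. (\<lambda>n. toy_proj n f) \<longlonglongrightarrow> f}" by simp
  qed (simp add: toy_proj_create_tendsto)
  thus ?thesis by blast
qed

text \<open>The error splits into the moved endpoint, the inner projection acting on
  \<open>f\<close>, and the outer projection acting on the limit vector; the uniform norm bounds
  reduce each to a known limit.\<close>

lemma toy_W_tendsto:
  assumes t: "t \<ge> 0"
  shows "(\<lambda>n. toy_W n t f) \<longlonglongrightarrow> free_brownian t f"
proof -
  let ?h = "indicat_real {0..<t}"
  let ?v = "field_op ?h f"
  let ?b = "\<lambda>n. 2 * norm f / sqrt n + (2 * hnorm ?h * norm (toy_proj n f - f) + norm (toy_proj n ?v - ?v))"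
  have h: "square_integrable half_line ?h" by (rule square_integrable_indicator_interval)
  have brownian: "free_brownian t f = ?v" by (simp add: free_brownian_def field_op_def)
  have le: "norm (toy_W n t f - ?v) \<le> ?b n" if n: "n > 0" for n
  proof -
    let ?g = "toy_proj n f" and ?hn = "indicat_real {0..<grid_end n t}"
    note diff = bounded_clinear_diff[OF bounded_clinear_toy_proj]
    have eq: "toy_W n t f - ?v = toy_proj n (field_op ?hn ?g - field_op ?h ?g) +
        (toy_proj n (field_op ?h (?g - f)) + (toy_proj n ?v - ?v))"
    proof -
      have "toy_W n t f = toy_proj n (field_op ?hn ?g)"
        by (simp only: toy_W_eq[OF n] grid_end_def)
      moreover have "toy_proj n (field_op ?hn ?g - field_op ?h ?g) =
          toy_proj n (field_op ?hn ?g) - toy_proj n (field_op ?h ?g)"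
        by (rule diff)
      moreover have "toy_proj n (field_op ?h (?g - f)) = toy_proj n (field_op ?h ?g) - toy_proj n ?v"
        by (simp only: diff bounded_clinear_diff[OF bounded_clinear_field_op[OF h]])
      ultimately show ?thesis by simp
    qed
    have "norm (toy_W n t f - ?v) \<le> norm (toy_proj n (field_op ?hn ?g - field_op ?h ?g)) +
        (norm (toy_proj n (field_op ?h (?g - f))) + norm (toy_proj n ?v - ?v))"
      unfolding eq by (intro order_trans[OF norm_triangle_ineq] add_left_mono norm_triangle_ineq)
    also have "\<dots> \<le> ?b n"
    proof (rule add_mono[OF _ add_mono[OF _ order_refl]])
      have "norm (field_op ?hn ?g - field_op ?h ?g) \<le> 2 * norm ?g / sqrt n"
        by (rule norm_field_op_grid_le[OF n t])
      also have "\<dots> \<le> 2 * norm f / sqrt n"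
        by (intro divide_right_mono mult_left_mono norm_toy_proj_le) simp_all
      finally show "norm (toy_proj n (field_op ?hn ?g - field_op ?h ?g)) \<le> 2 * norm f / sqrt n"
        by (rule order_trans[OF norm_toy_proj_le])
      show "norm (toy_proj n (field_op ?h (?g - f))) \<le> 2 * hnorm ?h * norm (?g - f)"
        by (rule order_trans[OF norm_toy_proj_le norm_field_op_le[OF h]])
    qed
    finally show ?thesis .
  qed
  have "?b \<longlonglongrightarrow> 0 + (2 * hnorm ?h * norm (f - f) + norm (?v - ?v))"
    by (intro tendsto_intros inverse_sqrt_tendsto_zero toy_proj_tendsto)
  hence b: "?b \<longlonglongrightarrow> 0" by simp
  have "(\<lambda>n. toy_W n t f - ?v) \<longlonglongrightarrow> 0"
    by (rule Lim_null_comparison[OF eventually_mono[OF eventually_gt_at_top[of 0] le] b])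
  thus ?thesis unfolding brownian by (simp add: LIM_zero_iff)
qed

text \<open>The topology is the pullback, along \<open>blinfun_apply\<close>, of the product
  topology on functions, where convergence is componentwise.\<close>

lemma limitin_strong_operator_topology:
  "limitin strong_operator_topology T S F \<longleftrightarrow> (\<forall>f. ((\<lambda>n. blinfun_apply (T n) f) \<longlongrightarrow> blinfun_apply S f) F)"
proof -
  have "limitin strong_operator_topology T S F \<longleftrightarrow>
      limitin euclidean (\<lambda>n. blinfun_apply (T n)) (blinfun_apply S) F"
    (is "?L \<longleftrightarrow> ?R")
  proof
    assume L: ?L
    show ?R
      unfolding limitin_def
    proof (intro conjI allI impI)
      fix U assume "openin euclidean U \<and> blinfun_apply S \<in> U"
      hence "openin strong_operator_topology (blinfun_apply -` U)" "S \<in> blinfun_apply -` U"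
        by (auto simp: strong_operator_topology_def openin_pullback_topology)
      from limitinD[OF L this] show "\<forall>\<^sub>F n in F. blinfun_apply (T n) \<in> U" by simp
    qed simp
  next
    assume R: ?R
    show ?L
      unfolding limitin_def
    proof (intro conjI allI impI)
      fix U assume "openin strong_operator_topology U \<and> S \<in> U"
      then obtain V where V: "openin euclidean V" "U = blinfun_apply -` V" "blinfun_apply S \<in> V"
        by (auto simp: strong_operator_topology_def openin_pullback_topology)
      from limitinD[OF R V(1,3)] show "\<forall>\<^sub>F n in F. T n \<in> U" by (simp add: V(2))
    qed (simp add: strong_operator_topology_topspace)
  qed
  also have "\<dots> \<longleftrightarrow> (\<forall>f. ((\<lambda>n. blinfun_apply (T n) f) \<longlongrightarrow> blinfun_apply S f) F)"
    by (simp add: euclidean_product_topology[symmetric] limitin_componentwise)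
  finally show ?thesis .
qed

text \<open>\<open>Blinfun\<close> represents a map faithfully only if that map is bounded and
  linear; for \<open>toy_W\<close> this is established for n > 0, hence the passage through eventual
  equality.\<close>

lemma strong_operator_limit_toy_W:
  assumes t: "t \<ge> 0"
  shows "strong_operator_limit (\<lambda>n. toy_W n t) (free_brownian t)"
  unfolding strong_operator_limit_def
proof (intro conjI)
  show W: "\<forall>\<^sub>F n in sequentially. bounded_clinear (toy_W n t)"
    using eventually_gt_at_top[of 0] by eventually_elim (rule bounded_clinear_toy_W)
  show B: "bounded_clinear (free_brownian t)"
    using bounded_clinear_field_op[OF square_integrable_indicator_interval, of t]
    by (simp add: field_op_def[abs_def] free_brownian_def[abs_def])
  show "limitin strong_operator_topology (\<lambda>n. Blinfun (toy_W n t)) (Blinfun (free_brownian t)) sequentially"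
    unfolding limitin_strong_operator_topology
  proof
    fix f
    have "\<forall>\<^sub>F n in sequentially. toy_W n t f = blinfun_apply (Blinfun (toy_W n t)) f"
      using W by eventually_elim (simp add: bounded_linear_Blinfun_apply bounded_clinear_bounded_linear)
    with toy_W_tendsto[OF t, of f]
    show "(\<lambda>n. blinfun_apply (Blinfun (toy_W n t)) f) \<longlonglongrightarrow> blinfun_apply (Blinfun (free_brownian t)) f"
      by (simp add: bounded_linear_Blinfun_apply bounded_clinear_bounded_linear[OF B] tendsto_cong)
  qed
qed

theorem proposition4:
  shows "(\<forall>n\<ge>1. free_family (toy_fock n) (toy_X n) \<and>
            (\<forall>i. has_vacuum_distribution (toy_fock n) (toy_X n i) bernoulli)) \<and>
         (\<forall>t\<ge>0. strong_operator_limit (\<lambda>n. toy_W n t) (free_brownian t))"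
  using free_family_toy_X has_vacuum_distribution_toy_X strong_operator_limit_toy_W by simp

end
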